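(* A graph class $\mathcal C$ has bounded expansion if and only if $\mathcal C$ has bounded merge-width and is weakly sparse, i.e. there is $t\in\mathbb N$ such that no graph in $\mathcal C$ contains the biclique $K_{t,t}$ as a subgraph.
   Context: Graphs are finite, simple and undirected: $G=(V,E(G))$ with $E(G)\subseteq\binom V2$. Subgraphs are not necessarily induced. Bounded expansion. A graph class $\mathcal C$ has bounded expansion if for every $r\in\mathbb N$ there is $k\in\mathbb R$ such that for every graph $H$ which can be obtained from some graph in $\mathcal C$ by first removing vertices and edges, and then contracting some pairwise disjoint vertex subsets inducing connected subgraphs of radius at most $r$ to single vertices, we have $|E(H)|\le k\cdot|V(H)|$. Merge-width. A construction sequence on $V$ is a sequence of steps maintaining a partition $\mathcal P$ of $V$ and a partition of $\binom V2$ into edges $E$, non-edges $N$, and unresolved pairs $U$. Initially $\mathcal P$ is the partition into singletons and $U=\binom V2$. In each step one of three operations is performed: merge two parts $A,B\in\mathcal P$, replacing them by $A\cup B$; resolve positively a pair of parts $A,B\in\mathcal P$ (possibly $A=B$), moving all $\{a,b\}\in U$ with $a\in A,b\in B$ from $U$ to $E$; or resolve negatively such a pair of parts, moving these pairs from $U$ to $N$. In the end $\mathcal P$ has one part and $U=\emptyset$; it is then a construction sequence of the graph $(V,E)$. Its radius-$r$ width is the least $k$ such that at every step, for every $v\in V$, at most $k$ parts of the current $\mathcal P$ contain a vertex reachable from $v$ by a path of length at most $r$ in the graph $(V,E\cup N)$ for the current $E,N$. The radius-$r$ merge-width $\mathrm{mw}_r(G)$ is the least radius-$r$ width of a construction sequence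 of $G$. A graph class $\mathcal C$ has bounded merge-width if $\sup_{G\in\mathcal C}\mathrm{mw}_r(G)<\infty$ for every $r\in\mathbb N$. *)

theory Defs
  imports Main "HOL-Library.Extended_Nat" "HOL-Library.Ramsey" "HOL-Library.Disjoint_Sets"
begin

section \<open>Graphs\<close>

text \<open>A graph is a pair of a vertex set and a set of two-element subsets of it; the notation
  \<open>[V]\<^bsup>2\<^esup>\<close> is the one of the Ramsey theory. The empty graph is allowed.\<close>

type_synonym 'a graph = "'a set \<times> 'a set set"

abbreviation verts :: "'a graph \<Rightarrow> 'a set" where "verts \<equiv> fst"
abbreviation edges :: "'a graph \<Rightarrow> 'a set set" where "edges \<equiv> snd"

definition simple_graph :: "'a graph \<Rightarrow> bool" where
  "simple_graph G \<longleftrightarrow> edges G \<subseteq> [verts G]\<^bsup>2\<^esup>"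

definition finite_simple_graph :: "'a graph \<Rightarrow> bool" where
  "finite_simple_graph G \<longleftrightarrow> finite (verts G) \<and> simple_graph G"

definition subgraph :: "'a graph \<Rightarrow> 'a graph \<Rightarrow> bool" where
  "subgraph H G \<longleftrightarrow> simple_graph H \<and> verts H \<subseteq> verts G \<and> edges H \<subseteq> edges G"

definition induced_subgraph :: "'a graph \<Rightarrow> 'a set \<Rightarrow> 'a graph" where
  "induced_subgraph G B = (B, {e \<in> edges G. e \<subseteq> B})"

definition contains_as_subgraph :: "'a graph \<Rightarrow> 'b graph \<Rightarrow> bool" where
  "contains_as_subgraph G H \<longleftrightarrow>
     (\<exists>f. inj_on f (verts H) \<and> f ` verts H \<subseteq> verts G \<and> (\<forall>e\<in>edges H. f ` e \<in> edges G))"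

definition biclique :: "nat \<Rightarrow> nat \<Rightarrow> (nat + nat) graph" where
  "biclique s t = ({..<s} <+> {..<t}, {{Inl i, Inr j} | i j. i < s \<and> j < t})"

definition is_path :: "'a graph \<Rightarrow> 'a \<Rightarrow> 'a list \<Rightarrow> 'a \<Rightarrow> bool" where
  "is_path G u p v \<longleftrightarrow> p \<noteq> [] \<and> hd p = u \<and> last p = v \<and> distinct p \<and> set p \<subseteq> verts G \<and>
     successively (\<lambda>x y. {x, y} \<in> edges G) p"

definition path_length :: "'a list \<Rightarrow> nat" where
  "path_length p = length p - 1"

text \<open>Distances are \<open>\<infinity>\<close> between different components, and so is the radius of a disconnected
  or empty graph.\<close>

definition graph_dist :: "'a graph \<Rightarrow> 'a \<Rightarrow> 'a \<Rightarrow> enat" where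
  "graph_dist G u v = (INF p\<in>{p. is_path G u p v}. enat (path_length p))"

definition graph_radius :: "'a graph \<Rightarrow> enat" where
  "graph_radius G = (INF c\<in>verts G. SUP v\<in>verts G. graph_dist G c v)"

definition connected_graph :: "'a graph \<Rightarrow> bool" where
  "connected_graph G \<longleftrightarrow> verts G \<noteq> {} \<and> (\<forall>u\<in>verts G. \<forall>v\<in>verts G. \<exists>p. is_path G u p v)"

section \<open>Bounded expansion\<close>

text \<open>The contraction has the members of \<open>\<B>\<close> as vertices, and each vertex \<open>v\<close> outside
  \<open>\<Union>\<B>\<close> survives as the singleton \<open>{v}\<close>; loops and parallel edges vanish.\<close>

definition contract :: "'a graph \<Rightarrow> 'a set set \<Rightarrow> 'a set graph" where
  "contract G \<B> =
    (let W = \<B> \<union> (\<lambda>v. {v}) ` (verts G - \<Union>\<B>)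
     in (W, {{X, Y} | X Y. X \<in> W \<and> Y \<in> W \<and> X \<noteq> Y \<and> (\<exists>x\<in>X. \<exists>y\<in>Y. {x, y} \<in> edges G)}))"

definition contractible :: "nat \<Rightarrow> 'a graph \<Rightarrow> 'a set set \<Rightarrow> bool" where
  "contractible r G \<B> \<longleftrightarrow> disjoint \<B> \<and>
     (\<forall>B\<in>\<B>. B \<subseteq> verts G \<and> connected_graph (induced_subgraph G B) \<and>
             graph_radius (induced_subgraph G B) \<le> enat r)"

definition bounded_expansion :: "'a graph set \<Rightarrow> bool" where
  "bounded_expansion C \<longleftrightarrow>
     (\<forall>r::nat. \<exists>k::real. \<forall>G\<in>C. \<forall>G' \<B>. subgraph G' G \<longrightarrow> contractible r G' \<B> \<longrightarrow>
        real (card (edges (contract G' \<B>))) \<le> k * real (card (verts (contract G' \<B>))))"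

section \<open>Merge-width\<close>

text \<open>A state consists of the current partition, the edges, the non-edges, and the unresolved
  pairs.\<close>

type_synonym 'a cs_state = "'a set set \<times> 'a set set \<times> 'a set set \<times> 'a set set"

definition cs_initial :: "'a set \<Rightarrow> 'a cs_state" where
  "cs_initial V = ((\<lambda>v. {v}) ` V, {}, {}, [V]\<^bsup>2\<^esup>)"

definition pairs_between :: "'a set \<Rightarrow> 'a set \<Rightarrow> 'a set set" where
  "pairs_between A B = {{a, b} | a b. a \<in> A \<and> b \<in> B}"

inductive cs_step :: "'a cs_state \<Rightarrow> 'a cs_state \<Rightarrow> bool" where
  merge: "A \<in> \<P> \<Longrightarrow> B \<in> \<P> \<Longrightarrow> A \<noteq> B \<Longrightarrow>
    cs_step (\<P>, E, N, U) (\<P> - {A, B} \<union> {A \<union> B}, E, N, U)"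
| resolve_positive: "A \<in> \<P> \<Longrightarrow> B \<in> \<P> \<Longrightarrow>
    cs_step (\<P>, E, N, U) (\<P>, E \<union> (U \<inter> pairs_between A B), N, U - pairs_between A B)"
| resolve_negative: "A \<in> \<P> \<Longrightarrow> B \<in> \<P> \<Longrightarrow>
    cs_step (\<P>, E, N, U) (\<P>, E, N \<union> (U \<inter> pairs_between A B), U - pairs_between A B)"

text \<open>A construction sequence is represented by its nonempty list of states. The final partition
  has one part, except that it has none if the graph is empty.\<close>

definition construction_sequence :: "'a graph \<Rightarrow> 'a cs_state list \<Rightarrow> bool" where
  "construction_sequence G ss \<longleftrightarrow> ss \<noteq> [] \<and> hd ss = cs_initial (verts G) \<and>
     successively cs_step ss \<and>
     (\<exists>\<P> E N. last ss = (\<P>, E, N, {}) \<and> card \<P> \<le> 1 \<and> E = edges G)"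

definition reachable_parts :: "'a set \<Rightarrow> nat \<Rightarrow> 'a cs_state \<Rightarrow> 'a \<Rightarrow> 'a set set" where
  "reachable_parts V r s v =
    (case s of (\<P>, E, N, U) \<Rightarrow>
       {A \<in> \<P>. \<exists>u\<in>A. \<exists>p. is_path (V, E \<union> N) v p u \<and> path_length p \<le> r})"

definition cs_width :: "'a set \<Rightarrow> nat \<Rightarrow> 'a cs_state list \<Rightarrow> nat" where
  "cs_width V r ss = (LEAST k. \<forall>s\<in>set ss. \<forall>v\<in>V. card (reachable_parts V r s v) \<le> k)"

definition merge_width :: "nat \<Rightarrow> 'a graph \<Rightarrow> enat" where
  "merge_width r G = (INF ss\<in>{ss. construction_sequence G ss}. enat (cs_width (verts G) r ss))"

definition bounded_merge_width :: "'a graph set \<Rightarrow> bool" where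
  "bounded_merge_width C \<longleftrightarrow> (\<forall>r. (SUP G\<in>C. merge_width r G) < \<infinity>)"

section \<open>Weak sparsity\<close>

definition weakly_sparse :: "'a graph set \<Rightarrow> bool" where
  "weakly_sparse C \<longleftrightarrow> (\<exists>t. \<forall>G\<in>C. \<not> contains_as_subgraph G (biclique t t))"

end

theory Submission
  imports Defs
begin

text \<open>Both directions translate between construction sequences and linear orderings of the vertices.

\<^bold>\<open>From bounded expansion to bounded merge-width.\<close> In a graph from a class of bounded expansion
every nonempty vertex set \<open>S\<close> contains a vertex \<open>v\<close> such that few vertices meet all short walks
that leave \<open>v\<close>, run outside \<open>S\<close> and end in another vertex of \<open>S\<close>. Otherwise every \<open>v\<close> in \<open>S\<close>
starts many such walks that are pairwise disjoint, and contracting suitable initial segments of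
them yields a dense shallow minor (\<open>bounded_expansion_hitting_set\<close>). Removing such vertices one
after the other gives an ordering of the vertices, the first removed one being the largest. In it,
every vertex \<open>v\<close> weakly reaches only boundedly many vertices \<open>u\<close>, that is, vertices joined to \<open>v\<close>
by a short walk on which \<open>u\<close> is minimal: unless \<open>u\<close> is \<open>v\<close>, such a walk meets the hitting set of
\<open>v\<close>, and from there on it is a shorter walk to \<open>u\<close> (\<open>weak_reach_bound\<close>). The construction sequence
runs through the ordering backwards. When the vertices below \<open>t\<close> remain, they are singleton parts,
all others are grouped by their neighbours below \<open>t\<close>, and the resolved pairs are the edges among
these others. If a vertex \<open>w\<close> is reached from \<open>v\<close> by at most \<open>r\<close> resolved edges, then its
neighbours below \<open>t\<close> are weakly reached by \<open>v\<close> in \<open>r + 1\<close> steps; so the walk ends in one of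
boundedly many groups (\<open>reachable_parts_bound\<close>). All non-edges are resolved at the very end, when
there is one part. That bounded expansion excludes large bicliques is immediate, as \<open>K\<^sub>t\<^sub>,\<^sub>t\<close> has
\<open>t\<^sup>2\<close> edges and \<open>2t\<close> vertices.

\<^bold>\<open>From bounded merge-width and weak sparsity to bounded expansion.\<close> Consider a construction
sequence of small width of a graph without \<open>K\<^sub>t\<^sub>,\<^sub>t\<close>. Pairs between two parts that are unresolved
at the same time are resolved together later, so they are all edges or all non-edges. Hence two
large parts that are joined by an unresolved edge have many resolved pairs between them, or else
they contain \<open>K\<^sub>t\<^sub>,\<^sub>t\<close>. More precisely, call a vertex overconnected if it has an unresolved edge
to a large part but few resolved neighbours there. If two vertices of large parts are not
overconnected and are joined by an unresolved edge, then a walk of at most three resolved pairs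
joins them (\<open>short_detour\<close>). The vertices are ordered by the last time when they are unsettled,
that is, lie in a small part or are overconnected. Double counting against the width shows that at
any time a part contains few vertices that are unsettled then or later, and that a large part is
joined by unresolved edges to few of them (\<open>card_remaining_in_part\<close>, \<open>card_remaining_adjacent\<close>).
Now take a short walk from \<open>v\<close> to \<open>u\<close> on which all vertices but \<open>u\<close> settle no later than \<open>v\<close>, and
\<open>u\<close> no earlier. Right after the last time when \<open>v\<close> is unsettled, the edges of the walk before the
last one can be replaced by short resolved walks, so up to its last step the walk stays within
boundedly many parts; this leaves boundedly many choices for \<open>u\<close> (\<open>card_strong_reach\<close>). In a
shallow minor, every edge between branch sets \<open>X\<close> and \<open>Y\<close>, where the last vertex of \<open>X\<close> to settle
does so no later than that of \<open>Y\<close>, is charged to a vertex of \<open>Y\<close> reached in this way from the last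
vertex of \<open>X\<close> to settle (\<open>card_minor_edges\<close>).\<close>

section \<open>Walks\<close>

text \<open>Walks may repeat vertices, so that they can be joined freely; \<open>walk_shorten\<close> leads back to paths.\<close>

definition walk :: "'a set set \<Rightarrow> 'a \<Rightarrow> 'a list \<Rightarrow> 'a \<Rightarrow> bool" where
  "walk E u p v \<longleftrightarrow> p \<noteq> [] \<and> hd p = u \<and> last p = v \<and> successively (\<lambda>x y. {x, y} \<in> E) p"

lemma walk_single [simp]: "walk E u [x] v \<longleftrightarrow> u = x \<and> v = x"
  by (auto simp: walk_def)

lemma walk_Cons: "walk E u (x # p) v \<longleftrightarrow>
    u = x \<and> (if p = [] then v = x else {x, hd p} \<in> E \<and> walk E (hd p) p v)"
  by (auto simp: walk_def successively_Cons)

lemma walk_append: "walk E u p v \<Longrightarrow> {v, w} \<in> E \<Longrightarrow> walk E w q z \<Longrightarrow> walk E u (p @ q) z"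
  by (auto simp: walk_def successively_append_iff)

text \<open>The lists \<open>p\<close> and \<open>q\<close> share the vertex \<open>v\<close>, which is kept only once.\<close>

lemma walk_join: "walk E u p v \<Longrightarrow> walk E v q w \<Longrightarrow> walk E u (p @ tl q) w"
  by (cases q) (auto simp: walk_def successively_append_iff successively_Cons)

lemma walk_rev: "walk E u p v \<Longrightarrow> walk E v (rev p) u"
  by (auto simp: walk_def hd_rev last_rev insert_commute)

lemma walk_prefix: "walk E u (p @ x # q) v \<Longrightarrow> walk E u (p @ [x]) x"
  by (auto simp: walk_def successively_append_iff successively_Cons hd_append split: if_splits)

lemma walk_suffix: "walk E u (p @ x # q) v \<Longrightarrow> walk E x (x # q) v"
  by (auto simp: walk_def successively_append_iff)

lemma walk_mono: "walk E u p v \<Longrightarrow> E \<subseteq> E' \<Longrightarrow> walk E' u p v"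
  unfolding walk_def using successively_mono by (metis (mono_tags, lifting) subsetD)

lemma walk_restrict: "walk E u p v \<Longrightarrow> set p \<subseteq> B \<Longrightarrow> walk {e\<in>E. e \<subseteq> B} u p v"
proof (induction p arbitrary: u)
  case (Cons a p)
  then show ?case by (cases p) (auto simp: walk_Cons)
qed (simp add: walk_def)

lemma is_path_iff: "is_path G u p v \<longleftrightarrow> walk (edges G) u p v \<and> distinct p \<and> set p \<subseteq> verts G"
  by (auto simp: is_path_def walk_def)

lemma walk_shorten:
  assumes "walk E u p v"
  shows "\<exists>q. walk E u q v \<and> distinct q \<and> set q \<subseteq> set p \<and> length q \<le> length p"
  using assms
proof (induction "length p" arbitrary: p rule: less_induct)
  case less
  show ?case
  proof (cases "distinct p")
    case True
    then show ?thesis using less.prems by auto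
  next
    case False
    then obtain xs ys zs y where p: "p = xs @ [y] @ ys @ [y] @ zs"
      using not_distinct_decomp by blast
    have "walk E u (xs @ [y]) y" "walk E y (y # zs) v"
      using walk_prefix[of E u xs y "ys @ [y] @ zs" v] walk_suffix[of E u "xs @ [y] @ ys" y zs v]
        less.prems p by auto
    then have w: "walk E u (xs @ [y] @ zs) v"
      using walk_join by fastforce
    have l: "length (xs @ [y] @ zs) < length p" using p by simp
    obtain q where "walk E u q v" "distinct q" "set q \<subseteq> set (xs @ [y] @ zs)"
      "length q \<le> length (xs @ [y] @ zs)"
      using less.hyps[OF l w] by blast
    then show ?thesis using p l by (intro exI[of _ q]) auto
  qed
qed

lemma walk_edge_in_Union: "walk E u p v \<Longrightarrow> p \<noteq> [u] \<Longrightarrow> x \<in> set p \<Longrightarrow> \<exists>e\<in>E. x \<in> e"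
proof (induction p arbitrary: u)
  case (Cons a p)
  show ?case
  proof (cases "p = [] \<or> x = a")
    case True
    then show ?thesis using Cons by (auto simp: walk_Cons split: if_splits)
  next
    case False
    then have w: "walk E (hd p) p v" "{a, hd p} \<in> E" "x \<in> set p"
      using Cons by (auto simp: walk_Cons)
    show ?thesis
    proof (cases "p = [hd p]")
      case True
      then have "x = hd p" using w(3) by (cases p) auto
      then show ?thesis using w(2) by blast
    qed (use Cons.IH[OF w(1) _ w(3)] in blast)
  qed
qed simp

section \<open>Shallow minors\<close>

lemma pairE:
  assumes "e \<in> [A]\<^bsup>2\<^esup>"
  obtains u v where "e = {u, v}" "u \<noteq> v" "u \<in> A" "v \<in> A"
proof -
  obtain u v where "e = {u, v}" "u \<noteq> v" "e \<subseteq> A"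
    using assms by (auto simp: nsets_def card_2_iff)
  then show thesis using that by auto
qed

text \<open>The index \<open>v\<close> of a branch set doubles as its centre: all of \<open>B v\<close> is within distance \<open>r\<close> of \<open>v\<close>
inside \<open>B v\<close>.\<close>

definition branch_sets :: "'a set set \<Rightarrow> nat \<Rightarrow> 'a set \<Rightarrow> ('a \<Rightarrow> 'a set) \<Rightarrow> bool" where
  "branch_sets E r I B \<longleftrightarrow> disjoint_family_on B I \<and> (\<forall>v\<in>I. v \<in> B v) \<and>
    (\<forall>v\<in>I. \<forall>u\<in>B v. \<exists>p. walk E v p u \<and> set p \<subseteq> B v \<and> length p \<le> r + 1)"

lemma branch_set_connected_radius:
  assumes v: "v \<in> B" and walks: "\<And>u. u \<in> B \<Longrightarrow> \<exists>p. walk E v p u \<and> set p \<subseteq> B \<and> length p \<le> r + 1"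
  shows "connected_graph (B, {e\<in>E. e \<subseteq> B})" "graph_radius (B, {e\<in>E. e \<subseteq> B}) \<le> enat r"
proof -
  let ?G = "(B, {e\<in>E. e \<subseteq> B})"
  show "connected_graph ?G"
    unfolding connected_graph_def
  proof (intro conjI ballI)
    show "verts ?G \<noteq> {}" using v by auto
    fix u w assume "u \<in> verts ?G" "w \<in> verts ?G"
    then obtain p q where p: "walk E v p u" "set p \<subseteq> B" and q: "walk E v q w" "set q \<subseteq> B"
      using walks by (metis fst_conv)
    have 1: "walk E u (rev p @ tl q) w" using p q walk_join walk_rev by metis
    have 2: "set (rev p @ tl q) \<subseteq> B" using p q by (cases q) auto
    obtain s where "walk {e\<in>E. e \<subseteq> B} u s w" "distinct s" "set s \<subseteq> B"
      using walk_shorten[OF walk_restrict[OF 1 2]] 2 by blast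
    then show "\<exists>p. is_path ?G u p w" by (auto simp: is_path_iff)
  qed
  have "graph_dist ?G v u \<le> enat r" if "u \<in> B" for u
  proof -
    obtain p where p: "walk E v p u" "set p \<subseteq> B" "length p \<le> r + 1" using walks[OF \<open>u \<in> B\<close>] by blast
    obtain s where s: "walk {e\<in>E. e \<subseteq> B} v s u" "distinct s" "set s \<subseteq> set p" "length s \<le> length p"
      using walk_shorten[OF walk_restrict[OF p(1,2)]] by blast
    then have "is_path ?G v s u" using p by (auto simp: is_path_iff)
    then have "graph_dist ?G v u \<le> enat (path_length s)"
      unfolding graph_dist_def by (intro INF_lower) simp
    also have "\<dots> \<le> enat r" using s p by (simp add: path_length_def)
    finally show ?thesis .
  qed
  then show "graph_radius ?G \<le> enat r"
    unfolding graph_radius_def using v by (intro INF_lower2[of v] SUP_least) auto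
qed

lemma graph_radius_center:
  assumes "graph_radius (B, F) \<le> enat r"
  obtains c where "c \<in> B" "\<And>u. u \<in> B \<Longrightarrow> \<exists>p. walk F c p u \<and> set p \<subseteq> B \<and> length p \<le> r + 1"
proof -
  have "graph_radius (B, F) < enat (Suc r)" using assms by (meson enat_ord_simps(2) le_less_trans lessI)
  then obtain c where c: "c \<in> B" "(SUP v\<in>B. graph_dist (B, F) c v) < enat (Suc r)"
    unfolding graph_radius_def by (auto simp: INF_less_iff)
  have "\<exists>p. walk F c p u \<and> set p \<subseteq> B \<and> length p \<le> r + 1" if u: "u \<in> B" for u
  proof -
    have "graph_dist (B, F) c u < enat (Suc r)" using SUP_upper[OF u] c(2) by (rule le_less_trans)
    then obtain p where "is_path (B, F) c p u" "path_length p < Suc r"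
      unfolding graph_dist_def by (auto simp: INF_less_iff)
    then show ?thesis by (intro exI[of _ p]) (auto simp: is_path_iff path_length_def)
  qed
  then show thesis using that c(1) by blast
qed

text \<open>Two vertices of a branch set of radius \<open>r\<close> are joined by a walk through its centre.\<close>

lemma contract_vertex_walks:
  assumes con: "contractible r G \<B>" and X: "X \<in> verts (contract G \<B>)" and xy: "x \<in> X" "y \<in> X"
  shows "\<exists>p. walk (edges G) x p y \<and> set p \<subseteq> X \<and> length p \<le> 2 * r + 1"
proof (cases "X \<in> \<B>")
  case True
  then have "graph_radius (X, {e\<in>edges G. e \<subseteq> X}) \<le> enat r"
    using con by (auto simp: contractible_def induced_subgraph_def)
  then obtain c where c: "c \<in> X" "\<And>u. u \<in> X \<Longrightarrow>
      \<exists>p. walk {e\<in>edges G. e \<subseteq> X} c p u \<and> set p \<subseteq> X \<and> length p \<le> r + 1"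
    by (rule graph_radius_center) blast
  obtain p where p: "walk (edges G) c p x" "set p \<subseteq> X" "length p \<le> r + 1"
    using c(2)[OF xy(1)] walk_mono[of "{e\<in>edges G. e \<subseteq> X}" c _ x "edges G"] by blast
  obtain q where q: "walk (edges G) c q y" "set q \<subseteq> X" "length q \<le> r + 1"
    using c(2)[OF xy(2)] walk_mono[of "{e\<in>edges G. e \<subseteq> X}" c _ y "edges G"] by blast
  have "walk (edges G) x (rev p @ tl q) y" using walk_join[OF walk_rev[OF p(1)] q(1)] .
  moreover have "set (tl q) \<subseteq> set q" by (cases q) auto
  ultimately show ?thesis using p q by (intro exI[of _ "rev p @ tl q"]) auto
next
  case False
  then obtain v where "X = {v}" using X by (auto simp: contract_def Let_def)
  then show ?thesis using xy by (intro exI[of _ "[v]"]) auto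
qed

lemma contract_vertices:
  assumes con: "contractible r G \<B>"
  shows "disjoint (verts (contract G \<B>))" "\<And>X. X \<in> verts (contract G \<B>) \<Longrightarrow> X \<noteq> {} \<and> X \<subseteq> verts G"
proof -
  have B: "disjoint \<B>" "\<And>X. X \<in> \<B> \<Longrightarrow> X \<noteq> {} \<and> X \<subseteq> verts G"
    using con by (auto simp: contractible_def connected_graph_def induced_subgraph_def)
  have W: "verts (contract G \<B>) = \<B> \<union> (\<lambda>v. {v}) ` (verts G - \<Union>\<B>)"
    by (simp add: contract_def Let_def)
  have "disjoint ((\<lambda>v. {v}) ` (verts G - \<Union>\<B>))" by (auto intro!: disjointI)
  then show "disjoint (verts (contract G \<B>))"
    unfolding W using B(1) by (intro disjoint_union) auto
  show "\<And>X. X \<in> verts (contract G \<B>) \<Longrightarrow> X \<noteq> {} \<and> X \<subseteq> verts G"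
    unfolding W using B(2) by blast
qed

text \<open>The form in which bounded expansion is used: deleting everything outside the branch sets and
contracting these leaves a graph whose vertices are exactly the branch sets. The constant is made
a natural number, and \<open>F\<close> lives on the centres, so no quotient graph appears in the applications.\<close>

lemma bounded_expansion_minor_bound:
  assumes "bounded_expansion C"
  obtains c :: nat where
    "\<And>G I B F. G \<in> C \<Longrightarrow> finite_simple_graph G \<Longrightarrow> finite I \<Longrightarrow> branch_sets (edges G) r I B \<Longrightarrow>
      \<Union>(B ` I) \<subseteq> verts G \<Longrightarrow> F \<subseteq> [I]\<^bsup>2\<^esup> \<Longrightarrow>
      (\<And>u v. {u, v} \<in> F \<Longrightarrow> \<exists>x\<in>B u. \<exists>y\<in>B v. {x, y} \<in> edges G) \<Longrightarrow> card F \<le> c * card I"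
proof -
  obtain k :: real where k: "\<And>G G' \<B>. G \<in> C \<Longrightarrow> subgraph G' G \<Longrightarrow> contractible r G' \<B> \<Longrightarrow>
        real (card (edges (contract G' \<B>))) \<le> k * real (card (verts (contract G' \<B>)))"
    using assms unfolding bounded_expansion_def by meson
  define c where "c = nat \<lceil>\<bar>k\<bar>\<rceil>"
  have "card F \<le> c * card I"
    if G: "G \<in> C" "finite_simple_graph G" and I: "finite I"
      and B: "branch_sets (edges G) r I B" and sub: "\<Union>(B ` I) \<subseteq> verts G"
      and F: "F \<subseteq> [I]\<^bsup>2\<^esup>" "\<And>u v. {u, v} \<in> F \<Longrightarrow> \<exists>x\<in>B u. \<exists>y\<in>B v. {x, y} \<in> edges G" for G I B F
  proof -
    define U where "U = \<Union>(B ` I)"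
    define G' where "G' = (U, {e\<in>edges G. e \<subseteq> U})"
    have sg: "subgraph G' G"
    proof -
      have "edges G \<subseteq> [verts G]\<^bsup>2\<^esup>"
        using G(2) by (simp add: finite_simple_graph_def simple_graph_def)
      then have "simple_graph G'"
        unfolding G'_def simple_graph_def nsets_def by auto
      then show ?thesis using sub by (auto simp: subgraph_def G'_def U_def)
    qed
    have dis: "disjoint_family_on B I" and mem: "\<And>v. v \<in> I \<Longrightarrow> v \<in> B v"
      using B by (auto simp: branch_sets_def)
    have inj: "inj_on B I"
    proof (rule inj_onI)
      fix x y assume "x \<in> I" "y \<in> I" "B x = B y"
      then show "x = y" using dis mem unfolding disjoint_family_on_def by blast
    qed
    have ind: "induced_subgraph G' (B v) = (B v, {e\<in>edges G. e \<subseteq> B v})" if "v \<in> I" for v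
      using that by (auto simp: induced_subgraph_def G'_def U_def)
    have con: "contractible r G' (B ` I)"
      unfolding contractible_def
    proof (intro conjI ballI)
      show "disjoint (B ` I)" using dis by (rule disjoint_family_on_disjoint_image)
      fix X assume "X \<in> B ` I"
      then obtain v where v: "v \<in> I" "X = B v" by auto
      show "X \<subseteq> verts G'" using v by (auto simp: G'_def U_def)
      have w: "\<And>u. u \<in> B v \<Longrightarrow> \<exists>p. walk (edges G) v p u \<and> set p \<subseteq> B v \<and> length p \<le> r + 1"
        using B v by (auto simp: branch_sets_def)
      show "connected_graph (induced_subgraph G' X)" "graph_radius (induced_subgraph G' X) \<le> enat r"
        using branch_set_connected_radius[OF mem[OF v(1)] w] ind[OF v(1)] v(2) by auto
    qed
    have W: "verts (contract G' (B ` I)) = B ` I"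
      by (auto simp: contract_def G'_def U_def Let_def)
    have E: "edges (contract G' (B ` I)) =
      {{X, Y} | X Y. X \<in> B ` I \<and> Y \<in> B ` I \<and> X \<noteq> Y \<and> (\<exists>x\<in>X. \<exists>y\<in>Y. {x, y} \<in> edges G')}"
    proof -
      have "B ` I \<union> (\<lambda>v. {v}) ` (verts G' - \<Union> (B ` I)) = B ` I" by (auto simp: G'_def U_def)
      then show ?thesis by (simp add: contract_def Let_def)
    qed
    have "(`) B ` F \<subseteq> edges (contract G' (B ` I))"
    proof
      fix e assume "e \<in> (`) B ` F"
      then obtain f where f: "f \<in> F" "e = B ` f" by auto
      have "f \<in> [I]\<^bsup>2\<^esup>" using F(1) f(1) by blast
      then obtain u v where uv: "f = {u, v}" "u \<noteq> v" "u \<in> I" "v \<in> I" by (rule pairE)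
      obtain x y where "x \<in> B u" "y \<in> B v" "{x, y} \<in> edges G" using F(2)[of u v] f(1) uv(1) by blast
      moreover from this have "{x, y} \<in> edges G'" using uv by (auto simp: G'_def U_def)
      moreover have "B u \<noteq> B v" using inj uv by (auto dest: inj_onD)
      ultimately show "e \<in> edges (contract G' (B ` I))"
        unfolding E using uv f by blast
    qed
    moreover have "finite (edges (contract G' (B ` I)))"
    proof (rule finite_subset)
      show "edges (contract G' (B ` I)) \<subseteq> Pow (B ` I)" unfolding E by auto
    qed (use I in simp)
    ultimately have "card ((`) B ` F) \<le> card (edges (contract G' (B ` I)))" by (rule card_mono[rotated])
    moreover have "card ((`) B ` F) = card F"
    proof (rule card_image)
      show "inj_on ((`) B) F"
        by (rule inj_on_subset[OF inj_on_image_Pow[OF inj]]) (use F(1) in \<open>auto simp: nsets_def\<close>)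
    qed
    ultimately have "real (card F) \<le> k * real (card (B ` I))"
      using k[OF G(1) sg con] W by simp
    also have "card (B ` I) = card I" using inj by (rule card_image)
    also have "k * real (card I) \<le> real c * real (card I)"
      unfolding c_def by (intro mult_right_mono) linarith+
    finally show "card F \<le> c * card I" by (simp flip: of_nat_mult)
  qed
  then show thesis using that by blast
qed

section \<open>Fans and hitting sets\<close>

text \<open>The average degree is at most \<open>2c\<close>, so at least half of the vertices have degree at most \<open>4c\<close>. A
maximal independent set of these dominates all of them, and each of its members dominates at most
\<open>4c + 1\<close> of them.\<close>

lemma large_independent_set:
  assumes S: "finite S" and F: "F \<subseteq> [S]\<^bsup>2\<^esup>" and card: "card F \<le> c * card S"
  obtains R where "R \<subseteq> S" "\<And>u v. u \<in> R \<Longrightarrow> v \<in> R \<Longrightarrow> {u, v} \<notin> F"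
    "card S \<le> 2 * (4 * c + 1) * card R"
proof -
  define deg where "deg v = card {e\<in>F. v \<in> e}" for v
  have finF: "finite F" using F S finite_imp_finite_nsets finite_subset by blast
  define low where "low = {v\<in>S. deg v \<le> 4 * c}"
  have low: "low \<subseteq> S" "finite low" using S by (auto simp: low_def)
  have sum: "(\<Sum>v\<in>S. deg v) = 2 * card F"
  proof -
    have "(\<Sum>v\<in>S. deg v) = (\<Sum>v\<in>S. \<Sum>e\<in>F. if v \<in> e then 1 else 0)"
      unfolding deg_def using finF by (simp add: sum.If_cases Int_def)
    also have "\<dots> = (\<Sum>e\<in>F. \<Sum>v\<in>S. if v \<in> e then 1 else 0)" by (rule sum.swap)
    also have "\<dots> = (\<Sum>e\<in>F. 2)"
    proof (rule sum.cong[OF refl])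
      fix e assume "e \<in> F"
      then have "e \<subseteq> S" "card e = 2" using F by (auto simp: nsets_def)
      then have "S \<inter> e = e" by auto
      then show "(\<Sum>v\<in>S. if v \<in> e then 1 else 0) = (2::nat)"
        using S \<open>card e = 2\<close> by (simp add: sum.If_cases)
    qed
    finally show ?thesis by simp
  qed
  have "(4 * c + 1) * card (S - low) \<le> (\<Sum>v\<in>S - low. deg v)"
    using sum_bounded_below[of "S - low" "4 * c + 1" deg] by (force simp: low_def mult.commute)
  also have "\<dots> \<le> (\<Sum>v\<in>S. deg v)" using S by (intro sum_mono2) auto
  finally have "(4 * c + 1) * card (S - low) \<le> 2 * c * card S" using sum card by simp
  then have "2 * ((4 * c + 1) * card (S - low)) \<le> (4 * c + 1) * card S" by simp
  then have "(4 * c + 1) * (2 * card (S - low)) \<le> (4 * c + 1) * card S"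
    by (simp only: mult.left_commute)
  then have "2 * card (S - low) \<le> card S"
    by (metis add_is_0 mult_le_cancel1 neq0_conv zero_neq_one)
  then have half: "card S \<le> 2 * card low"
    using card_Diff_subset[OF low(2,1)] card_mono[OF S low(1)] by simp
  define indep where "indep R \<longleftrightarrow> R \<subseteq> low \<and> (\<forall>u\<in>R. \<forall>v\<in>R. {u, v} \<notin> F)" for R
  have "finite {R. indep R}" by (rule finite_subset[of _ "Pow low"]) (auto simp: indep_def low(2))
  moreover have "indep {}" by (simp add: indep_def)
  ultimately obtain R where R: "indep R" "\<And>R'. indep R' \<Longrightarrow> R \<subseteq> R' \<Longrightarrow> R = R'"
    using finite_has_maximal[of "{R. indep R}"] by auto
  have sing: "{v, v} \<notin> F" for v using F by (auto simp: nsets_def dest!: subsetD)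
  have finR: "finite R" using R(1) low(2) by (auto simp: indep_def intro: finite_subset)
  \<comment> \<open>By maximality, every vertex of low degree is in \<open>R\<close> or has a neighbour in \<open>R\<close>.\<close>
  have "low \<subseteq> (\<Union>v\<in>R. insert v (\<Union>{e\<in>F. v \<in> e} - {v}))"
  proof
    fix u assume u: "u \<in> low"
    show "u \<in> (\<Union>v\<in>R. insert v (\<Union>{e\<in>F. v \<in> e} - {v}))"
    proof (cases "u \<in> R")
      case False
      then have "\<not> indep (insert u R)" using R(2) by blast
      then obtain v where "v \<in> R" "{u, v} \<in> F"
        using u R(1) sing unfolding indep_def by (metis insertE insert_commute insert_subset)
      then show ?thesis using False by blast
    qed auto
  qed
  then have "card low \<le> (\<Sum>v\<in>R. card (insert v (\<Union>{e\<in>F. v \<in> e} - {v})))"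
    by (rule order_trans[OF card_mono card_UN_le[OF finR], rotated])
      (use finR finF F S in \<open>auto simp: nsets_def\<close>)
  also have "\<dots> \<le> (\<Sum>v\<in>R. 4 * c + 1)"
  proof (rule sum_mono)
    fix v assume v: "v \<in> R"
    have "\<Union>{e\<in>F. v \<in> e} - {v} = (\<Union>e\<in>{e\<in>F. v \<in> e}. e - {v})" by auto
    then have "card (\<Union>{e\<in>F. v \<in> e} - {v}) \<le> (\<Sum>e\<in>{e\<in>F. v \<in> e}. card (e - {v}))"
      using card_UN_le[of "{e\<in>F. v \<in> e}" "\<lambda>e. e - {v}"] finF by simp
    also have "\<dots> = (\<Sum>e\<in>{e\<in>F. v \<in> e}. 1)"
      by (rule sum.cong) (use F in \<open>auto simp: nsets_def\<close>)
    also have "\<dots> = deg v" by (simp add: deg_def)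
    also have "\<dots> \<le> 4 * c" using v R(1) by (auto simp: indep_def low_def)
    finally have "card (\<Union>{e\<in>F. v \<in> e} - {v}) \<le> 4 * c" .
    moreover have "card (insert v Y) \<le> card Y + 1" for Y
      by (cases "finite Y") (auto simp: card_insert_if)
    ultimately show "card (insert v (\<Union>{e\<in>F. v \<in> e} - {v})) \<le> 4 * c + 1"
      by (meson add_le_mono1 order_trans)
  qed
  finally have "card low \<le> (4 * c + 1) * card R" by (simp add: mult.commute)
  then have "card S \<le> 2 * (4 * c + 1) * card R" using half by simp
  then show thesis using that[of R] R(1) low(1) by (auto simp: indep_def)
qed

text \<open>A greedy choice of pairwise non-conflicting objects. Objects with the same value of \<open>g\<close> conflict
and \<open>g\<close> has finitely many values, so a packing of maximal cardinality exists although there may be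
infinitely many objects.\<close>

lemma maximal_packing:
  assumes D: "finite D" "\<And>x. ok x \<Longrightarrow> g x \<in> D"
    and conf: "\<And>x y. ok x \<Longrightarrow> ok y \<Longrightarrow> g x = g y \<Longrightarrow> conf x y" "\<And>x y. conf x y \<Longrightarrow> conf y x"
  obtains Q where "finite Q" "\<And>x. x \<in> Q \<Longrightarrow> ok x" "inj_on g Q"
    "\<And>x y. x \<in> Q \<Longrightarrow> y \<in> Q \<Longrightarrow> x \<noteq> y \<Longrightarrow> \<not> conf x y"
    "\<And>x. ok x \<Longrightarrow> \<exists>y\<in>Q. conf x y"
proof -
  define pack where "pack Q \<longleftrightarrow> (\<forall>x\<in>Q. ok x) \<and> (\<forall>x\<in>Q. \<forall>y\<in>Q. x \<noteq> y \<longrightarrow> \<not> conf x y)" for Q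
  have inj: "inj_on g Q" if "pack Q" for Q
    using that conf unfolding pack_def inj_on_def by blast
  have fin: "finite Q" "card Q \<le> card D" if "pack Q" for Q
  proof -
    have "g ` Q \<subseteq> D" using that D(2) by (auto simp: pack_def)
    then show "finite Q" "card Q \<le> card D"
      using inj[OF that] D(1) by (auto intro: inj_on_finite card_inj_on_le)
  qed
  have "pack {}" by (simp add: pack_def)
  then obtain Q where Q: "pack Q" "\<And>Q'. pack Q' \<Longrightarrow> card Q' \<le> card Q"
    using ex_has_greatest_nat[of pack "{}" card "card D + 1"] fin(2)
    by (metis le_imp_less_Suc Suc_eq_plus1 less_or_eq_imp_le)
  have "\<exists>y\<in>Q. conf x y" if "ok x" for x
  proof (rule ccontr)
    assume no: "\<not> (\<exists>y\<in>Q. conf x y)"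
    then have "x \<notin> Q" using conf(1) that by blast
    moreover have "pack (insert x Q)"
      using Q(1) that no conf(2) unfolding pack_def by blast
    ultimately show False using Q(2)[of "insert x Q"] fin(1)[OF Q(1)] by simp
  qed
  then show thesis using that[of Q] Q(1) fin(1) inj unfolding pack_def by blast
qed

text \<open>The list \<open>q\<close> omits the common start \<open>v\<close>; hence disjointness of two walks of a fan is disjointness
of the lists.\<close>

definition fan_walk :: "'a set set \<Rightarrow> 'a set \<Rightarrow> nat \<Rightarrow> 'a \<Rightarrow> 'a list \<Rightarrow> bool" where
  "fan_walk E S r v q \<longleftrightarrow> q \<noteq> [] \<and> walk E v (v # q) (last q) \<and> length q \<le> r \<and>
    last q \<in> S - {v} \<and> set (butlast q) \<inter> S = {}"

text \<open>The list \<open>q\<close> holds the inner vertices, which avoid \<open>S\<close> and may be contracted into \<open>v\<close> or \<open>w\<close>.\<close>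

definition link :: "'a set set \<Rightarrow> 'a set \<Rightarrow> nat \<Rightarrow> 'a \<Rightarrow> 'a list \<Rightarrow> 'a \<Rightarrow> bool" where
  "link E S l v q w \<longleftrightarrow> v \<in> S \<and> w \<in> S \<and> v \<noteq> w \<and> set q \<inter> S = {} \<and> length q \<le> l \<and>
    walk E v (v # q @ [w]) w"

lemma link_inner_walk:
  assumes "link E S l v q w" "x \<in> set q"
  obtains p where "walk E v (v # p) x" "set p \<subseteq> set q" "length p \<le> l"
proof -
  obtain q1 q2 where q: "q = q1 @ x # q2" using assms(2) by (meson split_list)
  have "walk E v (v # q1 @ [x]) x"
    using assms(1) walk_prefix[of E v "v # q1" x "q2 @ [w]" w] unfolding link_def q by simp
  then show thesis using that[of "q1 @ [x]"] assms(1) by (auto simp: link_def q)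
qed

text \<open>Every link is contracted entirely into its first end, so its edge into the other end survives in
the minor.\<close>

lemma branch_sets_of_links:
  assumes links: "\<And>v q w. (v, q, w) \<in> L \<Longrightarrow> link E S l v q w"
    and disj: "\<And>v q w v' q' w'. (v, q, w) \<in> L \<Longrightarrow> (v', q', w') \<in> L \<Longrightarrow>
      (v, q, w) \<noteq> (v', q', w') \<Longrightarrow> set q \<inter> set q' = {}"
  shows "branch_sets E l S (\<lambda>v. insert v (\<Union>{set q | q. \<exists>w. (v, q, w) \<in> L}))" (is "branch_sets E l S ?B")
  unfolding branch_sets_def
proof (intro conjI ballI)
  have "q = q' \<and> v = v'" if "(v, q, w) \<in> L" "(v', q', w') \<in> L" "x \<in> set q" "x \<in> set q'" for v q w v' q' w' x
    using disj[OF that(1,2)] that by auto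
  moreover have "set q \<inter> S = {}" if "(v, q, w) \<in> L" for v q w
    using links[OF that] by (auto simp: link_def)
  ultimately show "disjoint_family_on ?B S"
    unfolding disjoint_family_on_def by blast
  fix v assume v: "v \<in> S"
  show "v \<in> ?B v" by simp
  fix u assume "u \<in> ?B v"
  then consider "u = v" | q w where "(v, q, w) \<in> L" "u \<in> set q" by auto
  then show "\<exists>p. walk E v p u \<and> set p \<subseteq> ?B v \<and> length p \<le> l + 1"
  proof cases
    case 1
    then show ?thesis by (intro exI[of _ "[v]"]) auto
  next
    case 2
    obtain p where p: "walk E v (v # p) u" "set p \<subseteq> set q" "length p \<le> l"
      using link_inner_walk[OF links[OF 2(1)] 2(2)] .
    then show ?thesis using 2(1) by (intro exI[of _ "v # p"]) auto
  qed
qed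

lemma link_last_edge:
  assumes "link E S l v q w"
  shows "\<exists>x\<in>insert v (set q). {x, w} \<in> E"
proof -
  have "successively (\<lambda>x y. {x, y} \<in> E) ((v # q) @ [w])"
    using assms by (simp add: link_def walk_def)
  then have "{last (v # q), w} \<in> E" by (subst (asm) successively_append_iff) simp
  then show ?thesis by (metis last_in_set list.discI list.simps(15))
qed

text \<open>Two walks that start in different vertices of \<open>S\<close> and meet outside \<open>S\<close> form a link. This is how
maximality of a family of links is used.\<close>

lemma link_of_crossing_walks:
  assumes "walk E v (v # q1 @ [x]) x" "walk E w (w # q2 @ [x]) x"
    and "v \<in> S" "w \<in> S" "v \<noteq> w" "set (q1 @ x # q2) \<inter> S = {}" "length (q1 @ x # q2) \<le> l"
  shows "link E S l v (q1 @ x # rev q2) w"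
proof -
  have "walk E v ((v # q1 @ [x]) @ tl (rev (w # q2 @ [x]))) w"
    using walk_join[OF assms(1) walk_rev[OF assms(2)]] .
  then show ?thesis using assms by (auto simp: link_def)
qed

lemma edge_between_pair:
  assumes "{u, v} = {a, b}" "x \<in> B a" "y \<in> B b" "{x, y} \<in> E"
  shows "\<exists>x\<in>B u. \<exists>y\<in>B v. {x, y} \<in> E"
proof -
  consider "u = a" "v = b" | "u = b" "v = a" using assms(1) by (auto simp: doubleton_eq_iff)
  then show ?thesis
  proof cases
    case 1
    then show ?thesis using assms by blast
  next
    case 2
    have "{y, x} \<in> E" using assms(4) by (simp add: insert_commute)
    then show ?thesis using 2 assms by blast
  qed
qed

lemma fan_walk_not_start: "fan_walk E S r v q \<Longrightarrow> v \<in> S \<Longrightarrow> v \<notin> set q"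
  unfolding fan_walk_def
  by (metis DiffD2 IntI append_butlast_last_id emptyE in_set_conv_decomp insertCI rotate1.simps(2) set_ConsD set_rotate1)

text \<open>Fan walks get cut at their first vertex in a larger set \<open>T\<close>; there is one, since the last vertex
is in \<open>S\<close>.\<close>

lemma fan_walk_split:
  assumes q: "fan_walk E S r v q" and S: "S \<subseteq> T"
  shows "q = takeWhile (\<lambda>x. x \<notin> T) q @ hd (dropWhile (\<lambda>x. x \<notin> T) q) # tl (dropWhile (\<lambda>x. x \<notin> T) q)"
    "hd (dropWhile (\<lambda>x. x \<notin> T) q) \<in> T" "set (takeWhile (\<lambda>x. x \<notin> T) q) \<inter> T = {}"
proof -
  have "last q \<in> set q" "last q \<in> T" using q S by (auto simp: fan_walk_def)
  then have ne: "dropWhile (\<lambda>x. x \<notin> T) q \<noteq> []" by auto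
  then show "hd (dropWhile (\<lambda>x. x \<notin> T) q) \<in> T" using hd_dropWhile[of "\<lambda>x. x \<notin> T" q] by simp
  show "q = takeWhile (\<lambda>x. x \<notin> T) q @ hd (dropWhile (\<lambda>x. x \<notin> T) q) # tl (dropWhile (\<lambda>x. x \<notin> T) q)"
    using ne by simp
  show "set (takeWhile (\<lambda>x. x \<notin> T) q) \<inter> T = {}" by (auto dest: set_takeWhileD)
qed

lemma fan_walk_prefix:
  assumes q: "fan_walk E S r v (q1 @ x # q2)"
  shows "walk E v (v # q1 @ [x]) x" "length (q1 @ [x]) \<le> r"
  using q walk_prefix[of E v "v # q1" x q2] unfolding fan_walk_def by auto

text \<open>The last vertices of disjoint fan walks are different, which bounds the size of a fan by \<open>card S\<close>.
The vertices of a maximal fan meet every fan walk.\<close>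

lemma maximal_fan:
  assumes S: "finite S"
  obtains Q where "finite Q" "\<And>q. q \<in> Q \<Longrightarrow> fan_walk E S r v q"
    "\<And>q q'. q \<in> Q \<Longrightarrow> q' \<in> Q \<Longrightarrow> q \<noteq> q' \<Longrightarrow> set q \<inter> set q' = {}"
    "\<And>q. fan_walk E S r v q \<Longrightarrow> \<exists>q'\<in>Q. set q \<inter> set q' \<noteq> {}"
proof -
  note result = that
  have *: "fan_walk E S r v q \<Longrightarrow> last q \<in> S" for q by (auto simp: fan_walk_def)
  show thesis
  proof (rule maximal_packing[of S "fan_walk E S r v" last "\<lambda>q q'. set q \<inter> set q' \<noteq> {}"])
    show "set q \<inter> set q' \<noteq> {}" if "fan_walk E S r v q" "fan_walk E S r v q'" "last q = last q'" for q q'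
      using that unfolding fan_walk_def by (metis IntI emptyE last_in_set)
    show thesis if "finite Q" "\<And>q. q \<in> Q \<Longrightarrow> fan_walk E S r v q"
      "\<And>q q'. q \<in> Q \<Longrightarrow> q' \<in> Q \<Longrightarrow> q \<noteq> q' \<Longrightarrow> \<not> set q \<inter> set q' \<noteq> {}"
      "\<And>q. fan_walk E S r v q \<Longrightarrow> \<exists>q'\<in>Q. set q \<inter> set q' \<noteq> {}" for Q
      by (rule result[of Q]) (use that in blast)+
  qed (use S * in auto)
qed

text \<open>Links conflict if they share an inner vertex or have the same ends. By maximality, any link
between two vertices that no member of \<open>L\<close> links crosses the interior of a member.\<close>

lemma maximal_links:
  assumes S: "finite S"
  obtains L where "finite L" "\<And>v q w. (v, q, w) \<in> L \<Longrightarrow> link E S l v q w"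
    "inj_on (\<lambda>(v, q, w). {v, w}) L"
    "\<And>v q w v' q' w'. (v, q, w) \<in> L \<Longrightarrow> (v', q', w') \<in> L \<Longrightarrow>
      (v, q, w) \<noteq> (v', q', w') \<Longrightarrow> set q \<inter> set q' = {}"
    "\<And>v q w. link E S l v q w \<Longrightarrow> {v, w} \<notin> (\<lambda>(v, q, w). {v, w}) ` L \<Longrightarrow>
      \<exists>(v', q', w')\<in>L. set q \<inter> set q' \<noteq> {}"
proof -
  define ok where "ok = (\<lambda>(v, q, w). link E S l v q w)"
  define g where "g = (\<lambda>(v :: 'a, q :: 'a list, w). {v, w})"
  define conf where "conf = (\<lambda>x y :: 'a \<times> 'a list \<times> 'a.
    g x = g y \<or> set (fst (snd x)) \<inter> set (fst (snd y)) \<noteq> {})"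
  obtain L where L: "finite L" "\<And>x. x \<in> L \<Longrightarrow> ok x" "inj_on g L"
    "\<And>x y. x \<in> L \<Longrightarrow> y \<in> L \<Longrightarrow> x \<noteq> y \<Longrightarrow> \<not> conf x y"
    "\<And>x. ok x \<Longrightarrow> \<exists>y\<in>L. conf x y"
  proof (rule maximal_packing[of "[S]\<^bsup>2\<^esup>" ok g conf])
    show "finite ([S]\<^bsup>2\<^esup>)" using S by (rule finite_imp_finite_nsets)
    show "ok x \<Longrightarrow> g x \<in> [S]\<^bsup>2\<^esup>" for x
      by (cases x) (simp add: ok_def g_def link_def)
    show "g x = g y \<Longrightarrow> conf x y" for x y by (simp add: conf_def)
    show "conf x y \<Longrightarrow> conf y x" for x y by (auto simp: conf_def)
  qed blast
  show thesis
  proof (rule that[of L])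
    show "finite L" by (rule L(1))
    show "link E S l v q w" if "(v, q, w) \<in> L" for v q w
      using L(2)[OF that] by (simp add: ok_def)
    show "inj_on (\<lambda>(v, q, w). {v, w}) L" using L(3) by (simp add: g_def)
    show "set q \<inter> set q' = {}" if "(v, q, w) \<in> L" "(v', q', w') \<in> L" "(v, q, w) \<noteq> (v', q', w')"
      for v q w v' q' w'
      using L(4)[OF that] by (auto simp: conf_def)
    show "\<exists>(v', q', w')\<in>L. set q \<inter> set q' \<noteq> {}"
      if "link E S l v q w" "{v, w} \<notin> (\<lambda>(v, q, w). {v, w}) ` L" for v q w
    proof -
      obtain y where y: "y \<in> L" "conf (v, q, w) y" using L(5)[of "(v, q, w)"] \<open>link E S l v q w\<close> by (auto simp: ok_def)
      have "g y \<in> g ` L" using y by blast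
      then have "g (v, q, w) \<noteq> g y" using that(2) unfolding g_def by (metis case_prod_conv)
      then show ?thesis using y by (intro bexI[of _ y]) (auto simp: conf_def split: prod.split)
    qed
  qed
qed

text \<open>Suppose that all \<open>v\<close> in \<open>S\<close> have large fans. Take a maximal family \<open>L\<close> of links. Contracting it
shows that \<open>L\<close> has \<open>O(card S)\<close> members; so the set \<open>M\<close> of their inner vertices is small as well,
and the graph \<open>F\<close> of the linked pairs has a large independent set \<open>R\<close>. Cut the fan walks of the
vertices in \<open>R\<close> at their first vertex in \<open>S \<union> M\<close>. By maximality of \<open>L\<close> the segments of different
vertices of \<open>R\<close> are disjoint and do not end in \<open>R\<close>: otherwise they would give a link between two
vertices of \<open>R\<close> that avoids \<open>M\<close>. Contracting the segments into the vertices of \<open>R\<close> gives a minor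
on \<open>S \<union> M\<close> in which every vertex of \<open>R\<close> has large degree. As \<open>R\<close> is a constant fraction of \<open>S \<union>
M\<close>, this is too dense.\<close>

lemma bounded_expansion_hitting_set:
  assumes C: "bounded_expansion C" "\<And>G. G \<in> C \<Longrightarrow> finite_simple_graph G"
  obtains m where "\<And>G S. G \<in> C \<Longrightarrow> S \<subseteq> verts G \<Longrightarrow> S \<noteq> {} \<Longrightarrow>
    \<exists>v\<in>S. \<exists>Z. finite Z \<and> card Z \<le> m \<and> (\<forall>q. fan_walk (edges G) S r v q \<longrightarrow> set q \<inter> Z \<noteq> {})"
proof -
  obtain c1 :: nat where c1:
    "\<And>G I B F. G \<in> C \<Longrightarrow> finite_simple_graph G \<Longrightarrow> finite I \<Longrightarrow> branch_sets (edges G) (2 * r) I B \<Longrightarrow>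
      \<Union>(B ` I) \<subseteq> verts G \<Longrightarrow> F \<subseteq> [I]\<^bsup>2\<^esup> \<Longrightarrow>
      (\<And>u v. {u, v} \<in> F \<Longrightarrow> \<exists>x\<in>B u. \<exists>y\<in>B v. {x, y} \<in> edges G) \<Longrightarrow> card F \<le> c1 * card I"
    using bounded_expansion_minor_bound[OF C(1)] by metis
  obtain c2 :: nat where c2:
    "\<And>G I B F. G \<in> C \<Longrightarrow> finite_simple_graph G \<Longrightarrow> finite I \<Longrightarrow> branch_sets (edges G) r I B \<Longrightarrow>
      \<Union>(B ` I) \<subseteq> verts G \<Longrightarrow> F \<subseteq> [I]\<^bsup>2\<^esup> \<Longrightarrow>
      (\<And>u v. {u, v} \<in> F \<Longrightarrow> \<exists>x\<in>B u. \<exists>y\<in>B v. {x, y} \<in> edges G) \<Longrightarrow> card F \<le> c2 * card I"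
    using bounded_expansion_minor_bound[OF C(1)] by metis
  \<comment> \<open>Here \<open>1 + 2 * r * c1\<close> bounds the size of \<open>S \<union> M\<close> relative to \<open>S\<close>, and \<open>2 * (4 * c1 + 1)\<close> the
    size of \<open>S\<close> relative to \<open>R\<close>.\<close>
  define p where "p = c2 * (1 + 2 * r * c1) * (2 * (4 * c1 + 1))"
  define m where "m = p * r"
  have "\<exists>v\<in>S. \<exists>Z. finite Z \<and> card Z \<le> m \<and> (\<forall>q. fan_walk (edges G) S r v q \<longrightarrow> set q \<inter> Z \<noteq> {})"
    if G: "G \<in> C" and SV: "S \<subseteq> verts G" and ne: "S \<noteq> {}" for G S
  proof (rule ccontr)
    assume contra: "\<not> ?thesis"
    define E where "E = edges G"
    have fsg: "finite_simple_graph G" using C(2) G by blast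
    then have E2: "E \<subseteq> [verts G]\<^bsup>2\<^esup>" and finV: "finite (verts G)"
      by (auto simp: finite_simple_graph_def simple_graph_def E_def)
    have EV: "e \<subseteq> verts G" if "e \<in> E" for e using E2 that by (auto simp: nsets_def)
    have finS: "finite S" using SV finV finite_subset by blast
    have walkV: "set p \<subseteq> verts G" if "walk E u p v" "u \<in> verts G" for u p v
      using walk_edge_in_Union[OF that(1)] EV that(2) by (cases "p = [u]") fastforce+

    obtain L where L: "finite L" "\<And>v q w. (v, q, w) \<in> L \<Longrightarrow> link E S (2 * r) v q w"
      "inj_on (\<lambda>(v, q, w). {v, w}) L"
      "\<And>v q w v' q' w'. (v, q, w) \<in> L \<Longrightarrow> (v', q', w') \<in> L \<Longrightarrow>
        (v, q, w) \<noteq> (v', q', w') \<Longrightarrow> set q \<inter> set q' = {}"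
      "\<And>v q w. link E S (2 * r) v q w \<Longrightarrow> {v, w} \<notin> (\<lambda>(v, q, w). {v, w}) ` L \<Longrightarrow>
        \<exists>(v', q', w')\<in>L. set q \<inter> set q' \<noteq> {}"
      by (rule maximal_links[OF finS, of E "2 * r"]) blast
    define F where "F = (\<lambda>(v, q, w). {v, w}) ` L"
    define M where "M = (\<Union>(v, q, w)\<in>L. set q)"
    have F2: "F \<subseteq> [S]\<^bsup>2\<^esup>" using L(2) by (fastforce simp: F_def link_def)
    let ?B = "\<lambda>v. insert v (\<Union>{set q | q. \<exists>w. (v, q, w) \<in> L})"
    have linkV: "set q \<subseteq> verts G" if "(v, q, w) \<in> L" for v q w
      using L(2)[OF that] walkV[of v "v # q @ [w]" w] SV unfolding link_def by auto
    have cardF: "card F \<le> c1 * card S"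
    proof (rule c1[OF G fsg finS, folded E_def, of ?B])
      show "branch_sets E (2 * r) S ?B" using L(2,4) by (rule branch_sets_of_links)
      show "\<Union>(?B ` S) \<subseteq> verts G" using linkV SV by blast
      show "\<exists>x\<in>?B u. \<exists>y\<in>?B v. {x, y} \<in> E" if "{u, v} \<in> F" for u v
      proof -
        obtain y where "{u, v} = (\<lambda>(v, q, w). {v, w}) y" "y \<in> L"
          using \<open>{u, v} \<in> F\<close> unfolding F_def by (rule imageE)
        then obtain a q b where ab: "(a, q, b) \<in> L" "{u, v} = {a, b}" by (cases y) simp
        obtain x where x: "x \<in> insert a (set q)" "{x, b} \<in> E" using link_last_edge[OF L(2)[OF ab(1)]] by blast
        have "x \<in> ?B a" "b \<in> ?B b" using x ab by auto
        then show ?thesis using edge_between_pair[of u v a b x ?B b E] x(2) ab(2) by simp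
      qed
    qed (rule F2)
    have "card M \<le> 2 * r * card L"
    proof -
      have "card M \<le> (\<Sum>(v, q, w)\<in>L. card (set q))"
        unfolding M_def using card_UN_le[OF L(1), of "\<lambda>(v, q, w). set q"] by (simp add: case_prod_unfold)
      also have "\<dots> \<le> (\<Sum>x\<in>L. 2 * r)"
      proof (rule sum_mono)
        fix x assume x: "x \<in> L"
        obtain v q w where vqw: "x = (v, q, w)" by (cases x)
        have "length q \<le> 2 * r" using L(2) x unfolding vqw link_def by blast
        then show "(case x of (v, q, w) \<Rightarrow> card (set q)) \<le> 2 * r"
          using card_length[of q] vqw by simp
      qed
      finally show ?thesis by (simp add: mult.commute)
    qed
    also have "card L = card F" using card_image[OF L(3)] by (simp add: F_def)
    finally have cardM: "card M \<le> 2 * r * c1 * card S"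
      using cardF by (metis mult.assoc mult_le_mono2 order_trans)
    have finM: "finite M" using L(1) by (auto simp: M_def)
    obtain R where R: "R \<subseteq> S" "\<And>u v. u \<in> R \<Longrightarrow> v \<in> R \<Longrightarrow> {u, v} \<notin> F"
      "card S \<le> 2 * (4 * c1 + 1) * card R"
      using large_independent_set[OF finS F2 cardF] by metis
    have finR: "finite R" using R(1) finS finite_subset by blast
    have Rpos: "card R > 0" using R(3) ne finS by (cases "card R") auto
    have link_hits: "set q \<inter> M \<noteq> {}" if "v \<in> R" "w \<in> R" "link E S (2 * r) v q w" for v q w
      using L(5)[OF that(3)] R(2)[OF that(1,2)] unfolding F_def M_def by fastforce

    \<comment> \<open>The vertices of a maximal fan form a hitting set, so every maximal fan has more than \<open>p\<close>
      members.\<close>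
    have "\<exists>Q. finite Q \<and> p < card Q \<and> (\<forall>q\<in>Q. fan_walk E S r v q) \<and>
        (\<forall>q\<in>Q. \<forall>q'\<in>Q. q \<noteq> q' \<longrightarrow> set q \<inter> set q' = {})" if v: "v \<in> S" for v
    proof -
      obtain Q where Q: "finite Q" "\<And>q. q \<in> Q \<Longrightarrow> fan_walk E S r v q"
        "\<And>q q'. q \<in> Q \<Longrightarrow> q' \<in> Q \<Longrightarrow> q \<noteq> q' \<Longrightarrow> set q \<inter> set q' = {}"
        "\<And>q. fan_walk E S r v q \<Longrightarrow> \<exists>q'\<in>Q. set q \<inter> set q' \<noteq> {}"
        by (rule maximal_fan[OF finS, of E r v]) blast
      have "\<not> card (\<Union>(set ` Q)) \<le> m"
      proof
        assume le: "card (\<Union>(set ` Q)) \<le> m"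
        have "set q \<inter> \<Union>(set ` Q) \<noteq> {}" if "fan_walk E S r v q" for q
          using Q(4)[OF that] by blast
        moreover have "finite (\<Union>(set ` Q))" using Q(1) by simp
        ultimately show False using contra v le unfolding E_def by metis
      qed
      moreover have "card (\<Union>(set ` Q)) \<le> card Q * r"
      proof -
        have "card (\<Union>(set ` Q)) \<le> (\<Sum>q\<in>Q. card (set q))" by (rule card_UN_le[OF Q(1)])
        also have "\<dots> \<le> (\<Sum>q\<in>Q. r)"
        proof (rule sum_mono)
          fix q assume "q \<in> Q"
          then have "length q \<le> r" using Q(2) by (simp add: fan_walk_def)
          then show "card (set q) \<le> r" using card_length[of q] by simp
        qed
        finally show ?thesis by simp
      qed
      ultimately have "p < card Q" unfolding m_def
        by (metis leI mult_le_mono1 order_trans)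
      then show ?thesis using Q by blast
    qed
    then obtain Q where Q: "\<And>v. v \<in> S \<Longrightarrow> finite (Q v)" "\<And>v. v \<in> S \<Longrightarrow> p < card (Q v)"
      "\<And>v q. v \<in> S \<Longrightarrow> q \<in> Q v \<Longrightarrow> fan_walk E S r v q"
      "\<And>v q q'. v \<in> S \<Longrightarrow> q \<in> Q v \<Longrightarrow> q' \<in> Q v \<Longrightarrow> q \<noteq> q' \<Longrightarrow> set q \<inter> set q' = {}"
      by metis
    define T where "T = S \<union> M"
    define seg where "seg q = takeWhile (\<lambda>x. x \<notin> T) q" for q
    define stop where "stop q = hd (dropWhile (\<lambda>x. x \<notin> T) q)" for q
    have ST: "S \<subseteq> T" by (simp add: T_def)
    have split: "\<exists>q'. q = seg q @ stop q # q'" "stop q \<in> T" "set (seg q) \<inter> T = {}" "stop q \<in> set q"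
      if "v \<in> S" "q \<in> Q v" for v q
      using fan_walk_split[OF Q(3)[OF that] ST] unfolding seg_def stop_def
      by (blast, blast, blast, metis in_set_conv_decomp)
    have stopR: "stop q \<notin> R" if v: "v \<in> R" "q \<in> Q v" for v q
    proof
      assume sR: "stop q \<in> R"
      have vS: "v \<in> S" using v R(1) by blast
      obtain q' where q': "q = seg q @ stop q # q'" using split(1)[OF vS v(2)] by blast
      have fw: "fan_walk E S r v (seg q @ stop q # q')" using Q(3)[OF vS v(2)] q' by simp
      have "v \<noteq> stop q" using fan_walk_not_start[OF Q(3)[OF vS v(2)] vS] split(4)[OF vS v(2)] by blast
      then have "link E S (2 * r) v (seg q) (stop q)"
        using fan_walk_prefix[OF fw] vS sR R(1) split(3)[OF vS v(2)] ST by (auto simp: link_def)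
      then show False using link_hits[OF v(1) sR] split(3)[OF vS v(2)] by (auto simp: T_def)
    qed
    define B where "B v = (if v \<in> R then insert v (\<Union>(set ` seg ` Q v)) else {v})" for v
    have walk_seg: "\<exists>q1. walk E v (v # q1 @ [x]) x \<and> set (q1 @ [x]) \<subseteq> set (seg q) \<and> length (q1 @ [x]) \<le> r"
      if v: "v \<in> R" "q \<in> Q v" and x: "x \<in> set (seg q)" for v q x
    proof -
      have vS: "v \<in> S" using v R(1) by blast
      obtain q1 q2 where q1: "seg q = q1 @ x # q2" using x by (meson split_list)
      then obtain q3 where q3: "q = q1 @ x # q3" using split(1)[OF vS v(2)] by auto
      show ?thesis using fan_walk_prefix[of E S r v q1 x q3] Q(3)[OF vS v(2)] q1 q3 by auto
    qed
    have seg_disj: "set (seg q) \<inter> set (seg q') = {}"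
      if v: "v \<in> R" "q \<in> Q v" and v': "v' \<in> R" "q' \<in> Q v'" and "v \<noteq> v'" for v q v' q'
    proof (rule ccontr)
      assume "\<not> ?thesis"
      then obtain x where x: "x \<in> set (seg q)" "x \<in> set (seg q')" by blast
      have vS: "v \<in> S" "v' \<in> S" using v v' R(1) by auto
      obtain q1 where q1: "walk E v (v # q1 @ [x]) x" "set (q1 @ [x]) \<subseteq> set (seg q)" "length (q1 @ [x]) \<le> r"
        using walk_seg[OF v x(1)] by blast
      obtain q2 where q2: "walk E v' (v' # q2 @ [x]) x" "set (q2 @ [x]) \<subseteq> set (seg q')" "length (q2 @ [x]) \<le> r"
        using walk_seg[OF v' x(2)] by blast
      have T: "set (q1 @ x # q2) \<inter> T = {}"
        using q1(2) q2(2) split(3)[OF vS(1) v(2)] split(3)[OF vS(2) v'(2)] by auto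
      then have S: "set (q1 @ x # q2) \<inter> S = {}" using ST by blast
      have "length (q1 @ x # q2) \<le> 2 * r" using q1(3) q2(3) by simp
      then have "link E S (2 * r) v (q1 @ x # rev q2) v'"
        by (rule link_of_crossing_walks[OF q1(1) q2(1) vS \<open>v \<noteq> v'\<close> S])
      then have "set (q1 @ x # rev q2) \<inter> M \<noteq> {}" by (rule link_hits[OF v(1) v'(1)])
      then show False using T by (auto simp: T_def)
    qed
    have bs: "branch_sets E r T B"
      unfolding branch_sets_def
    proof (intro conjI ballI)
      have segT: "set (seg q) \<inter> T = {}" if "v \<in> R" "q \<in> Q v" for v q using split(3) that R(1) by blast
      show "disjoint_family_on B T"
        unfolding disjoint_family_on_def
      proof (intro ballI impI)
        fix v w assume vw: "v \<in> T" "w \<in> T" "v \<noteq> w"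
        have memB: "x = u \<or> (\<exists>q. u \<in> R \<and> q \<in> Q u \<and> x \<in> set (seg q))" if "x \<in> B u" for x u
          using that by (auto simp: B_def split: if_splits)
        show "B v \<inter> B w = {}"
        proof (rule ccontr)
          assume "B v \<inter> B w \<noteq> {}"
          then obtain x where x: "x \<in> B v" "x \<in> B w" by blast
          have noT: "x \<notin> T" if "u \<in> R" "q \<in> Q u" "x \<in> set (seg q)" for u q
            using segT[OF that(1,2)] that(3) by blast
          have noB: False if "v \<in> R" "q \<in> Q v" "x \<in> set (seg q)" "w \<in> R" "q' \<in> Q w" "x \<in> set (seg q')" for q q'
            using seg_disj[OF that(1,2,4,5) vw(3)] that(3,6) by blast
          from memB[OF x(1)] memB[OF x(2)] show False
            by (elim disjE exE conjE) (use vw noT noB in blast)+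
        qed
      qed
      fix v assume v: "v \<in> T"
      show "v \<in> B v" by (simp add: B_def)
      fix u assume u: "u \<in> B v"
      show "\<exists>p. walk E v p u \<and> set p \<subseteq> B v \<and> length p \<le> r + 1"
      proof (cases "u = v")
        case True
        then show ?thesis using u by (intro exI[of _ "[v]"]) auto
      next
        case False
        then obtain q where q: "v \<in> R" "q \<in> Q v" "u \<in> set (seg q)" using u by (auto simp: B_def split: if_splits)
        obtain q1 where "walk E v (v # q1 @ [u]) u" "set (q1 @ [u]) \<subseteq> set (seg q)" "length (q1 @ [u]) \<le> r"
          using walk_seg[OF q] by blast
        then show ?thesis using q by (intro exI[of _ "v # q1 @ [u]"]) (auto simp: B_def)
      qed
    qed
    \<comment> \<open>The edges of the second minor: one for each fan walk of each vertex in \<open>R\<close>.\<close>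
    define F' where "F' = (\<lambda>(v, q). {v, stop q}) ` (SIGMA v:R. Q v)"
    have "inj_on (\<lambda>(v, q). {v, stop q}) (SIGMA v:R. Q v)"
    proof (rule inj_onI, clarify)
      fix v q v' q' assume *: "v \<in> R" "q \<in> Q v" "v' \<in> R" "q' \<in> Q v'" "{v, stop q} = {v', stop q'}"
      then have eq: "v = v'" "stop q = stop q'" using stopR by (metis doubleton_eq_iff)+
      have "v \<in> S" using * R(1) by blast
      then have "q = q'" using Q(4)[of v q q'] split(4)[of v] * eq by (metis IntI emptyE)
      then show "v = v' \<and> q = q'" using eq by simp
    qed
    then have "card F' = (\<Sum>v\<in>R. card (Q v))"
      unfolding F'_def using finR Q(1) R(1) by (subst card_image) (auto simp: subset_iff)
    also have "\<dots> \<ge> (\<Sum>v\<in>R. p + 1)"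
      using Q(2) R(1) by (intro sum_mono) (auto simp: Suc_le_eq)
    finally have low: "card R * (p + 1) \<le> card F'" by simp
    have up: "card F' \<le> c2 * card T"
    proof (rule c2[OF G fsg _, folded E_def, OF _ bs])
      show "finite T" using finS finM by (simp add: T_def)
      have "M \<subseteq> verts G" unfolding M_def
      proof (rule UN_least)
        fix y assume y: "y \<in> L"
        obtain a q b where "y = (a, q, b)" by (cases y)
        then show "(case y of (v, q, w) \<Rightarrow> set q) \<subseteq> verts G" using linkV y by simp
      qed
      then have TV: "T \<subseteq> verts G" using SV by (simp add: T_def)
      have segV: "set (seg q) \<subseteq> verts G" if "v \<in> R" "q \<in> Q v" for v q
      proof -
        have v: "v \<in> S" "v \<in> verts G" using that R(1) SV by auto
        have "walk E v (v # q) (last q)" using Q(3)[OF v(1) that(2)] by (simp add: fan_walk_def)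
        then have "set q \<subseteq> verts G" using walkV v(2) by fastforce
        then show ?thesis unfolding seg_def using set_takeWhileD by fast
      qed
      show "\<Union>(B ` T) \<subseteq> verts G"
      proof (rule UN_least)
        fix v assume "v \<in> T"
        then show "B v \<subseteq> verts G" using TV segV[of v] by (auto simp: B_def)
      qed
      show "F' \<subseteq> [T]\<^bsup>2\<^esup>"
        unfolding F'_def
      proof (rule image_subsetI)
        fix y assume y: "y \<in> (SIGMA v:R. Q v)"
        obtain v q where vq: "y = (v, q)" "v \<in> R" "q \<in> Q v" using y by blast
        then have "v \<in> S" using R(1) by blast
        then have "stop q \<in> T" "v \<in> T" "stop q \<noteq> v" using split(2) vq ST stopR[OF vq(2,3)] by auto
        then show "(case y of (v, q) \<Rightarrow> {v, stop q}) \<in> [T]\<^bsup>2\<^esup>" by (simp add: vq)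
      qed
      show "\<exists>x\<in>B u. \<exists>y\<in>B v. {x, y} \<in> E" if uv: "{u, v} \<in> F'" for u v
      proof -
        obtain y where y: "{u, v} = (\<lambda>(v, q). {v, stop q}) y" "y \<in> (SIGMA v:R. Q v)"
          using uv unfolding F'_def by (rule imageE)
        obtain a q where aq: "y = (a, q)" by (cases y)
        then have a: "a \<in> R" "q \<in> Q a" "{u, v} = {a, stop q}" using y by simp_all
        then have aS: "a \<in> S" using R(1) by blast
        obtain q' where q': "q = seg q @ stop q # q'" using split(1)[OF aS a(2)] by blast
        have "walk E a (a # seg q @ [stop q]) (stop q)"
          using fan_walk_prefix(1)[of E S r a "seg q" "stop q" q'] Q(3)[OF aS a(2)] q' by simp
        then have "successively (\<lambda>x y. {x, y} \<in> E) ((a # seg q) @ [stop q])" by (simp add: walk_def)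
        then have e: "{last (a # seg q), stop q} \<in> E" by (subst (asm) successively_append_iff) simp
        have "last (a # seg q) \<in> insert a (set (seg q))" by (metis last_in_set list.discI list.simps(15))
        moreover have "insert a (set (seg q)) \<subseteq> B a" using a by (auto simp: B_def)
        ultimately have "last (a # seg q) \<in> B a" by blast
        moreover have "stop q \<in> B (stop q)" by (simp add: B_def)
        ultimately show ?thesis using edge_between_pair[OF a(3)] e by metis
      qed
    qed
    have "card T \<le> card S + card M" unfolding T_def by (rule card_Un_le)
    also have "\<dots> \<le> (1 + 2 * r * c1) * card S" using cardM by simp
    also have "\<dots> \<le> (1 + 2 * r * c1) * (2 * (4 * c1 + 1) * card R)"
      using R(3) by (rule mult_le_mono2)
    finally have "card F' \<le> c2 * ((1 + 2 * r * c1) * (2 * (4 * c1 + 1) * card R))"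
      using up by (meson mult_le_mono2 order_trans)
    then have "card F' \<le> p * card R" unfolding p_def by (simp only: mult.assoc)
    then have "card R * (p + 1) \<le> p * card R" using low by linarith
    then show False using Rpos by simp
  qed
  then show thesis using that by blast
qed

section \<open>Weak reachability\<close>

text \<open>The vertex chosen from \<open>S\<close> becomes the largest one, so for the remaining vertices the sets of
smaller vertices do not change.\<close>

lemma ordering_by_elimination:
  assumes "finite S" and "\<And>S'. S' \<subseteq> S \<Longrightarrow> S' \<noteq> {} \<Longrightarrow> \<exists>v\<in>S'. P v S'"
  shows "\<exists>L :: 'a \<Rightarrow> nat. inj_on L S \<and> (\<forall>v\<in>S. P v {u\<in>S. L u \<le> L v})"
  using assms
proof (induction S rule: finite_psubset_induct)
  case (psubset S)
  show ?case
  proof (cases "S = {}")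
    case False
    then obtain v where v: "v \<in> S" "P v S" using psubset.prems by blast
    have "\<exists>L :: 'a \<Rightarrow> nat. inj_on L (S - {v}) \<and> (\<forall>u\<in>S - {v}. P u {w\<in>S - {v}. L w \<le> L u})"
    proof (rule psubset.IH)
      show "S - {v} \<subset> S" using v by blast
      show "\<exists>v\<in>S'. P v S'" if "S' \<subseteq> S - {v}" "S' \<noteq> {}" for S'
        using psubset.prems[of S'] that by blast
    qed
    then obtain L :: "'a \<Rightarrow> nat" where L: "inj_on L (S - {v})" "\<And>u. u \<in> S - {v} \<Longrightarrow> P u {w\<in>S - {v}. L w \<le> L u}"
      by blast
    \<comment> \<open>The sum exceeds all values of \<open>L\<close> on the other vertices.\<close>
    define L' where "L' = L(v := Suc (sum L (S - {v})))"
    have lt: "L u < L' v" if "u \<in> S - {v}" for u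
      using member_le_sum[of u "S - {v}" L] that psubset.hyps by (simp add: L'_def less_Suc_eq_le)
    have "{w\<in>S. L' w \<le> L' v} = S"
      using lt by (auto simp: L'_def less_imp_le)
    moreover have "{w\<in>S. L' w \<le> L' u} = {w\<in>S - {v}. L w \<le> L u}" if "u \<in> S - {v}" for u
      using lt[OF that] that by (auto simp: L'_def)
    moreover have "inj_on L' S"
    proof (rule inj_onI)
      fix x y assume xy: "x \<in> S" "y \<in> S" "L' x = L' y"
      show "x = y"
      proof (cases "x = v \<or> y = v")
        case True
        show ?thesis
        proof (rule ccontr)
          assume "x \<noteq> y"
          with True xy consider "x = v" "y \<in> S - {v}" | "y = v" "x \<in> S - {v}" by blast
          then show False
          proof cases
            case 1
            then show False using lt[OF 1(2)] xy(3) by (simp add: L'_def)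
          next
            case 2
            then show False using lt[OF 2(2)] xy(3) by (simp add: L'_def)
          qed
        qed
      next
        case False
        then show ?thesis using inj_onD[OF L(1), of x y] xy by (simp add: L'_def)
      qed
    qed
    ultimately have "P u {w\<in>S. L' w \<le> L' u}" if "u \<in> S" for u
      using v(2) L(2)[of u] that by (cases "u = v") simp_all
    then show ?thesis using \<open>inj_on L' S\<close> by blast
  qed auto
qed

definition weak_reach :: "'a set set \<Rightarrow> ('a \<Rightarrow> nat) \<Rightarrow> nat \<Rightarrow> 'a \<Rightarrow> 'a set" where
  "weak_reach E L s v = {u. \<exists>p. walk E v p u \<and> length p \<le> s + 1 \<and> (\<forall>x\<in>set p. L u \<le> L x)}"

lemma walk_in_vertices:
  assumes "E \<subseteq> [V]\<^bsup>2\<^esup>" "walk E u p v" "u \<in> V"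
  shows "set p \<subseteq> V"
proof
  fix x assume x: "x \<in> set p"
  show "x \<in> V"
  proof (cases "p = [u]")
    case False
    then obtain e where "e \<in> E" "x \<in> e" using walk_edge_in_Union[OF assms(2) False x] by blast
    then show ?thesis using assms(1) by (auto simp: nsets_def)
  qed (use x assms(3) in simp)
qed

text \<open>Consider a path from \<open>v\<close> to \<open>u\<close> on which \<open>u\<close> is minimal, and its first vertex \<open>y\<close> after \<open>v\<close> that
is smaller than \<open>v\<close>. The part up to \<open>y\<close> is a fan walk, so it contains some \<open>z\<close> in \<open>Z v\<close>; the rest
of the path shows that \<open>z\<close> weakly reaches \<open>u\<close> in fewer steps.\<close>

lemma weak_reach_bound:
  assumes E: "E \<subseteq> [V]\<^bsup>2\<^esup>" and V: "finite V" and L: "inj_on L V"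
    and Z: "\<And>v. v \<in> V \<Longrightarrow> finite (Z v) \<and> card (Z v) \<le> m"
      "\<And>v q. v \<in> V \<Longrightarrow> fan_walk E {u\<in>V. L u \<le> L v} r v q \<Longrightarrow> set q \<inter> Z v \<noteq> {}"
  shows "s \<le> r \<Longrightarrow> v \<in> V \<Longrightarrow> card (weak_reach E L s v) \<le> (m + 1) ^ s"
proof (induction s arbitrary: v)
  case 0
  have "weak_reach E L 0 v \<subseteq> {v}"
    unfolding weak_reach_def walk_def by (auto simp: le_Suc_eq length_Suc_conv)
  then have "card (weak_reach E L 0 v) \<le> card {v}" by (intro card_mono) auto
  then show ?case by simp
next
  case (Suc s)
  have fin: "finite (weak_reach E L s z)" if "z \<in> V" for z
  proof (rule finite_subset[OF _ V])
    show "weak_reach E L s z \<subseteq> V"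
      using walk_in_vertices[OF E _ that] unfolding weak_reach_def walk_def by fastforce
  qed
  have "weak_reach E L (Suc s) v \<subseteq> insert v (\<Union>z\<in>Z v \<inter> V. weak_reach E L s z)"
  proof
    fix u assume "u \<in> weak_reach E L (Suc s) v"
    then obtain p0 where "walk E v p0 u" "length p0 \<le> s + 2" "\<forall>x\<in>set p0. L u \<le> L x"
      by (auto simp: weak_reach_def)
    then obtain p where p: "walk E v p u" "length p \<le> s + 2" "\<forall>x\<in>set p. L u \<le> L x" "distinct p"
      using walk_shorten[of E v p0 u] by (meson le_trans subsetD)
    show "u \<in> insert v (\<Union>z\<in>Z v \<inter> V. weak_reach E L s z)"
    proof (cases "u = v")
      case False
      then obtain q where q: "p = v # q" "q \<noteq> []" using p(1) by (cases p) (auto simp: walk_def split: if_splits)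
      have pV: "set p \<subseteq> V" using walk_in_vertices[OF E p(1) Suc.prems(2)] .
      let ?S = "{u\<in>V. L u \<le> L v}"
      have "last q = u" using p(1) q by (auto simp: walk_def)
      then have "u \<in> set q" using q by auto
      then have "u \<in> set q" "u \<in> ?S" using pV p(3) q by auto
      then obtain q1 y q2 where y: "q = q1 @ y # q2" "y \<in> ?S" "\<forall>x\<in>set q1. x \<notin> ?S"
        using split_list_first_prop[of q "\<lambda>x. x \<in> ?S"] by blast
      have "walk E v (v # q1 @ [y]) y" using walk_prefix[of E v "v # q1" y q2 u] p(1) q y by simp
      moreover have "y \<noteq> v" using p(4) q y by auto
      ultimately have "fan_walk E ?S r v (q1 @ [y])"
        using y p(2) q Suc.prems(1) by (auto simp: fan_walk_def)
      then obtain z where z: "z \<in> set (q1 @ [y])" "z \<in> Z v" using Z(2)[OF Suc.prems(2)] by blast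
      then have "z \<in> set q" using y by auto
      then obtain a b where ab: "q = a @ z # b" by (meson split_list)
      have "walk E z (z # b) u" using walk_suffix[of E v "v # a" z b u] p(1) q ab by simp
      then have "u \<in> weak_reach E L s z"
        unfolding weak_reach_def using p(2,3) q ab by (intro CollectI exI[of _ "z # b"]) auto
      then show ?thesis using z pV q \<open>z \<in> set q\<close> by auto
    qed simp
  qed
  then have "card (weak_reach E L (Suc s) v) \<le> card (insert v (\<Union>z\<in>Z v \<inter> V. weak_reach E L s z))"
    using fin V by (intro card_mono) auto
  also have "\<dots> \<le> 1 + card (\<Union>z\<in>Z v \<inter> V. weak_reach E L s z)"
    using V fin by (subst card_insert_if) auto
  also have "card (\<Union>z\<in>Z v \<inter> V. weak_reach E L s z) \<le> (\<Sum>z\<in>Z v \<inter> V. card (weak_reach E L s z))"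
    using V by (intro card_UN_le) simp
  also have "\<dots> \<le> (\<Sum>z\<in>Z v \<inter> V. (m + 1) ^ s)"
    using Suc by (intro sum_mono) auto
  also have "\<dots> = card (Z v \<inter> V) * (m + 1) ^ s" by simp
  also have "\<dots> \<le> m * (m + 1) ^ s"
    using Z(1)[OF Suc.prems(2)] card_mono[of "Z v" "Z v \<inter> V"] by (intro mult_le_mono1) auto
  also have "1 + \<dots> \<le> (m + 1) ^ Suc s" by simp
  finally show ?case by simp
qed

section \<open>Construction sequences from orderings\<close>

definition coarser :: "'a set set \<Rightarrow> 'a set set \<Rightarrow> bool" where
  "coarser P Q \<longleftrightarrow> (\<forall>A\<in>P. \<exists>B\<in>Q. A \<subseteq> B)"

text \<open>Carrying \<open>ok\<close> along the steps bounds the width of the intermediate states together with the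
existence of the sequence.\<close>

abbreviation good_step :: "('a cs_state \<Rightarrow> bool) \<Rightarrow> 'a cs_state \<Rightarrow> 'a cs_state \<Rightarrow> bool" where
  "good_step ok s s' \<equiv> cs_step s s' \<and> ok s'"

lemma partition_part_unique:
  "partition_on V P \<Longrightarrow> A \<in> P \<Longrightarrow> B \<in> P \<Longrightarrow> x \<in> A \<Longrightarrow> x \<in> B \<Longrightarrow> A = B"
  by (metis disjointD disjoint_iff partition_onD2)

lemma partition_part_ex: "partition_on V P \<Longrightarrow> x \<in> V \<Longrightarrow> \<exists>A\<in>P. x \<in> A"
  by (metis UnionE partition_onD1)

lemma partition_part_subset: "partition_on V P \<Longrightarrow> A \<in> P \<Longrightarrow> A \<subseteq> V"
  by (metis Union_upper partition_onD1)

lemma partition_part_nonempty: "partition_on V P \<Longrightarrow> A \<in> P \<Longrightarrow> \<exists>x. x \<in> A"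
  by (metis ex_in_conv partition_onD3)

lemma partition_on_merge:
  assumes P: "partition_on V P" and A: "A \<in> P" "B \<in> P"
  shows "partition_on V (P - {A, B} \<union> {A \<union> B})"
proof (rule partition_onI)
  show "\<Union>(P - {A, B} \<union> {A \<union> B}) = V" using P A partition_onD1 by fastforce
  show "disjnt p q" if "p \<in> P - {A, B} \<union> {A \<union> B}" "q \<in> P - {A, B} \<union> {A \<union> B}" "p \<noteq> q" for p q
    using that partition_part_unique[OF P] A unfolding disjnt_iff by blast
  show "{} \<notin> P - {A, B} \<union> {A \<union> B}"
    using partition_onD3[OF P] partition_part_nonempty[OF P A(1)] by auto
qed

lemma merge_to_coarser:
  assumes V: "finite V" and P: "partition_on V P" "partition_on V P'" "coarser P P'"
    and ok: "\<And>Q. partition_on V Q \<Longrightarrow> coarser P Q \<Longrightarrow> ok (Q, E, N, U)"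
  shows "(good_step ok)\<^sup>*\<^sup>* (P, E, N, U) (P', E, N, U)"
  using P ok
proof (induction "card P" arbitrary: P rule: less_induct)
  case less
  show ?case
  proof (cases "\<exists>B\<in>P'. \<exists>A1\<in>P. \<exists>A2\<in>P. A1 \<noteq> A2 \<and> A1 \<subseteq> B \<and> A2 \<subseteq> B")
    case False
    have "A \<in> P'" if A: "A \<in> P" for A
    proof -
      obtain B where B: "B \<in> P'" "A \<subseteq> B" using less.prems(3) A by (auto simp: coarser_def)
      have "x \<in> A" if x: "x \<in> B" for x
      proof -
        obtain A' where A': "A' \<in> P" "x \<in> A'"
          using partition_part_ex[OF less.prems(1), of x] partition_part_subset[OF less.prems(2) B(1)] x by blast
        then obtain B' where "B' \<in> P'" "A' \<subseteq> B'" using less.prems(3) by (auto simp: coarser_def)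
        then have "A' \<subseteq> B" using partition_part_unique[OF less.prems(2) B(1), of B' x] A' x by auto
        then show ?thesis using False A A' B by blast
      qed
      then show ?thesis using B by (metis subsetI subset_antisym)
    qed
    moreover have "B \<in> P" if B: "B \<in> P'" for B
    proof -
      obtain x where x: "x \<in> B" using partition_part_nonempty[OF less.prems(2) B] by blast
      then obtain A where A: "A \<in> P" "x \<in> A"
        using partition_part_ex[OF less.prems(1), of x] partition_part_subset[OF less.prems(2) B] by blast
      then have "A = B" using calculation partition_part_unique[OF less.prems(2) _ B] x by blast
      then show ?thesis using A by simp
    qed
    ultimately have "P = P'" by blast
    then show ?thesis by simp
  next
    case True
    then obtain B A1 A2 where B: "B \<in> P'" "A1 \<in> P" "A2 \<in> P" "A1 \<noteq> A2" "A1 \<subseteq> B" "A2 \<subseteq> B" by blast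
    \<comment> \<open>Merging two parts inside the same part of \<open>P'\<close> keeps all hypotheses.\<close>
    define P1 where "P1 = P - {A1, A2} \<union> {A1 \<union> A2}"
    have finP: "finite P" using finite_elements[OF V less.prems(1)] .
    have p1: "partition_on V P1" unfolding P1_def using partition_on_merge[OF less.prems(1) B(2,3)] .
    have c: "coarser P P1"
      unfolding coarser_def
    proof
      fix A assume "A \<in> P"
      show "\<exists>B\<in>P1. A \<subseteq> B"
      proof (cases "A = A1 \<or> A = A2")
        case True
        then show ?thesis unfolding P1_def by (intro bexI[of _ "A1 \<union> A2"]) auto
      next
        case False
        then show ?thesis using \<open>A \<in> P\<close> unfolding P1_def by (intro bexI[of _ A]) auto
      qed
    qed
    have c': "coarser P1 P'"
      unfolding coarser_def
    proof
      fix A assume "A \<in> P1"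
      then consider "A \<in> P" | "A = A1 \<union> A2" unfolding P1_def by blast
      then show "\<exists>B\<in>P'. A \<subseteq> B"
      proof cases
        case 1
        then show ?thesis using less.prems(3) by (auto simp: coarser_def)
      next
        case 2
        then show ?thesis using B by (intro bexI[of _ B]) auto
      qed
    qed
    have "card P1 \<le> card (P - {A1, A2}) + 1"
      unfolding P1_def using card_Un_le[of "P - {A1, A2}" "{A1 \<union> A2}"] by simp
    also have "card (P - {A1, A2}) = card P - 2" using B by (subst card_Diff_subset) auto
    also have "card P - 2 + 1 < card P"
      using card_mono[OF finP, of "{A1, A2}"] B by simp
    finally have lt: "card P1 < card P" .
    have "ok (Q, E, N, U)" if q: "partition_on V Q" "coarser P1 Q" for Q
    proof (rule less.prems(4)[OF q(1)])
      show "coarser P Q" unfolding coarser_def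
      proof
        fix A assume "A \<in> P"
        then obtain A' where "A' \<in> P1" "A \<subseteq> A'" using c by (auto simp: coarser_def)
        moreover from this obtain B where "B \<in> Q" "A' \<subseteq> B" using q(2) by (auto simp: coarser_def)
        ultimately show "\<exists>B\<in>Q. A \<subseteq> B" by blast
      qed
    qed
    then have "(good_step ok)\<^sup>*\<^sup>* (P1, E, N, U) (P', E, N, U)"
      using less.hyps[OF lt p1 less.prems(2) c'] by blast
    moreover have "good_step ok (P, E, N, U) (P1, E, N, U)"
      unfolding P1_def using cs_step.merge[OF B(2-4)] less.prems(4)[OF p1 c] P1_def by simp
    ultimately show ?thesis by (rule converse_rtranclp_into_rtranclp[rotated])
  qed
qed

lemma resolve_pairs:
  assumes "finite AA" "AA \<subseteq> P \<times> P"
    and ok: "\<And>E' U'. E \<subseteq> E' \<Longrightarrow> E' \<subseteq> E \<union> (U \<inter> (\<Union>(A, B)\<in>AA. pairs_between A B)) \<Longrightarrow> ok (P, E', N, U')"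
  shows "(good_step ok)\<^sup>*\<^sup>* (P, E, N, U)
    (P, E \<union> (U \<inter> (\<Union>(A, B)\<in>AA. pairs_between A B)), N, U - (\<Union>(A, B)\<in>AA. pairs_between A B))"
  using assms
proof (induction AA rule: finite_induct)
  case empty
  then show ?case by simp
next
  case (insert x F)
  obtain A B where x: "x = (A, B)" by (cases x)
  let ?X = "\<Union>(A, B)\<in>F. pairs_between A B"
  have before: "(good_step ok)\<^sup>*\<^sup>* (P, E, N, U) (P, E \<union> (U \<inter> ?X), N, U - ?X)"
  proof (rule insert.IH)
    show "F \<subseteq> P \<times> P" using insert.prems(1) by simp
    show "ok (P, E', N, U')" if "E \<subseteq> E'" "E' \<subseteq> E \<union> U \<inter> ?X" for E' U'
      using that(2) by (intro insert.prems(2)[OF that(1)]) auto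
  qed
  let ?E2 = "E \<union> (U \<inter> (\<Union>(A, B)\<in>insert x F. pairs_between A B))"
  let ?U2 = "U - (\<Union>(A, B)\<in>insert x F. pairs_between A B)"
  have "cs_step (P, E \<union> (U \<inter> ?X), N, U - ?X)
     (P, E \<union> (U \<inter> ?X) \<union> ((U - ?X) \<inter> pairs_between A B), N, U - ?X - pairs_between A B)"
    using insert.prems(1) x by (intro cs_step.resolve_positive) auto
  also have "E \<union> (U \<inter> ?X) \<union> ((U - ?X) \<inter> pairs_between A B) = ?E2" by (auto simp: x)
  also have "U - ?X - pairs_between A B = ?U2" by (auto simp: x)
  finally have "cs_step (P, E \<union> (U \<inter> ?X), N, U - ?X) (P, ?E2, N, ?U2)" .
  moreover have "ok (P, ?E2, N, ?U2)" by (rule insert.prems(2)) auto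
  ultimately have "good_step ok (P, E \<union> (U \<inter> ?X), N, U - ?X) (P, ?E2, N, ?U2)" by (rule conjI)
  with before show ?case by (rule rtranclp.rtrancl_into_rtrancl)
qed

lemma construction_list:
  assumes "(good_step ok)\<^sup>*\<^sup>* a b" "ok a"
  shows "\<exists>ss. ss \<noteq> [] \<and> hd ss = a \<and> last ss = b \<and> successively cs_step ss \<and> (\<forall>s\<in>set ss. ok s)"
  using assms
proof (induction rule: rtranclp_induct)
  case base
  then show ?case by (intro exI[of _ "[a]"]) auto
next
  case (step y z)
  then obtain ss where "ss \<noteq> []" "hd ss = a" "last ss = y" "successively cs_step ss" "\<forall>s\<in>set ss. ok s"
    by blast
  then show ?case using step.hyps
    by (intro exI[of _ "ss @ [z]"]) (auto simp: successively_append_iff)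
qed

text \<open>The vertices with equal keys form the parts of the construction sequence when the vertices below
\<open>t\<close> remain: these stay single, the others are classified by their neighbours below \<open>t\<close>.\<close>

definition key :: "'a set set \<Rightarrow> ('a \<Rightarrow> nat) \<Rightarrow> nat \<Rightarrow> 'a \<Rightarrow> 'a + 'a set" where
  "key E L t w = (if L w < t then Inl w else Inr {u. {w, u} \<in> E \<and> L u < t})"

definition key_parts :: "'a set \<Rightarrow> 'a set set \<Rightarrow> ('a \<Rightarrow> nat) \<Rightarrow> nat \<Rightarrow> 'a set set" where
  "key_parts V E L t = (\<lambda>w. {u\<in>V. key E L t u = key E L t w}) ` V"

definition upper_edges :: "'a set set \<Rightarrow> ('a \<Rightarrow> nat) \<Rightarrow> nat \<Rightarrow> 'a set set" where
  "upper_edges E L t = {e\<in>E. \<forall>x\<in>e. t \<le> L x}"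

lemma partition_key_parts: "partition_on V (key_parts V E L t)"
  by (rule partition_onI) (auto simp: key_parts_def disjnt_iff)

lemma key_parts_same: "A \<in> key_parts V E L t \<Longrightarrow> u \<in> A \<Longrightarrow> w \<in> A \<Longrightarrow> key E L t u = key E L t w"
  by (auto simp: key_parts_def)

lemma coarser_key_parts:
  assumes L: "inj_on L V"
  shows "coarser (key_parts V E L (Suc t)) (key_parts V E L t)"
  unfolding coarser_def
proof
  fix A assume A: "A \<in> key_parts V E L (Suc t)"
  then obtain w where w: "w \<in> V" "A = {u\<in>V. key E L (Suc t) u = key E L (Suc t) w}"
    by (auto simp: key_parts_def)
  have "key E L t u = key E L t w" if "u \<in> A" for u
  proof (cases "L w < Suc t")
    case True
    then show ?thesis using that w by (auto simp: key_def split: if_splits)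
  next
    case False
    then have "\<not> L u < Suc t" and eq: "{y. {u, y} \<in> E \<and> L y < Suc t} = {y. {w, y} \<in> E \<and> L y < Suc t}"
      using that w by (auto simp: key_def split: if_splits)
    have "{u, y} \<in> E \<longleftrightarrow> {w, y} \<in> E" if "L y < t" for y
      using eq that less_SucI by blast
    then show ?thesis using False \<open>\<not> L u < Suc t\<close> by (auto simp: key_def)
  qed
  moreover have "A \<subseteq> V" using partition_part_subset[OF partition_key_parts A] .
  ultimately have "A \<subseteq> {u\<in>V. key E L t u = key E L t w}" by blast
  moreover have "{u\<in>V. key E L t u = key E L t w} \<in> key_parts V E L t"
    unfolding key_parts_def using w(1) by (rule imageI)
  ultimately show "\<exists>B\<in>key_parts V E L t. A \<subseteq> B" by blast
qed

text \<open>The hypotheses on \<open>Q\<close>, \<open>E'\<close> and \<open>N'\<close> cover all states on the way from \<open>Suc t\<close> to \<open>t\<close>, so the keys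
are those for \<open>Suc t\<close> whereas the resolved pairs are bounded by those for \<open>t\<close>. A resolved walk of
positive length stays in the vertices from \<open>t\<close> on. If it ends in \<open>w\<close> and \<open>u\<close> below \<open>t\<close> is a
neighbour of \<open>w\<close>, then the walk extended by \<open>u\<close> shows that \<open>u\<close> is weakly reachable; so there are
few possible keys for \<open>w\<close>.\<close>

lemma reachable_parts_bound:
  assumes E: "E \<subseteq> [V]\<^bsup>2\<^esup>" and V: "finite V" and L: "inj_on L V"
    and W: "card (weak_reach E L (Suc r) v) \<le> W" and v: "v \<in> V"
    and Q: "partition_on V Q" "coarser (key_parts V E L (Suc t)) Q" and EN: "E' \<union> N' \<subseteq> upper_edges E L t"
  shows "card (reachable_parts V r (Q, E', N', U') v) \<le> 2 + 2 ^ (W + 1)"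
proof -
  \<comment> \<open>The vertex that is being removed, if there is one at \<open>t\<close>.\<close>
  define Y where "Y = {y\<in>V. L y = t}"
  have Y: "card Y \<le> 1" "finite Y" using L V by (auto simp: Y_def card_le_Suc0_iff_eq inj_on_def)
  define X where "X = weak_reach E L (Suc r) v \<inter> V \<union> Y"
  have finX: "finite X" using V Y by (simp add: X_def)
  have finW: "finite (weak_reach E L (Suc r) v)"
  proof (rule finite_subset[OF _ V], rule subsetI)
    fix u assume "u \<in> weak_reach E L (Suc r) v"
    then obtain p where "walk E v p u" by (auto simp: weak_reach_def)
    moreover from this have "u \<in> set p" by (auto simp: walk_def)
    ultimately show "u \<in> V" using walk_in_vertices[OF E _ v] by blast
  qed
  have cardX: "card X \<le> W + 1"
    using W Y card_Un_le[of "weak_reach E L (Suc r) v \<inter> V" Y]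
      card_mono[OF finW, of "weak_reach E L (Suc r) v \<inter> V"] unfolding X_def by auto
  \<comment> \<open>\<open>K\<close> collects the possible keys: \<open>Inl v\<close> occurs for the trivial walk only, \<open>Inl ` Y\<close> for the
    vertex being removed.\<close>
  define K where "K = insert (Inl v) (Inl ` Y \<union> Inr ` Pow X)"
  have "card K \<le> Suc (card (Inl ` Y \<union> Inr ` Pow X))"
    unfolding K_def using finX Y by (intro card_insert_le_m1) auto
  also have "card (Inl ` Y \<union> Inr ` Pow X) \<le> card (Inl ` Y :: ('a + 'a set) set) + card (Inr ` Pow X :: ('a + 'a set) set)"
    by (rule card_Un_le)
  also have "\<dots> \<le> 1 + 2 ^ (W + 1)"
  proof (rule add_mono)
    have "card (Inr ` Pow X :: ('a + 'a set) set) = 2 ^ card X"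
      by (simp add: card_image card_Pow finX)
    also have "\<dots> \<le> 2 ^ (W + 1)" using cardX by (rule power_increasing) simp
    finally show "card (Inr ` Pow X :: ('a + 'a set) set) \<le> 2 ^ (W + 1)" .
  qed (use Y in \<open>simp add: card_image\<close>)
  finally have cardK: "card K \<le> 2 + 2 ^ (W + 1)" by simp
  have key: "key E L (Suc t) w \<in> K"
    if p: "is_path (V, E' \<union> N') v p w" "path_length p \<le> r" for p w
  proof -
    have wp: "walk (upper_edges E L t) v p w" "walk E v p w" and lp: "length p \<le> Suc r"
      using p EN walk_mono[of "E' \<union> N'" v p w] by (auto simp: is_path_iff upper_edges_def path_length_def)
    have wV: "w \<in> V" using p by (auto simp: is_path_iff walk_def)
    show ?thesis
    proof (cases "p = [v] \<and> L v < t")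
      case True
      then show ?thesis using wp by (auto simp: K_def key_def)
    next
      case False
      have pt: "t \<le> L x" if "x \<in> set p" for x
        using walk_edge_in_Union[OF wp(1) _ that] False that by (cases "p = [v]") (auto simp: upper_edges_def)
      have wt: "t \<le> L w" using pt wp by (auto simp: walk_def)
      show ?thesis
      proof (cases "L w = t")
        case True
        then show ?thesis using wV by (auto simp: K_def key_def Y_def)
      next
        case F: False
        have "u \<in> X" if u: "{w, u} \<in> E" "L u < Suc t" for u
        proof -
          have uV: "u \<in> V" using u(1) E by (auto dest!: subsetD)
          show ?thesis
          proof (cases "L u = t")
            case False
            then have "L u < t" using u by simp
            moreover have "walk E v (p @ [u]) u" using walk_append[OF wp(2) u(1)] by simp
            ultimately have "u \<in> weak_reach E L (Suc r) v"
              unfolding weak_reach_def using pt lp by (intro CollectI exI[of _ "p @ [u]"]) fastforce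
            then show ?thesis using uV by (simp add: X_def)
          qed (use uV in \<open>simp add: X_def Y_def\<close>)
        qed
        then have "{u. {w, u} \<in> E \<and> L u < Suc t} \<in> Pow X" by blast
        then have "Inr {u. {w, u} \<in> E \<and> L u < Suc t} \<in> K" unfolding K_def by blast
        then show ?thesis using F wt by (simp add: key_def)
      qed
    qed
  qed
  define R where "R = reachable_parts V r (Q, E', N', U') v"
  have "\<exists>w\<in>A. w \<in> V \<and> key E L (Suc t) w \<in> K" if "A \<in> R" for A
    using that key partition_part_subset[OF Q(1)] unfolding R_def reachable_parts_def by fastforce
  then obtain f where f: "\<And>A. A \<in> R \<Longrightarrow> f A \<in> A \<and> f A \<in> V \<and> key E L (Suc t) (f A) \<in> K" by metis
  have RQ: "R \<subseteq> Q" by (auto simp: R_def reachable_parts_def)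
  have "inj_on (\<lambda>A. key E L (Suc t) (f A)) R"
  proof (rule inj_onI)
    fix A B assume AB: "A \<in> R" "B \<in> R" "key E L (Suc t) (f A) = key E L (Suc t) (f B)"
    let ?C = "{u\<in>V. key E L (Suc t) u = key E L (Suc t) (f A)}"
    have "?C \<in> key_parts V E L (Suc t)" using f[OF AB(1)] by (auto simp: key_parts_def)
    then obtain D where D: "D \<in> Q" "?C \<subseteq> D" using Q(2) by (auto simp: coarser_def)
    have "f A \<in> D" "f B \<in> D" using D f AB by auto
    then show "A = B" using partition_part_unique[OF Q(1)] D(1) f AB RQ by (metis subsetD)
  qed
  then have "card R \<le> card K" by (rule card_inj_on_le) (use f finX Y in \<open>auto simp: K_def\<close>)
  then show ?thesis using cardK unfolding R_def by linarith
qed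

definition ordering_state :: "'a set \<Rightarrow> 'a set set \<Rightarrow> ('a \<Rightarrow> nat) \<Rightarrow> nat \<Rightarrow> 'a cs_state" where
  "ordering_state V E L t = (key_parts V E L t, upper_edges E L t, {}, [V]\<^bsup>2\<^esup> - upper_edges E L t)"

lemma key_parts_low:
  assumes "A \<in> key_parts V E L t" "x \<in> A" "L x < t"
  shows "A = {x}"
  using assms by (auto simp: key_parts_def key_def split: if_splits)

text \<open>The vertex \<open>x\<close> at \<open>t\<close> is complete or empty to every part above \<open>t\<close>, because the parts are defined
by adjacency to the vertices up to \<open>t\<close>. So resolving \<open>x\<close> positively with the adjacent parts
resolves exactly its edges to vertices above \<open>t\<close>; then the parts that only adjacency to \<open>x\<close>
distinguishes are merged.\<close>

lemma ordering_step:
  assumes E: "E \<subseteq> [V]\<^bsup>2\<^esup>" and V: "finite V" and L: "inj_on L V"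
    and ok: "\<And>Q E' U'. partition_on V Q \<Longrightarrow> coarser (key_parts V E L (Suc t)) Q \<Longrightarrow>
      E' \<subseteq> upper_edges E L t \<Longrightarrow> ok (Q, E', {}, U')"
  shows "(good_step ok)\<^sup>*\<^sup>* (ordering_state V E L (Suc t)) (ordering_state V E L t)"
proof -
  let ?P = "key_parts V E L (Suc t)" and ?P' = "key_parts V E L t"
  let ?E = "upper_edges E L (Suc t)" and ?E' = "upper_edges E L t"
  let ?U = "[V]\<^bsup>2\<^esup> - ?E"
  define AA where "AA = {(A, B) \<in> ?P \<times> ?P. \<exists>x\<in>A. \<exists>w\<in>B. L x = t \<and> t < L w \<and> {x, w} \<in> E}"
  define X where "X = (\<Union>(A, B)\<in>AA. pairs_between A B)"
  have finP: "finite ?P" using V by (simp add: key_parts_def)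
  have AA: "AA \<subseteq> ?P \<times> ?P" by (auto simp: AA_def)
  then have finAA: "finite AA" using finP by (meson finite_SigmaI finite_subset)
  have sub: "?E \<subseteq> ?E'" by (auto simp: upper_edges_def)
  have UX: "?U \<inter> X = ?E' - ?E"
  proof
    show "?U \<inter> X \<subseteq> ?E' - ?E"
    proof
      fix e assume e: "e \<in> ?U \<inter> X"
      then obtain A B where AB: "(A, B) \<in> AA" "e \<in> pairs_between A B" unfolding X_def by blast
      then obtain x w where x: "A \<in> ?P" "B \<in> ?P" "x \<in> A" "w \<in> B" "L x = t" "t < L w" "{x, w} \<in> E"
        by (auto simp: AA_def)
      have "A = {x}" using key_parts_low[OF x(1,3)] x(5) by simp
      then obtain b where b: "b \<in> B" "e = {x, b}" using AB by (auto simp: pairs_between_def)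
      have "key E L (Suc t) b = key E L (Suc t) w" using key_parts_same[OF x(2) b(1) x(4)] .
      then have "t < L b" "{u. {b, u} \<in> E \<and> L u < Suc t} = {u. {w, u} \<in> E \<and> L u < Suc t}"
        using x(6) by (auto simp: key_def split: if_splits)
      moreover have "x \<in> {u. {w, u} \<in> E \<and> L u < Suc t}" using x by (simp add: insert_commute)
      ultimately have "{b, x} \<in> E" "t < L b" by blast+
      then have "{x, b} \<in> ?E'" using x(5) by (auto simp: upper_edges_def insert_commute)
      then show "e \<in> ?E' - ?E" using e b by blast
    qed
    show "?E' - ?E \<subseteq> ?U \<inter> X"
    proof
      fix e assume e: "e \<in> ?E' - ?E"
      then have eE: "e \<in> E" "\<forall>x\<in>e. t \<le> L x" "\<not> (\<forall>x\<in>e. Suc t \<le> L x)" by (auto simp: upper_edges_def)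
      then have e2: "e \<in> [V]\<^bsup>2\<^esup>" using E by blast
      obtain x where x: "x \<in> e" "L x = t" using eE(2,3) by (metis le_antisym not_less_eq_eq)
      obtain w where w: "e = {x, w}" "w \<noteq> x" "x \<in> V" "w \<in> V"
        using e2 x(1) by (auto elim!: pairE)
      have "L w \<noteq> L x" using L w by (auto dest: inj_onD)
      then have lw: "t < L w" using eE(2) w(1) x(2) by auto
      obtain A where A: "A \<in> ?P" "x \<in> A" using partition_part_ex[OF partition_key_parts w(3)] by blast
      obtain B where B: "B \<in> ?P" "w \<in> B" using partition_part_ex[OF partition_key_parts w(4)] by blast
      have "(A, B) \<in> AA" using A B x(2) lw eE(1) w(1) unfolding AA_def by blast
      moreover have "e \<in> pairs_between A B" using A B w(1) by (auto simp: pairs_between_def)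
      ultimately have "e \<in> X" unfolding X_def by blast
      then show "e \<in> ?U \<inter> X" using e e2 by blast
    qed
  qed
  have "(good_step ok)\<^sup>*\<^sup>* (?P, ?E, {}, ?U) (?P, ?E \<union> (?U \<inter> X), {}, ?U - X)"
    unfolding X_def
  proof (rule resolve_pairs[OF finAA AA], fold X_def)
    show "ok (?P, E', {}, U')" if "E' \<subseteq> ?E \<union> ?U \<inter> X" for E' U'
    proof (rule ok[OF partition_key_parts])
      show "coarser ?P ?P" by (auto simp: coarser_def)
      show "E' \<subseteq> ?E'" using that UX sub by blast
    qed
  qed
  moreover have "?E \<union> (?U \<inter> X) = ?E'" using UX sub by blast
  moreover have "?U - X = [V]\<^bsup>2\<^esup> - ?E'"
  proof -
    have "?U - X = ?U - (?U \<inter> X)" by blast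
    also have "\<dots> = ?U - (?E' - ?E)" by (simp only: UX)
    also have "\<dots> = [V]\<^bsup>2\<^esup> - ?E'" using sub by blast
    finally show ?thesis .
  qed
  ultimately have 1: "(good_step ok)\<^sup>*\<^sup>* (?P, ?E, {}, ?U) (?P, ?E', {}, [V]\<^bsup>2\<^esup> - ?E')" by simp
  have 2: "(good_step ok)\<^sup>*\<^sup>* (?P, ?E', {}, [V]\<^bsup>2\<^esup> - ?E') (?P', ?E', {}, [V]\<^bsup>2\<^esup> - ?E')"
    by (rule merge_to_coarser[OF V partition_key_parts partition_key_parts coarser_key_parts[OF L]])
      (use ok in blast)
  show ?thesis unfolding ordering_state_def using rtranclp_trans[OF 1 2] .
qed

lemma cs_width_le:
  "(\<And>s v. s \<in> set ss \<Longrightarrow> v \<in> V \<Longrightarrow> card (reachable_parts V r s v) \<le> K) \<Longrightarrow> cs_width V r ss \<le> K"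
  unfolding cs_width_def by (rule Least_le) blast

text \<open>Before the final step, no pair is resolved negatively, so the resolved pairs are edges and
resolved walks are walks of \<open>G\<close>. In the end the single part is resolved with itself.\<close>

lemma merge_width_le_weak_reach:
  assumes G: "finite_simple_graph G" and L: "inj_on L (verts G)"
    and W: "\<And>v. v \<in> verts G \<Longrightarrow> card (weak_reach (edges G) L (Suc r) v) \<le> W"
  shows "merge_width r G \<le> enat (2 + 2 ^ (W + 1))"
proof -
  define V E where "V = verts G" and "E = edges G"
  define K :: nat where "K = 2 + 2 ^ (W + 1)"
  define ok where "ok s \<longleftrightarrow> (\<forall>v\<in>V. card (reachable_parts V r s v) \<le> K)" for s
  have V: "finite V" and E: "E \<subseteq> [V]\<^bsup>2\<^esup>" and LV: "inj_on L V"
    using G L by (auto simp: V_def E_def finite_simple_graph_def simple_graph_def)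
  have okI: "ok (Q, E', N', U')"
    if "partition_on V Q" "coarser (key_parts V E L (Suc t)) Q" "E' \<union> N' \<subseteq> upper_edges E L t" for Q E' N' U' t
    unfolding ok_def K_def
    using reachable_parts_bound[OF E V LV _ _ that] W by (auto simp: V_def E_def)
  obtain n where n: "\<And>v. v \<in> V \<Longrightarrow> L v < n"
    using V finite_nat_set_iff_bounded[of "L ` V"] by auto
  have init: "ordering_state V E L n = cs_initial V"
  proof -
    have "key_parts V E L n = (\<lambda>v. {v}) ` V"
      unfolding key_parts_def using n by (intro image_cong) (auto simp: key_def)
    moreover have "upper_edges E L n = {}"
    proof -
      have False if e: "e \<in> E" "\<forall>x\<in>e. n \<le> L x" for e
      proof -
        have "e \<in> [V]\<^bsup>2\<^esup>" using e(1) E by blast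
        then obtain u v where "e = {u, v}" "u \<in> V" by (rule pairE)
        then show False using e(2) n[of u] by simp
      qed
      then show ?thesis by (auto simp: upper_edges_def)
    qed
    ultimately show ?thesis by (simp add: ordering_state_def cs_initial_def)
  qed
  have chain: "(good_step ok)\<^sup>*\<^sup>* (ordering_state V E L (t + d)) (ordering_state V E L t)" for t d
  proof (induction d)
    case (Suc d)
    have "(good_step ok)\<^sup>*\<^sup>* (ordering_state V E L (Suc (t + d))) (ordering_state V E L (t + d))"
      by (rule ordering_step[OF E V LV]) (use okI[where N' = "{}"] in simp)
    then show ?case using Suc rtranclp_trans by fastforce
  qed simp
  have ok0: "ok (ordering_state V E L n)"
    unfolding ordering_state_def by (rule okI[OF partition_key_parts coarser_key_parts[OF LV]]) simp
  have E0: "upper_edges E L 0 = E" by (simp add: upper_edges_def)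
  have "\<exists>N P. (good_step ok)\<^sup>*\<^sup>* (ordering_state V E L n) (P, E, N, {}) \<and> card P \<le> 1"
  proof (cases "V = {}")
    case True
    have "[{} :: 'a set]\<^bsup>2\<^esup> = {}" by (auto simp: nsets_def)
    then have "ordering_state V E L 0 = ({}, E, {}, {})"
      using E0 True unfolding ordering_state_def key_parts_def by simp
    then have "(good_step ok)\<^sup>*\<^sup>* (ordering_state V E L n) ({}, E, {}, {})"
      using chain[of 0 n] by simp
    moreover have "card ({} :: 'a set set) \<le> 1" by simp
    ultimately show ?thesis by blast
  next
    case False
    have P0: "key_parts V E L 0 = {V}" using False by (auto simp: key_parts_def key_def)
    have s0: "ordering_state V E L 0 = ({V}, E, {}, [V]\<^bsup>2\<^esup> - E)"
      using E0 P0 by (simp add: ordering_state_def)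
    let ?N = "{} \<union> (([V]\<^bsup>2\<^esup> - E) \<inter> pairs_between V V)"
    have "[V]\<^bsup>2\<^esup> \<subseteq> pairs_between V V" by (auto simp: pairs_between_def elim!: pairE)
    then have all: "[V]\<^bsup>2\<^esup> - E - pairs_between V V = {}" by blast
    have "cs_step ({V}, E, {}, [V]\<^bsup>2\<^esup> - E) ({V}, E, ?N, {})"
      by (rule cs_step.resolve_negative[of V "{V}" V E "{}" "[V]\<^bsup>2\<^esup> - E", unfolded all]) simp_all
    moreover have "ok ({V}, E, ?N, {})"
      unfolding ok_def
    proof
      fix v
      have "card (reachable_parts V r ({V}, E, ?N, {}) v) \<le> card {V}"
        by (rule card_mono) (auto simp: reachable_parts_def)
      also have "\<dots> \<le> K" by (simp add: K_def)
      finally show "card (reachable_parts V r ({V}, E, ?N, {}) v) \<le> K" .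
    qed
    ultimately have "good_step ok ({V}, E, {}, [V]\<^bsup>2\<^esup> - E) ({V}, E, ?N, {})" by (rule conjI)
    moreover have "(good_step ok)\<^sup>*\<^sup>* (ordering_state V E L n) ({V}, E, {}, [V]\<^bsup>2\<^esup> - E)"
      using chain[of 0 n] s0 by simp
    ultimately have "(good_step ok)\<^sup>*\<^sup>* (ordering_state V E L n) ({V}, E, ?N, {})"
      by (rule rtranclp.rtrancl_into_rtrancl[rotated])
    moreover have "card {V} \<le> 1" by simp
    ultimately show ?thesis by blast
  qed
  then obtain N P where end_state: "(good_step ok)\<^sup>*\<^sup>* (ordering_state V E L n) (P, E, N, {})" "card P \<le> 1"
    by blast
  obtain ss where ss: "ss \<noteq> []" "hd ss = cs_initial V" "last ss = (P, E, N, {})"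
    "successively cs_step ss" "\<forall>s\<in>set ss. ok s"
    using construction_list[OF end_state(1) ok0] init by auto
  have "construction_sequence G ss"
    unfolding construction_sequence_def using ss end_state(2) by (auto simp: V_def E_def)
  moreover have "cs_width V r ss \<le> K"
    by (rule cs_width_le) (use ss(5) in \<open>auto simp: ok_def\<close>)
  ultimately show ?thesis
    unfolding merge_width_def K_def[symmetric] V_def by (intro INF_lower2[of ss]) auto
qed

theorem bounded_expansion_imp_bounded_merge_width:
  assumes C: "bounded_expansion C" "\<And>G. G \<in> C \<Longrightarrow> finite_simple_graph G"
  shows "bounded_merge_width C"
  unfolding bounded_merge_width_def
proof
  fix r
  obtain m where m: "\<And>G S. G \<in> C \<Longrightarrow> S \<subseteq> verts G \<Longrightarrow> S \<noteq> {} \<Longrightarrow>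
    \<exists>v\<in>S. \<exists>Z. finite Z \<and> card Z \<le> m \<and> (\<forall>q. fan_walk (edges G) S (Suc r) v q \<longrightarrow> set q \<inter> Z \<noteq> {})"
    using bounded_expansion_hitting_set[OF C] by blast
  define W where "W = (m + 1) ^ Suc r"
  have "merge_width r G \<le> enat (2 + 2 ^ (W + 1))" if G: "G \<in> C" for G
  proof -
    have g: "finite_simple_graph G" using C(2) G .
    then have V: "finite (verts G)" and E: "edges G \<subseteq> [verts G]\<^bsup>2\<^esup>"
      by (auto simp: finite_simple_graph_def simple_graph_def)
    define P where "P v S \<longleftrightarrow> (\<exists>Z. finite Z \<and> card Z \<le> m \<and>
      (\<forall>q. fan_walk (edges G) S (Suc r) v q \<longrightarrow> set q \<inter> Z \<noteq> {}))" for v S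
    have "\<exists>v\<in>S. P v S" if "S \<subseteq> verts G" "S \<noteq> {}" for S
      unfolding P_def by (rule m[OF G that])
    then obtain L :: "'a \<Rightarrow> nat" where L: "inj_on L (verts G)"
      and P: "\<forall>v\<in>verts G. P v {u\<in>verts G. L u \<le> L v}"
      using ordering_by_elimination[OF V, of P] by blast
    obtain Z where
      Z: "\<And>v. v \<in> verts G \<Longrightarrow> finite (Z v) \<and> card (Z v) \<le> m"
      "\<And>v q. v \<in> verts G \<Longrightarrow> fan_walk (edges G) {u\<in>verts G. L u \<le> L v} (Suc r) v q \<Longrightarrow> set q \<inter> Z v \<noteq> {}"
      using P unfolding P_def bchoice_iff by blast
    show ?thesis
    proof (rule merge_width_le_weak_reach[OF g L])
      show "card (weak_reach (edges G) L (Suc r) v) \<le> W" if "v \<in> verts G" for v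
        unfolding W_def using weak_reach_bound[OF E V L Z order_refl that] .
    qed
  qed
  then have "(SUP G\<in>C. merge_width r G) \<le> enat (2 + 2 ^ (W + 1))" by (rule SUP_least)
  then show "(SUP G\<in>C. merge_width r G) < \<infinity>" using enat_ord_simps(4) le_less_trans by blast
qed

text \<open>A biclique is a minor of depth 0, and the density \<open>t / 2\<close> of \<open>K\<^sub>t\<^sub>,\<^sub>t\<close> exceeds every constant.\<close>

theorem bounded_expansion_imp_weakly_sparse:
  assumes C: "bounded_expansion C" "\<And>G. G \<in> C \<Longrightarrow> finite_simple_graph G"
  shows "weakly_sparse C"
proof -
  obtain c :: nat where c:
    "\<And>G I B F. G \<in> C \<Longrightarrow> finite_simple_graph G \<Longrightarrow> finite I \<Longrightarrow> branch_sets (edges G) 0 I B \<Longrightarrow>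
      \<Union>(B ` I) \<subseteq> verts G \<Longrightarrow> F \<subseteq> [I]\<^bsup>2\<^esup> \<Longrightarrow>
      (\<And>u v. {u, v} \<in> F \<Longrightarrow> \<exists>x\<in>B u. \<exists>y\<in>B v. {x, y} \<in> edges G) \<Longrightarrow> card F \<le> c * card I"
    using bounded_expansion_minor_bound[OF C(1)] by metis
  define t where "t = 2 * c + 1"
  have "\<not> contains_as_subgraph G (biclique t t)" if G: "G \<in> C" for G
  proof
    assume "contains_as_subgraph G (biclique t t)"
    then obtain f where f: "inj_on f ({..<t} <+> {..<t})" "f ` ({..<t} <+> {..<t}) \<subseteq> verts G"
      and fe: "\<forall>e\<in>{{Inl i, Inr j} | i j. i < t \<and> j < t}. f ` e \<in> edges G"
      unfolding contains_as_subgraph_def biclique_def fst_conv snd_conv by (elim exE conjE)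
    have edge: "{f (Inl i), f (Inr j)} \<in> edges G" if "i < t" "j < t" for i j
      using fe[rule_format, of "{Inl i, Inr j}"] that by auto
    define I where "I = f ` ({..<t} <+> {..<t})"
    define F where "F = (\<lambda>(i, j). {f (Inl i), f (Inr j)}) ` ({..<t} \<times> {..<t})"
    have eq: "f (Inl i) = f (Inl j) \<longleftrightarrow> i = j" "f (Inr i) = f (Inr j) \<longleftrightarrow> i = j"
      "f (Inl i) \<noteq> f (Inr j)" "f (Inr j) \<noteq> f (Inl i)" if "i < t" "j < t" for i j
      using inj_on_eq_iff[OF f(1)] that by (auto simp: InlI InrI)
    have "inj_on (\<lambda>(i, j). {f (Inl i), f (Inr j)}) ({..<t} \<times> {..<t})"
      by (rule inj_onI) (auto simp: doubleton_eq_iff eq)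
    then have "card F = t * t" by (simp add: F_def card_image)
    moreover have "card F \<le> c * card I"
    proof (rule c[OF G C(2)[OF G], of I "\<lambda>v. {v}"])
      show "finite I" by (simp add: I_def)
      show "branch_sets (edges G) 0 I (\<lambda>v. {v})"
        by (auto simp: branch_sets_def disjoint_family_on_def intro!: exI[of _ "[_]"])
      show "\<Union>((\<lambda>v. {v}) ` I) \<subseteq> verts G" using f(2) by (auto simp: I_def)
      show "F \<subseteq> [I]\<^bsup>2\<^esup>" by (auto simp: F_def I_def eq)
      show "\<exists>x\<in>{u}. \<exists>y\<in>{v}. {x, y} \<in> edges G" if "{u, v} \<in> F" for u v
      proof -
        have "F \<subseteq> edges G" using edge by (auto simp: F_def)
        then show ?thesis using that by auto
      qed
    qed
    moreover have "card I \<le> 2 * t"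
      unfolding I_def using card_image_le[of "{..<t} <+> {..<t}" f] by (simp add: card_Plus)
    ultimately have "t * t \<le> c * (2 * t)" by (metis mult_le_mono2 order_trans)
    then have "t \<le> 2 * c" by (simp add: t_def)
    then show False by (simp add: t_def)
  qed
  then show ?thesis unfolding weakly_sparse_def by blast
qed

section \<open>One state of a construction sequence of a sparse graph\<close>

text \<open>The threshold for a part to be large. It exceeds \<open>2 * t * t\<close>, so that \<open>t\<close> exceptions are a
fraction below \<open>1 / (2 * t)\<close> of a large part, and \<open>2 * t\<close>, so that the removal of \<open>t\<close> vertices
leaves at least \<open>t\<close>.\<close>

definition large_size :: "nat \<Rightarrow> nat" where
  "large_size t = 2 * t * t + 2 * t + 1"

text \<open>A bound for \<open>small_adjacent\<close>: at most \<open>t\<close> dominating vertices, and \<open>2 * t * (k * large_size t)\<close>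
others.\<close>

definition small_adjacent_bound :: "nat \<Rightarrow> nat \<Rightarrow> nat" where
  "small_adjacent_bound t k = t + 2 * t * (k * large_size t)"

text \<open>A state of a construction sequence of the graph \<open>(V, E)\<close> with partition \<open>P\<close> and set \<open>R\<close> of
resolved pairs, be they edges or non-edges. The elements of \<open>E - R\<close> are the unresolved edges. The
assumption \<open>homog\<close> holds because unresolved pairs between the same parts will be resolved
together, \<open>near\<close> follows from the width for radius 1, and \<open>sparse\<close> excludes the biclique.\<close>

locale sparse_state =
  fixes V :: "'a set" and E :: "'a set set" and P :: "'a set set" and R :: "'a set set" and t k :: nat
  assumes finV: "finite V" and E2: "E \<subseteq> [V]\<^bsup>2\<^esup>" and part: "partition_on V P"
    and homog: "A \<in> P \<Longrightarrow> B \<in> P \<Longrightarrow> a \<in> A \<Longrightarrow> a' \<in> A \<Longrightarrow> b \<in> B \<Longrightarrow> b' \<in> B \<Longrightarrow>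
      {a, b} \<in> E - R \<Longrightarrow> a' \<noteq> b' \<Longrightarrow> {a', b'} \<notin> R \<Longrightarrow> {a', b'} \<in> E"
    and near: "v \<in> V \<Longrightarrow> card {A\<in>P. \<exists>u\<in>A. {v, u} \<in> R} \<le> k"
    and tpos: "t > 0"
    and sparse: "X \<subseteq> V \<Longrightarrow> Y \<subseteq> V \<Longrightarrow> t \<le> card X \<Longrightarrow> t \<le> card Y \<Longrightarrow> \<exists>x\<in>X. \<exists>y\<in>Y. {x, y} \<notin> E"
begin

text \<open>As each of these vertices misses less than a \<open>1 / (2 * t)\<close> fraction of \<open>B\<close>, any \<open>t\<close> of them have
at least half of \<open>B\<close> as common neighbours.\<close>

definition dominating :: "'a set \<Rightarrow> 'a set" where
  "dominating B = {u\<in>V. 2 * t * card {b\<in>B. {u, b} \<notin> E} < card B}"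

definition small_adjacent :: "'a set \<Rightarrow> 'a set" where
  "small_adjacent B = {u\<in>V. (\<exists>A\<in>P. u \<in> A \<and> card A < large_size t) \<and> (\<exists>b\<in>B. {u, b} \<in> E - R)}"

definition large_adjacent :: "'a set \<Rightarrow> 'a set set" where
  "large_adjacent A = {B\<in>P. large_size t \<le> card B \<and> (\<exists>a\<in>A. \<exists>b\<in>B. {a, b} \<in> E - R)}"

definition overconnected :: "'a \<Rightarrow> bool" where
  "overconnected u \<longleftrightarrow> (\<exists>B\<in>P. large_size t \<le> card B \<and> (\<exists>b\<in>B. {u, b} \<in> E - R) \<and> card {b\<in>B. {u, b} \<in> R} < t)"

definition unsettled :: "'a set" where
  "unsettled = {u\<in>V. (\<exists>A\<in>P. u \<in> A \<and> card A < large_size t) \<or> overconnected u}"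

lemma finP: "finite P"
  using finite_elements[OF finV part] .

lemma part_sub: "A \<in> P \<Longrightarrow> A \<subseteq> V"
  using partition_part_subset[OF part] .

lemma finpart: "A \<in> P \<Longrightarrow> finite A"
  using part_sub finV finite_subset by blast

lemma card_dominating:
  assumes B: "B \<subseteq> V" "2 * t \<le> card B"
  shows "card (dominating B) < t"
proof (rule ccontr)
  assume "\<not> ?thesis"
  then obtain X where X: "X \<subseteq> dominating B" "card X = t" "finite X"
    using obtain_subset_with_card_n[of t "dominating B"] by (metis leI)
  define M where "M = (\<Union>u\<in>X. {b\<in>B. {u, b} \<notin> E})"
  have finB: "finite B" using B finV finite_subset by blast
  have "2 * t * card M \<le> 2 * t * (\<Sum>u\<in>X. card {b\<in>B. {u, b} \<notin> E})"
    unfolding M_def by (intro mult_le_mono2 card_UN_le X(3))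
  also have "\<dots> = (\<Sum>u\<in>X. 2 * t * card {b\<in>B. {u, b} \<notin> E})" by (rule sum_distrib_left)
  also have "\<dots> \<le> (\<Sum>u\<in>X. card B)"
    using X(1) by (intro sum_mono) (auto simp: dominating_def)
  also have "\<dots> = t * card B" using X(2) by simp
  finally have "t * (2 * card M) \<le> t * card B" by (simp add: ac_simps)
  then have half: "2 * card M \<le> card B" using tpos by simp
  have "M \<subseteq> B" by (auto simp: M_def)
  then have "card (B - M) = card B - card M" using finB by (simp add: card_Diff_subset finite_subset)
  then have "t \<le> card (B - M)" using half B(2) by simp
  moreover have "X \<subseteq> V" using X(1) by (auto simp: dominating_def)
  moreover have "B - M \<subseteq> V" using B by blast
  ultimately obtain x y where "x \<in> X" "y \<in> B - M" "{x, y} \<notin> E" using sparse[of X "B - M"] X(2) by auto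
  then show False by (auto simp: M_def)
qed

text \<open>The vertex \<open>u\<close> is listed separately because it may belong to \<open>B\<close> and is not its own neighbour.\<close>

lemma dominatingI:
  assumes u: "u \<in> V" and B: "large_size t \<le> card B" "finite B"
    and non: "{b\<in>B. {u, b} \<notin> E} \<subseteq> insert u N" and N: "finite N" "card N < t"
  shows "u \<in> dominating B"
proof -
  have "card {b\<in>B. {u, b} \<notin> E} \<le> card (insert u N)" using non N by (intro card_mono) auto
  also have "\<dots> \<le> t" using N by (simp add: card_insert_if)
  finally have "2 * t * card {b\<in>B. {u, b} \<notin> E} \<le> 2 * t * t" by simp
  also have "\<dots> < card B" using B(1) by (simp add: large_size_def)
  finally show ?thesis using u by (simp add: dominating_def)
qed

text \<open>Let \<open>u\<close> be in a small part and joined to \<open>B\<close> by an unresolved edge. By homogeneity the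
non-neighbours of \<open>u\<close> in \<open>B\<close> are resolved. So either \<open>u\<close> dominates \<open>B\<close>, or it has many resolved
pairs with \<open>B\<close>. The second kind is bounded by double counting: a vertex of \<open>B\<close> has resolved
neighbours in at most \<open>k\<close> parts, and the small ones among these have fewer than \<open>large_size t\<close>
vertices.\<close>

lemma card_small_adjacent:
  assumes B: "B \<in> P" "large_size t \<le> card B"
  shows "card (small_adjacent B) \<le> small_adjacent_bound t k"
proof -
  \<comment> \<open>The vertices of the second kind, with resolved pairs to a \<open>1 / (2 * t)\<close> fraction of \<open>B\<close>.\<close>
  define Y where "Y = {u\<in>small_adjacent B. card B \<le> 2 * t * card {b\<in>B. {u, b} \<in> R}}"
  have BV: "B \<subseteq> V" "finite B" using part_sub finpart B by auto
  have finY: "finite Y" using finV by (auto simp: Y_def small_adjacent_def)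
  have "small_adjacent B \<subseteq> dominating B \<union> Y"
  proof
    fix u assume u: "u \<in> small_adjacent B"
    then obtain A b where A: "A \<in> P" "u \<in> A" "card A < large_size t" and b: "b \<in> B" "{u, b} \<in> E - R" and uV: "u \<in> V"
      by (auto simp: small_adjacent_def)
    have uB: "u \<notin> B" using partition_part_unique[OF part A(1) B(1) A(2)] A(3) B(2) by auto
    show "u \<in> dominating B \<union> Y"
    proof (cases "u \<in> dominating B")
      case False
      have "{b\<in>B. {u, b} \<notin> E} \<subseteq> {b\<in>B. {u, b} \<in> R}"
      proof
        fix c assume c: "c \<in> {b\<in>B. {u, b} \<notin> E}"
        then have "u \<noteq> c" using uB by auto
        then show "c \<in> {b\<in>B. {u, b} \<in> R}"
          using homog[OF A(1) B(1) A(2) A(2) b(1) _ b(2), of c] c by auto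
      qed
      then have "card {b\<in>B. {u, b} \<notin> E} \<le> card {b\<in>B. {u, b} \<in> R}"
        using BV(2) by (intro card_mono) auto
      then have "2 * t * card {b\<in>B. {u, b} \<notin> E} \<le> 2 * t * card {b\<in>B. {u, b} \<in> R}"
        by (rule mult_le_mono2)
      moreover have "card B \<le> 2 * t * card {b\<in>B. {u, b} \<notin> E}"
        using False uV by (simp add: dominating_def not_less)
      ultimately have "card B \<le> 2 * t * card {b\<in>B. {u, b} \<in> R}" by (rule order_trans[rotated])
      then show ?thesis using u by (simp add: Y_def)
    qed simp
  qed
  moreover have "card Y \<le> 2 * t * (k * large_size t)"
  proof -
    have "card B * card Y = (\<Sum>u\<in>Y. card B)" by simp
    also have "\<dots> \<le> (\<Sum>u\<in>Y. 2 * t * card {b\<in>B. {u, b} \<in> R})"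
      by (intro sum_mono) (simp add: Y_def)
    also have "\<dots> = 2 * t * (\<Sum>u\<in>Y. card {b\<in>B. {u, b} \<in> R})" by (simp add: sum_distrib_left)
    also have "(\<Sum>u\<in>Y. card {b\<in>B. {u, b} \<in> R}) = (\<Sum>b\<in>B. card {u\<in>Y. {u, b} \<in> R})"
      using finY BV(2) by (intro sum_multicount_gen) auto
    also have "\<dots> \<le> (\<Sum>b\<in>B. k * large_size t)"
    proof (rule sum_mono)
      fix b assume b: "b \<in> B"
      define AA where "AA = {A\<in>P. card A < large_size t \<and> (\<exists>u\<in>A. {b, u} \<in> R)}"
      have finAA: "finite AA" using finP by (simp add: AA_def)
      have "{u\<in>Y. {u, b} \<in> R} \<subseteq> \<Union>AA"
        by (auto simp: Y_def small_adjacent_def AA_def insert_commute)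
      moreover have "finite (\<Union>AA)" using finAA finpart by (auto simp: AA_def)
      ultimately have "card {u\<in>Y. {u, b} \<in> R} \<le> card (\<Union>AA)" by (rule card_mono[rotated])
      also have "\<dots> \<le> (\<Sum>A\<in>AA. card A)" using card_UN_le[OF finAA, of "\<lambda>A. A"] by simp
      also have "\<dots> \<le> (\<Sum>A\<in>AA. large_size t)" by (intro sum_mono) (simp add: AA_def less_imp_le)
      also have "\<dots> = card AA * large_size t" by simp
      also have "card AA \<le> card {A\<in>P. \<exists>u\<in>A. {b, u} \<in> R}"
        using finP by (intro card_mono) (auto simp: AA_def)
      also have "\<dots> \<le> k" using near b BV by blast
      finally show "card {u\<in>Y. {u, b} \<in> R} \<le> k * large_size t" by simp
    qed
    finally have "card B * card Y \<le> card B * (2 * t * (k * large_size t))" by (simp add: ac_simps)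
    moreover have "card B > 0" using B(2) by (simp add: large_size_def)
    ultimately show ?thesis by simp
  qed
  moreover have "card (dominating B) \<le> t"
    using card_dominating[OF BV(1)] B(2) by (simp add: large_size_def)
  moreover have "finite (dominating B \<union> Y)" using finV finY by (simp add: dominating_def)
  ultimately show ?thesis
    using card_mono[of "dominating B \<union> Y" "small_adjacent B"] card_Un_le[of "dominating B" Y]
    unfolding small_adjacent_bound_def by linarith
qed

text \<open>A vertex of \<open>A\<close> without resolved neighbours in \<open>B\<close> is adjacent to all of \<open>B\<close>, so there are fewer
than \<open>t\<close> of them. Hence at least half of \<open>A\<close> has resolved neighbours in \<open>B\<close>, for each \<open>B\<close>, whereas
every vertex of \<open>A\<close> has resolved neighbours in at most \<open>k\<close> parts.\<close>

lemma card_large_adjacent: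
  assumes A: "A \<in> P" "large_size t \<le> card A"
  shows "card (large_adjacent A) \<le> 2 * k"
proof -
  have finA: "finite A" "A \<subseteq> V" using finpart part_sub A by auto
  have finL: "finite (large_adjacent A)" using finP by (simp add: large_adjacent_def)
  have half: "card A \<le> 2 * card {a\<in>A. \<exists>b\<in>B. {a, b} \<in> R}" if B: "B \<in> large_adjacent A" for B
  proof -
    obtain a0 b0 where BP: "B \<in> P" "large_size t \<le> card B" "a0 \<in> A" "b0 \<in> B" "{a0, b0} \<in> E - R"
      using B by (auto simp: large_adjacent_def)
    have "{a\<in>A. \<not> (\<exists>b\<in>B. {a, b} \<in> R)} \<subseteq> dominating B"
    proof
      fix a assume a: "a \<in> {a\<in>A. \<not> (\<exists>b\<in>B. {a, b} \<in> R)}"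
      have "{b\<in>B. {a, b} \<notin> E} \<subseteq> insert a {}"
        using homog[OF A(1) BP(1) BP(3) _ BP(4) _ BP(5), of a] a by blast
      then show "a \<in> dominating B"
        using a finA BP finpart tpos by (intro dominatingI[of _ _ "{}"]) auto
    qed
    then have "card {a\<in>A. \<not> (\<exists>b\<in>B. {a, b} \<in> R)} \<le> card (dominating B)"
      using finV by (intro card_mono) (auto simp: dominating_def)
    also have "\<dots> < t"
      using card_dominating[OF part_sub[OF BP(1)]] BP(2) by (simp add: large_size_def)
    finally have few: "card {a\<in>A. \<not> (\<exists>b\<in>B. {a, b} \<in> R)} < t" .
    have "card A = card ({a\<in>A. \<not> (\<exists>b\<in>B. {a, b} \<in> R)} \<union> {a\<in>A. \<exists>b\<in>B. {a, b} \<in> R})"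
      by (rule arg_cong[where f = card]) blast
    also have "\<dots> \<le> card {a\<in>A. \<not> (\<exists>b\<in>B. {a, b} \<in> R)} + card {a\<in>A. \<exists>b\<in>B. {a, b} \<in> R}"
      by (rule card_Un_le)
    finally show ?thesis using few A(2) by (simp add: large_size_def)
  qed
  have "card A * card (large_adjacent A) = (\<Sum>B\<in>large_adjacent A. card A)" by simp
  also have "\<dots> \<le> (\<Sum>B\<in>large_adjacent A. 2 * card {a\<in>A. \<exists>b\<in>B. {a, b} \<in> R})"
    using half by (rule sum_mono)
  also have "\<dots> = 2 * (\<Sum>B\<in>large_adjacent A. card {a\<in>A. \<exists>b\<in>B. {a, b} \<in> R})"
    by (simp add: sum_distrib_left)
  also have "(\<Sum>B\<in>large_adjacent A. card {a\<in>A. \<exists>b\<in>B. {a, b} \<in> R}) =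
      (\<Sum>a\<in>A. card {B\<in>large_adjacent A. \<exists>b\<in>B. {a, b} \<in> R})"
    using finL finA by (intro sum_multicount_gen) auto
  also have "\<dots> \<le> (\<Sum>a\<in>A. k)"
  proof (rule sum_mono)
    fix a assume "a \<in> A"
    have "card {B\<in>large_adjacent A. \<exists>b\<in>B. {a, b} \<in> R} \<le> card {B\<in>P. \<exists>b\<in>B. {a, b} \<in> R}"
      using finP by (intro card_mono) (auto simp: large_adjacent_def)
    then show "card {B\<in>large_adjacent A. \<exists>b\<in>B. {a, b} \<in> R} \<le> k"
      using near[of a] \<open>a \<in> A\<close> finA by fastforce
  qed
  finally have "card A * card (large_adjacent A) \<le> card A * (2 * k)" by simp
  moreover have "card A > 0" using A(2) by (simp add: large_size_def)
  ultimately show ?thesis by simp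
qed

text \<open>Each such vertex is adjacent to all of some subset of \<open>Y\<close> with at least \<open>t\<close> elements, and fewer
than \<open>t\<close> vertices share the same subset.\<close>

lemma card_many_neighbours:
  assumes Y: "finite Y" "Y \<subseteq> V" "card Y \<le> d"
  shows "card {u\<in>V. t \<le> card {y\<in>Y. {u, y} \<in> E}} \<le> t * 2 ^ d"
proof -
  define PP where "PP = {Z\<in>Pow Y. t \<le> card Z}"
  have finPP: "finite PP" using Y by (simp add: PP_def)
  have "{u\<in>V. t \<le> card {y\<in>Y. {u, y} \<in> E}} \<subseteq> (\<Union>Z\<in>PP. {u\<in>V. \<forall>y\<in>Z. {u, y} \<in> E})"
  proof
    fix u assume u: "u \<in> {u\<in>V. t \<le> card {y\<in>Y. {u, y} \<in> E}}"
    then have "{y\<in>Y. {u, y} \<in> E} \<in> PP" by (auto simp: PP_def)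
    then show "u \<in> (\<Union>Z\<in>PP. {u\<in>V. \<forall>y\<in>Z. {u, y} \<in> E})"
      using u by (intro UN_I[of "{y\<in>Y. {u, y} \<in> E}"]) auto
  qed
  then have "card {u\<in>V. t \<le> card {y\<in>Y. {u, y} \<in> E}} \<le> card (\<Union>Z\<in>PP. {u\<in>V. \<forall>y\<in>Z. {u, y} \<in> E})"
    using finPP finV by (intro card_mono) auto
  also have "\<dots> \<le> (\<Sum>Z\<in>PP. card {u\<in>V. \<forall>y\<in>Z. {u, y} \<in> E})" by (rule card_UN_le[OF finPP])
  also have "\<dots> \<le> (\<Sum>Z\<in>PP. t)"
  proof (rule sum_mono)
    fix Z assume Z: "Z \<in> PP"
    show "card {u\<in>V. \<forall>y\<in>Z. {u, y} \<in> E} \<le> t"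
    proof (rule ccontr)
      assume "\<not> ?thesis"
      then obtain x y where "x \<in> {u\<in>V. \<forall>y\<in>Z. {u, y} \<in> E}" "y \<in> Z" "{x, y} \<notin> E"
        using sparse[of "{u\<in>V. \<forall>y\<in>Z. {u, y} \<in> E}" Z] Z Y(2) by (auto simp: PP_def)
      then show False by blast
    qed
  qed
  also have "\<dots> = card PP * t" by simp
  also have "card PP \<le> card (Pow Y)" using Y by (intro card_mono) (auto simp: PP_def)
  also have "card (Pow Y) = 2 ^ card Y" using Y by (simp add: card_Pow)
  also have "\<dots> \<le> 2 ^ d" using Y by (intro power_increasing) auto
  finally show ?thesis by (simp add: mult.commute)
qed

text \<open>Both ends have at least \<open>t\<close> resolved neighbours in the part of the other end. The pairs between
these two sets of neighbours cannot all be edges, and by homogeneity a non-edge between the two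
parts is resolved. The case \<open>x = y\<close> arises when the parts coincide.\<close>

lemma short_detour:
  assumes ab: "a \<in> V - unsettled" "b \<in> V - unsettled" "{a, b} \<in> E - R"
  shows "\<exists>x y. {a, x} \<in> R \<and> (x = y \<or> {x, y} \<in> R) \<and> {y, b} \<in> R"
proof -
  obtain A where A: "A \<in> P" "a \<in> A" using partition_part_ex[OF part] ab(1) by blast
  obtain B where B: "B \<in> P" "b \<in> B" using partition_part_ex[OF part] ab(2) by blast
  have big: "large_size t \<le> card A" "large_size t \<le> card B" using ab A B by (auto simp: unsettled_def not_less)
  have "\<not> overconnected a" "\<not> overconnected b" using ab by (auto simp: unsettled_def)
  have X: "t \<le> card {x\<in>B. {a, x} \<in> R}"
    using \<open>\<not> overconnected a\<close> B big ab(3) unfolding overconnected_def by (meson not_le)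
  have "{b, a} \<in> E - R" using ab(3) by (simp add: insert_commute)
  then have Y: "t \<le> card {y\<in>A. {b, y} \<in> R}"
    using \<open>\<not> overconnected b\<close> A big unfolding overconnected_def by (meson not_le)
  obtain x y where xy: "x \<in> B" "{a, x} \<in> R" "y \<in> A" "{b, y} \<in> R" "{x, y} \<notin> E"
    using sparse[OF _ _ X Y] part_sub[OF A(1)] part_sub[OF B(1)] by blast
  have "x = y \<or> {x, y} \<in> R"
    using homog[OF A(1) B(1) A(2) xy(3) B(2) xy(1) ab(3)] xy(5) by (auto simp: insert_commute)
  moreover have "{y, b} \<in> R" using xy(4) by (simp add: insert_commute)
  ultimately show ?thesis using xy(2) by blast
qed

text \<open>Each of the \<open>length p - 1\<close> edges becomes at most three resolved pairs.\<close>

lemma walk_of_resolved: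
  assumes "walk E v p x" "set p \<subseteq> V - unsettled"
  shows "\<exists>q. walk R v q x \<and> length q + 2 \<le> 3 * length p"
  using assms
proof (induction p arbitrary: v)
  case Nil
  then show ?case by (simp add: walk_def)
next
  case (Cons a p)
  show ?case
  proof (cases "p = []")
    case True
    then show ?thesis using Cons.prems by (intro exI[of _ "[v]"]) (auto simp: walk_Cons)
  next
    case False
    then have w: "v = a" "{v, hd p} \<in> E" "walk E (hd p) p x" using Cons.prems(1) by (auto simp: walk_Cons)
    obtain q where q: "walk R (hd p) q x" "length q + 2 \<le> 3 * length p"
      using Cons.IH[OF w(3)] Cons.prems(2) by auto
    have "\<exists>q'. walk R v q' (hd p) \<and> length q' \<le> 4"
    proof (cases "{v, hd p} \<in> R")
      case True
      then show ?thesis by (intro exI[of _ "[v, hd p]"]) (auto simp: walk_Cons)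
    next
      case F: False
      have "hd p \<in> set p" using False by simp
      then have "hd p \<in> V - unsettled" "v \<in> V - unsettled" using Cons.prems(2) w(1) by auto
      then obtain y z where yz: "{v, y} \<in> R" "y = z \<or> {y, z} \<in> R" "{z, hd p} \<in> R"
        using short_detour w(2) F by blast
      show ?thesis
      proof (cases "y = z")
        case True
        then show ?thesis using yz by (intro exI[of _ "[v, y, hd p]"]) (auto simp: walk_Cons)
      next
        case False
        then show ?thesis using yz by (intro exI[of _ "[v, y, z, hd p]"]) (auto simp: walk_Cons)
      qed
    qed
    then obtain q' where q': "walk R v q' (hd p)" "length q' \<le> 4" by blast
    have "walk R v (q' @ tl q) x" using walk_join[OF q'(1) q(1)] .
    moreover have "length (q' @ tl q) + 2 \<le> 3 * length (a # p)"
      using q q' by (cases q) (auto simp: walk_def)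
    ultimately show ?thesis by blast
  qed
qed

end

section \<open>Orderings from construction sequences\<close>

text \<open>A bound, in terms of the present state, for the vertices of \<open>A\<close> that become overconnected at any
later time. Let \<open>B\<close> be the later part responsible for \<open>u\<close>; then \<open>u\<close> has unresolved edges to almost
all of \<open>B\<close>, which are unresolved at present too. If \<open>B\<close> contains a part that is already large, \<open>u\<close>
dominates that part. Otherwise \<open>B\<close> consists of vertices in small parts, and \<open>u\<close> is adjacent to
many members of \<open>small_adjacent A\<close>.\<close>

lemma (in sparse_state) later_overconnected_in_part:
  assumes s2: "sparse_state V E P2 R2 t k" and R: "R \<subseteq> R2" and ref: "coarser P P2"
    and A: "A \<in> P" "u \<in> A" and overconnected: "sparse_state.overconnected E P2 R2 t u"
  shows "u \<in> \<Union>(dominating ` large_adjacent A) \<union> {u\<in>V. t \<le> card {y\<in>small_adjacent A. {u, y} \<in> E}}"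
proof -
  interpret s2: sparse_state V E P2 R2 t k by (rule s2)
  obtain B b where B: "B \<in> P2" "large_size t \<le> card B" "b \<in> B" "{u, b} \<in> E - R2" and few: "card {b\<in>B. {u, b} \<in> R2} < t"
    using overconnected unfolding s2.overconnected_def by blast
  have uV: "u \<in> V" using A part_sub by blast
  have finB: "finite B" using s2.finpart[OF B(1)] .
  obtain A2 where A2: "A2 \<in> P2" "A \<subseteq> A2" using ref A(1) by (auto simp: coarser_def)
  have pos: "{u, c} \<in> E - R" if "c \<in> B" "c \<noteq> u" "{u, c} \<notin> R2" for c
    using s2.homog[OF A2(1) B(1) _ _ B(3) that(1) B(4), of u] that A A2 R by blast
  let ?N = "{c\<in>B. {u, c} \<in> R2}"
  show ?thesis
  proof (cases "\<exists>C\<in>P. large_size t \<le> card C \<and> C \<subseteq> B")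
    case True
    then obtain C where C: "C \<in> P" "large_size t \<le> card C" "C \<subseteq> B" by blast
    have "\<not> C \<subseteq> insert u ?N"
    proof
      assume "C \<subseteq> insert u ?N"
      then have "card C \<le> card (insert u ?N)" using finB by (intro card_mono) auto
      also have "\<dots> \<le> t" using few finB by (simp add: card_insert_if)
      finally show False using C(2) by (simp add: large_size_def)
    qed
    then obtain c where c: "c \<in> C" "c \<noteq> u" "{u, c} \<notin> R2" using C(3) by auto
    then have "{u, c} \<in> E - R" using pos C(3) by blast
    then have "C \<in> large_adjacent A" using c C A by (auto simp: large_adjacent_def)
    moreover have "u \<in> dominating C"
    proof (rule dominatingI[OF uV C(2) finpart[OF C(1)]])
      show "{b\<in>C. {u, b} \<notin> E} \<subseteq> insert u ?N" using pos C(3) by blast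
    qed (use finB few in auto)
    ultimately show ?thesis by blast
  next
    case False
    let ?B' = "{c\<in>B. c \<noteq> u \<and> {u, c} \<notin> R2}"
    have sub: "?B' \<subseteq> {y\<in>small_adjacent A. {u, y} \<in> E}"
    proof
      fix c assume c: "c \<in> ?B'"
      then have e: "{u, c} \<in> E - R" using pos by blast
      have cV: "c \<in> V" using c s2.part_sub[OF B(1)] by blast
      then obtain C where C: "C \<in> P" "c \<in> C" using partition_part_ex[OF part] by blast
      obtain C2 where C2: "C2 \<in> P2" "C \<subseteq> C2" using ref C(1) by (auto simp: coarser_def)
      have "C2 = B" using partition_part_unique[OF s2.part C2(1) B(1), of c] C C2 c by blast
      then have "card C < large_size t" using False C C2 by (metis not_le)
      moreover have "{c, u} \<in> E - R" using e by (simp add: insert_commute)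
      ultimately have "c \<in> small_adjacent A" using C A cV unfolding small_adjacent_def by blast
      then show "c \<in> {y\<in>small_adjacent A. {u, y} \<in> E}" using e by blast
    qed
    have "B \<subseteq> ?B' \<union> insert u ?N" by blast
    then have "card B \<le> card (?B' \<union> insert u ?N)" using finB by (intro card_mono) auto
    also have "\<dots> \<le> card ?B' + card (insert u ?N)" by (rule card_Un_le)
    also have "card (insert u ?N) \<le> t" using few finB by (simp add: card_insert_if)
    finally have "t \<le> card ?B'" using B(2) by (simp add: large_size_def)
    also have "\<dots> \<le> card {y\<in>small_adjacent A. {u, y} \<in> E}"
      using sub finV by (intro card_mono) (auto simp: small_adjacent_def)
    finally show ?thesis using uV by blast
  qed
qed

lemma (in sparse_state) card_later_overconnected:
  assumes A: "A \<in> P" "large_size t \<le> card A"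
  shows "card (\<Union>(dominating ` large_adjacent A) \<union> {u\<in>V. t \<le> card {y\<in>small_adjacent A. {u, y} \<in> E}})
    \<le> 2 * k * t + t * 2 ^ small_adjacent_bound t k"
proof -
  have finL: "finite (large_adjacent A)" using finP by (simp add: large_adjacent_def)
  have "card (\<Union>(dominating ` large_adjacent A)) \<le> (\<Sum>B\<in>large_adjacent A. card (dominating B))"
    by (rule card_UN_le[OF finL])
  also have "\<dots> \<le> (\<Sum>B\<in>large_adjacent A. t)"
  proof (rule sum_mono)
    fix B assume "B \<in> large_adjacent A"
    then have "B \<in> P" "large_size t \<le> card B" by (auto simp: large_adjacent_def)
    then show "card (dominating B) \<le> t"
      using card_dominating[OF part_sub] by (simp add: large_size_def less_imp_le)
  qed
  also have "\<dots> = card (large_adjacent A) * t" by simp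
  also have "\<dots> \<le> 2 * k * t" using card_large_adjacent[OF A] by (rule mult_le_mono1)
  finally have 1: "card (\<Union>(dominating ` large_adjacent A)) \<le> 2 * k * t" .
  have "card {u\<in>V. t \<le> card {y\<in>small_adjacent A. {u, y} \<in> E}} \<le> t * 2 ^ small_adjacent_bound t k"
    using card_small_adjacent[OF A] finV
    by (intro card_many_neighbours) (auto simp: small_adjacent_def)
  with 1 show ?thesis using card_Un_le[of "\<Union>(dominating ` large_adjacent A)"] by (meson add_mono order_trans)
qed

text \<open>All vertices of a small part, or those of a large part that are overconnected at some time from
now on.\<close>

definition remaining_bound :: "nat \<Rightarrow> nat \<Rightarrow> nat" where
  "remaining_bound t k = large_size t + (2 * k * t + t * 2 ^ small_adjacent_bound t k)"

definition strong_bound :: "nat \<Rightarrow> nat \<Rightarrow> nat" where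
  "strong_bound t k = large_size t +
    (k * (2 * remaining_bound t k) + k * (small_adjacent_bound t k + 2 * k * remaining_bound t k))"

text \<open>A construction sequence with states \<open>0, \<dots>, n\<close>, reduced to the properties that the ordering depends
on.\<close>

locale sparse_sequence =
  fixes V :: "'a set" and E :: "'a set set" and P :: "nat \<Rightarrow> 'a set set" and R :: "nat \<Rightarrow> 'a set set"
    and t k n :: nat
  assumes state: "i \<le> n \<Longrightarrow> sparse_state V E (P i) (R i) t k"
    and R_mono: "i \<le> j \<Longrightarrow> j \<le> n \<Longrightarrow> R i \<subseteq> R j"
    and coarsen: "i \<le> j \<Longrightarrow> j \<le> n \<Longrightarrow> coarser (P i) (P j)"
    and halves: "i < n \<Longrightarrow> A \<in> P (Suc i) \<Longrightarrow> \<exists>A1\<in>P i. \<exists>A2\<in>P i. A \<subseteq> A1 \<union> A2"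
    and singletons: "A \<in> P 0 \<Longrightarrow> card A \<le> 1"
    and final: "card (P n) \<le> 1" "E \<subseteq> R n"
begin

definition unsettled_at :: "nat \<Rightarrow> 'a set" where
  "unsettled_at i = sparse_state.unsettled V E (P i) (R i) t"

text \<open>By \<open>last_unsettled\<close>, the set \<open>remaining j\<close> consists of the vertices whose last unsettled time is
at least \<open>j\<close>. A vertex of a large part may turn overconnected later on, which is why settled
vertices can be remaining.\<close>

definition remaining :: "nat \<Rightarrow> 'a set" where
  "remaining j = {u\<in>V. \<exists>i. j \<le> i \<and> i \<le> n \<and> u \<in> unsettled_at i}"

definition last_unsettled :: "'a \<Rightarrow> nat" where
  "last_unsettled u = Max {i. i \<le> n \<and> u \<in> unsettled_at i}"

lemma finV: "finite V"
  using sparse_state.finV[OF state[of 0]] by simp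

lemma unsettled_at_iff:
  assumes "i \<le> n"
  shows "u \<in> unsettled_at i \<longleftrightarrow> u \<in> V \<and>
    ((\<exists>A\<in>P i. u \<in> A \<and> card A < large_size t) \<or> sparse_state.overconnected E (P i) (R i) t u)"
  unfolding unsettled_at_def sparse_state.unsettled_def[OF state[OF assms]] by simp

lemma card_remaining_in_part:
  assumes j: "j \<le> n" and A: "A \<in> P j"
  shows "card (A \<inter> remaining j) \<le> remaining_bound t k"
proof -
  interpret s: sparse_state V E "P j" "R j" t k by (rule state[OF j])
  show ?thesis
  proof (cases "card A < large_size t")
    case True
    have "card (A \<inter> remaining j) \<le> card A" using s.finpart[OF A] by (intro card_mono) auto
    then show ?thesis using True by (simp add: remaining_bound_def)
  next
    case False
    then have big: "large_size t \<le> card A" by simp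
    let ?X = "\<Union>(s.dominating ` s.large_adjacent A) \<union> {u\<in>V. t \<le> card {y\<in>s.small_adjacent A. {u, y} \<in> E}}"
    have "A \<inter> remaining j \<subseteq> ?X"
    proof
      fix u assume u: "u \<in> A \<inter> remaining j"
      then obtain i where i: "j \<le> i" "i \<le> n" "u \<in> unsettled_at i" by (auto simp: remaining_def)
      interpret s2: sparse_state V E "P i" "R i" t k by (rule state[OF i(2)])
      have c: "coarser (P j) (P i)" using coarsen[OF i(1,2)] .
      have "\<not> (\<exists>B\<in>P i. u \<in> B \<and> card B < large_size t)"
      proof
        assume "\<exists>B\<in>P i. u \<in> B \<and> card B < large_size t"
        then obtain B where B: "B \<in> P i" "u \<in> B" "card B < large_size t" by blast
        obtain A2 where A2: "A2 \<in> P i" "A \<subseteq> A2" using c A by (auto simp: coarser_def)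
        have "A2 = B" using partition_part_unique[OF s2.part A2(1) B(1), of u] A2 B u by blast
        then have "card A \<le> card B" using A2 s2.finpart[OF B(1)] by (intro card_mono) auto
        then show False using B(3) False by simp
      qed
      then have "s2.overconnected u" using i unsettled_at_iff by blast
      then show "u \<in> ?X"
        using s.later_overconnected_in_part[OF state[OF i(2)] R_mono[OF i(1,2)] c A] u by blast
    qed
    then have "card (A \<inter> remaining j) \<le> card ?X"
      using s.finV by (intro card_mono) (auto simp: s.dominating_def s.large_adjacent_def s.finP)
    also have "\<dots> \<le> 2 * k * t + t * 2 ^ small_adjacent_bound t k"
      using s.card_later_overconnected[OF A big] by simp
    finally show ?thesis by (simp add: remaining_bound_def)
  qed
qed

lemma tpos: "t > 0"
  using sparse_state.tpos[OF state[of 0]] by simp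

lemma unsettled_at_0: "u \<in> V \<Longrightarrow> u \<in> unsettled_at 0"
proof -
  interpret s: sparse_state V E "P 0" "R 0" t k by (rule state) simp
  assume u: "u \<in> V"
  then obtain A where A: "A \<in> P 0" "u \<in> A" using partition_part_ex[OF s.part] by blast
  then have "card A < large_size t" using singletons[of A] tpos by (simp add: large_size_def)
  then show ?thesis using unsettled_at_iff[of 0 u] A u by auto
qed

lemma last_unsettled:
  assumes u: "u \<in> V"
  shows "last_unsettled u \<le> n" "u \<in> unsettled_at (last_unsettled u)"
    "\<And>i. last_unsettled u < i \<Longrightarrow> i \<le> n \<Longrightarrow> u \<notin> unsettled_at i"
    "\<And>j. j \<le> last_unsettled u \<longleftrightarrow> u \<in> remaining j"
proof -
  let ?S = "{i. i \<le> n \<and> u \<in> unsettled_at i}"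
  have S: "finite ?S" "?S \<noteq> {}" using unsettled_at_0[OF u] by auto
  have "last_unsettled u \<in> ?S" unfolding last_unsettled_def using S by (rule Max_in)
  then show 1: "last_unsettled u \<le> n" "u \<in> unsettled_at (last_unsettled u)" by auto
  have le: "i \<le> last_unsettled u" if "i \<le> n" "u \<in> unsettled_at i" for i
    unfolding last_unsettled_def using S(1) that by (intro Max_ge) auto
  then show "\<And>i. last_unsettled u < i \<Longrightarrow> i \<le> n \<Longrightarrow> u \<notin> unsettled_at i" by fastforce
  show "\<And>j. j \<le> last_unsettled u \<longleftrightarrow> u \<in> remaining j"
    unfolding remaining_def using 1 u le le_trans by blast
qed

text \<open>Those in small parts are bounded by \<open>small_adjacent_bound\<close>; the others lie in at most \<open>2 * k\<close>
large parts.\<close>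

lemma card_remaining_adjacent:
  assumes j: "j \<le> n" and B: "B \<in> P j" "large_size t \<le> card B"
  shows "card {u\<in>remaining j. \<exists>b\<in>B. {u, b} \<in> E - R j} \<le> small_adjacent_bound t k + 2 * k * remaining_bound t k"
proof -
  interpret s: sparse_state V E "P j" "R j" t k by (rule state[OF j])
  have big: "large_size t \<le> card B" using B by simp
  have finL: "finite (s.large_adjacent B)" using s.finP by (simp add: s.large_adjacent_def)
  have "{u\<in>remaining j. \<exists>b\<in>B. {u, b} \<in> E - R j} \<subseteq>
    s.small_adjacent B \<union> (\<Union>A\<in>s.large_adjacent B. A \<inter> remaining j)"
  proof
    fix u assume u: "u \<in> {u\<in>remaining j. \<exists>b\<in>B. {u, b} \<in> E - R j}"
    then have uV: "u \<in> V" by (simp add: remaining_def)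
    then obtain A where A: "A \<in> P j" "u \<in> A" using partition_part_ex[OF s.part] by blast
    show "u \<in> s.small_adjacent B \<union> (\<Union>A\<in>s.large_adjacent B. A \<inter> remaining j)"
    proof (cases "card A < large_size t")
      case True
      then show ?thesis using A u uV by (auto simp: s.small_adjacent_def)
    next
      case False
      obtain b where b: "b \<in> B" "{b, u} \<in> E - R j" using u by (auto simp: insert_commute)
      then have "A \<in> s.large_adjacent B" using A False by (auto simp: s.large_adjacent_def)
      then show ?thesis using A u by blast
    qed
  qed
  then have "card {u\<in>remaining j. \<exists>b\<in>B. {u, b} \<in> E - R j} \<le>
      card (s.small_adjacent B \<union> (\<Union>A\<in>s.large_adjacent B. A \<inter> remaining j))"
    using finV finL by (intro card_mono) (auto simp: s.small_adjacent_def remaining_def)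
  also have "\<dots> \<le> card (s.small_adjacent B) + card (\<Union>A\<in>s.large_adjacent B. A \<inter> remaining j)"
    by (rule card_Un_le)
  also have "card (s.small_adjacent B) \<le> small_adjacent_bound t k"
    using s.card_small_adjacent[OF B(1) big] by simp
  also have "card (\<Union>A\<in>s.large_adjacent B. A \<inter> remaining j) \<le> (\<Sum>A\<in>s.large_adjacent B. card (A \<inter> remaining j))"
    by (rule card_UN_le[OF finL])
  also have "\<dots> \<le> (\<Sum>A\<in>s.large_adjacent B. remaining_bound t k)"
    by (intro sum_mono card_remaining_in_part[OF j]) (auto simp: s.large_adjacent_def)
  also have "\<dots> = card (s.large_adjacent B) * remaining_bound t k" by simp
  also have "\<dots> \<le> 2 * k * remaining_bound t k" using s.card_large_adjacent[OF B(1) big] by (rule mult_le_mono1)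
  finally show ?thesis by simp
qed

text \<open>Here \<open>l\<close> bounds the number of vertices of the walk, one more than its length.\<close>

definition near_parts :: "nat \<Rightarrow> nat \<Rightarrow> 'a \<Rightarrow> 'a set set" where
  "near_parts l j v = {A\<in>P j. \<exists>u\<in>A. \<exists>p. walk (R j) v p u \<and> length p \<le> l}"

text \<open>Strong reachability for the ordering by \<open>last_unsettled\<close> in which vertices that settle last come
first. Ties are admitted both on the walk and at its end.\<close>

definition strong_reach :: "nat \<Rightarrow> 'a \<Rightarrow> 'a set" where
  "strong_reach s v = {u\<in>V. last_unsettled v \<le> last_unsettled u \<and> (\<exists>p. p \<noteq> [] \<and> walk E v (p @ [u]) u \<and> length p \<le> s \<and>
     set p \<subseteq> V \<and> (\<forall>x\<in>set p. last_unsettled x \<le> last_unsettled v))}"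

text \<open>No vertex is overconnected in the final state, so a vertex that is still unsettled there witnesses
that the whole graph is small.\<close>

lemma strong_reach_final:
  assumes v: "v \<in> V" and n: "last_unsettled v = n"
  shows "card (strong_reach s v) \<le> strong_bound t k"
proof -
  interpret s: sparse_state V E "P n" "R n" t k by (rule state) simp
  have "\<not> s.overconnected v" using final(2) by (auto simp: s.overconnected_def)
  then obtain A where A: "A \<in> P n" "v \<in> A" "card A < large_size t"
    using last_unsettled(2)[OF v] n unsettled_at_iff[of n v] by auto
  have "P n = {A}" using final(1) A(1) s.finP
    by (metis card_le_Suc0_iff_eq One_nat_def insertI1 is_singletonI' is_singleton_the_elem singletonD empty_iff)
  then have "V = A" using partition_onD1[OF s.part] by simp
  then have "card V < large_size t" using A(3) by simp
  moreover have "card (strong_reach s v) \<le> card V"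
    using s.finV by (intro card_mono) (auto simp: strong_reach_def)
  ultimately show ?thesis by (simp add: strong_bound_def)
qed

text \<open>The set \<open>remaining j\<close> is counted in the parts of time \<open>Suc j\<close>, each of which is covered by two
parts of time \<open>j\<close>.\<close>

lemma card_remaining_previous:
  assumes j: "j < n" and A: "A \<in> P (Suc j)"
  shows "card (A \<inter> remaining j) \<le> 2 * remaining_bound t k"
proof -
  obtain A1 A2 where A12: "A1 \<in> P j" "A2 \<in> P j" "A \<subseteq> A1 \<union> A2" using halves[OF j A] by blast
  have "card (A \<inter> remaining j) \<le> card (A1 \<inter> remaining j \<union> A2 \<inter> remaining j)"
    using A12 finV by (intro card_mono) (auto simp: remaining_def)
  also have "\<dots> \<le> card (A1 \<inter> remaining j) + card (A2 \<inter> remaining j)" by (rule card_Un_le)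
  also have "\<dots> \<le> 2 * remaining_bound t k"
    using card_remaining_in_part[of j A1] card_remaining_in_part[of j A2] A12 j by simp
  finally show ?thesis .
qed

text \<open>At time \<open>Suc j\<close>, where \<open>j\<close> is the last unsettled time of \<open>v\<close>, the walk up to the vertex \<open>x\<close> before
\<open>u\<close> has settled vertices only, so a resolved walk of length at most \<open>3 * s\<close> leads from \<open>v\<close> to \<open>x\<close>.
If the pair \<open>{x, u}\<close> is resolved or \<open>u\<close> is settled as well, then \<open>u\<close> is in a part near \<open>v\<close> (set
\<open>X1\<close>). Otherwise \<open>u\<close> is remaining and joined by an unresolved edge to the large part of \<open>x\<close> (set
\<open>X2\<close>).\<close>

lemma card_strong_reach:
  assumes v: "v \<in> V" and near: "\<And>j. j \<le> n \<Longrightarrow> card (near_parts (3 * s + 1) j v) \<le> k"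
  shows "card (strong_reach s v) \<le> strong_bound t k"
proof (cases "last_unsettled v = n")
  case True
  then show ?thesis using strong_reach_final v by blast
next
  case False
  define j where "j = last_unsettled v"
  have j: "j < n" using last_unsettled(1)[OF v] False by (simp add: j_def)
  then have j1: "Suc j \<le> n" by simp
  interpret st: sparse_state V E "P (Suc j)" "R (Suc j)" t k by (rule state[OF j1])
  define NP where "NP = near_parts (3 * s + 1) (Suc j) v"
  have finNP: "finite NP" using st.finP by (simp add: NP_def near_parts_def)
  have cardNP: "card NP \<le> k" using near[OF j1] by (simp add: NP_def)
  define X1 where "X1 = (\<Union>A\<in>NP. A \<inter> remaining j)"
  define BB where "BB = {B\<in>NP. large_size t \<le> card B}"
  define X2 where "X2 = (\<Union>B\<in>BB. {u\<in>remaining (Suc j). \<exists>b\<in>B. {u, b} \<in> E - R (Suc j)})"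
  have finBB: "finite BB" "BB \<subseteq> NP" using finNP by (auto simp: BB_def)
  have "strong_reach s v \<subseteq> X1 \<union> X2"
  proof
    fix u assume "u \<in> strong_reach s v"
    then obtain p where uV: "u \<in> V" and ju: "j \<le> last_unsettled u" and p: "p \<noteq> []" "walk E v (p @ [u]) u" "length p \<le> s"
      "set p \<subseteq> V" "\<forall>x\<in>set p. last_unsettled x \<le> j"
      unfolding strong_reach_def j_def by blast
    have uj: "u \<in> remaining j" using last_unsettled(4)[OF uV] ju by blast
    have pw: "set p \<subseteq> V - st.unsettled"
    proof
      fix x assume x: "x \<in> set p"
      then have "x \<in> V" "last_unsettled x < Suc j" using p by auto
      then show "x \<in> V - st.unsettled" using last_unsettled(3)[OF _ _ j1] by (auto simp: unsettled_at_def)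
    qed
    obtain p' x where px: "p = p' @ [x]" using p(1) by (metis append_butlast_last_id)
    have wx: "walk E v p x" using p(2) walk_prefix[of E v p' x "[u]" u] px by simp
    have e: "{x, u} \<in> E" using walk_suffix[of E v p' x "[u]" u] p(2) px by (simp add: walk_Cons)
    obtain q where q: "walk (R (Suc j)) v q x" "length q + 2 \<le> 3 * length p"
      using st.walk_of_resolved[OF wx pw] by blast
    have nearI: "u \<in> X1" if w: "walk (R (Suc j)) v q' u" "length q' \<le> 3 * s + 1" for q'
    proof -
      obtain A where A: "A \<in> P (Suc j)" "u \<in> A" using partition_part_ex[OF st.part uV] by blast
      then have "A \<in> NP" using w by (auto simp: NP_def near_parts_def)
      then show ?thesis using A uj by (auto simp: X1_def)
    qed
    consider "{x, u} \<in> R (Suc j)" | "{x, u} \<notin> R (Suc j)" "u \<notin> st.unsettled" | "{x, u} \<notin> R (Suc j)" "u \<in> st.unsettled" by blast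
    then show "u \<in> X1 \<union> X2"
    proof cases
      case 1
      have "walk (R (Suc j)) v (q @ [u]) u" using walk_append[OF q(1) 1] by simp
      then show ?thesis using nearI[of "q @ [u]"] q(2) p(3) by simp
    next
      case 2
      have "set (p @ [u]) \<subseteq> V - st.unsettled" using pw 2 uV by simp
      then obtain q' where "walk (R (Suc j)) v q' u" "length q' + 2 \<le> 3 * length (p @ [u])"
        using st.walk_of_resolved[OF p(2)] by blast
      then show ?thesis using nearI[of q'] p(3) by simp
    next
      case 3
      have xV: "x \<in> V" "x \<notin> st.unsettled" using pw px by auto
      obtain B where B: "B \<in> P (Suc j)" "x \<in> B" using partition_part_ex[OF st.part xV(1)] by blast
      have "large_size t \<le> card B" using xV B by (auto simp: st.unsettled_def not_less)
      moreover have "B \<in> NP" using B q p(3) unfolding NP_def near_parts_def by fastforce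
      ultimately have "B \<in> BB" by (simp add: BB_def)
      moreover have "u \<in> remaining (Suc j)" using 3(2) uV j1 by (auto simp: remaining_def unsettled_at_def)
      moreover have "{u, x} \<in> E - R (Suc j)" using e 3(1) by (simp add: insert_commute)
      ultimately show ?thesis using B(2) by (auto simp: X2_def)
    qed
  qed
  then have "card (strong_reach s v) \<le> card (X1 \<union> X2)"
    using finV finNP finBB(1) by (intro card_mono) (auto simp: X1_def X2_def remaining_def)
  also have "\<dots> \<le> card X1 + card X2" by (rule card_Un_le)
  also have "card X1 \<le> k * (2 * remaining_bound t k)"
  proof -
    have "card X1 \<le> (\<Sum>A\<in>NP. card (A \<inter> remaining j))" unfolding X1_def by (rule card_UN_le[OF finNP])
    also have "\<dots> \<le> (\<Sum>A\<in>NP. 2 * remaining_bound t k)"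
      by (intro sum_mono card_remaining_previous[OF j]) (auto simp: NP_def near_parts_def)
    also have "\<dots> = card NP * (2 * remaining_bound t k)" by simp
    also have "\<dots> \<le> k * (2 * remaining_bound t k)" using cardNP by (rule mult_le_mono1)
    finally show ?thesis .
  qed
  also have "card X2 \<le> k * (small_adjacent_bound t k + 2 * k * remaining_bound t k)"
  proof -
    have "card X2 \<le> (\<Sum>B\<in>BB. card {u\<in>remaining (Suc j). \<exists>b\<in>B. {u, b} \<in> E - R (Suc j)})"
      unfolding X2_def by (rule card_UN_le[OF finBB(1)])
    also have "\<dots> \<le> (\<Sum>B\<in>BB. small_adjacent_bound t k + 2 * k * remaining_bound t k)"
      by (intro sum_mono card_remaining_adjacent[OF j1]) (auto simp: BB_def NP_def near_parts_def)
    also have "\<dots> = card BB * (small_adjacent_bound t k + 2 * k * remaining_bound t k)" by simp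
    also have "\<dots> \<le> k * (small_adjacent_bound t k + 2 * k * remaining_bound t k)"
      using card_mono[OF finNP finBB(2)] cardNP by (intro mult_le_mono1) simp
    finally show ?thesis .
  qed
  finally show ?thesis by (simp add: strong_bound_def)
qed

end

section \<open>Invariants of construction sequences\<close>

definition cs_inv :: "'a set \<Rightarrow> 'a cs_state \<Rightarrow> bool" where
  "cs_inv V = (\<lambda>(P, E, N, U). partition_on V P \<and> E \<union> N \<union> U = [V]\<^bsup>2\<^esup> \<and> U \<inter> (E \<union> N) = {} \<and> E \<inter> N = {})"

definition cs_parts :: "'a cs_state \<Rightarrow> 'a set set" where "cs_parts = fst"
definition cs_edges :: "'a cs_state \<Rightarrow> 'a set set" where "cs_edges s = fst (snd s)"
definition cs_nonedges :: "'a cs_state \<Rightarrow> 'a set set" where "cs_nonedges s = fst (snd (snd s))"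
definition cs_open :: "'a cs_state \<Rightarrow> 'a set set" where "cs_open s = snd (snd (snd s))"
definition cs_resolved :: "'a cs_state \<Rightarrow> 'a set set" where "cs_resolved s = cs_edges s \<union> cs_nonedges s"

lemmas cs_sel = cs_parts_def cs_edges_def cs_nonedges_def cs_open_def cs_resolved_def

lemma cs_inv_initial: "cs_inv V (cs_initial V)"
  by (auto simp: cs_inv_def cs_initial_def partition_on_singletons)

lemma cs_step_inv:
  assumes "cs_step s s'" "cs_inv V s"
  shows "cs_inv V s'"
  using assms
proof cases
  case (merge A P B E N U)
  then show ?thesis using assms(2) partition_on_merge[of V P A B] by (simp add: cs_inv_def)
qed (use assms(2) in \<open>auto simp: cs_inv_def\<close>)

lemma cs_step_mono:
  assumes "cs_step s s'"
  shows "coarser (cs_parts s) (cs_parts s')" "cs_edges s \<subseteq> cs_edges s'" "cs_nonedges s \<subseteq> cs_nonedges s'"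
    "\<And>A. A \<in> cs_parts s' \<Longrightarrow> \<exists>A1\<in>cs_parts s. \<exists>A2\<in>cs_parts s. A \<subseteq> A1 \<union> A2"
proof -
  show "coarser (cs_parts s) (cs_parts s')"
    using assms
  proof cases
    case (merge A P B E N U)
    show ?thesis unfolding coarser_def
    proof
      fix C assume C: "C \<in> cs_parts s"
      show "\<exists>D\<in>cs_parts s'. C \<subseteq> D"
      proof (cases "C = A \<or> C = B")
        case True
        then show ?thesis using merge by (intro bexI[of _ "A \<union> B"]) (auto simp: cs_sel)
      next
        case False
        then show ?thesis using merge C by (intro bexI[of _ C]) (auto simp: cs_sel)
      qed
    qed
  qed (auto simp: coarser_def cs_sel)
  show "cs_edges s \<subseteq> cs_edges s'" "cs_nonedges s \<subseteq> cs_nonedges s'"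
    using assms by (cases; auto simp: cs_sel)+
  show "\<And>A. A \<in> cs_parts s' \<Longrightarrow> \<exists>A1\<in>cs_parts s. \<exists>A2\<in>cs_parts s. A \<subseteq> A1 \<union> A2"
    using assms
  proof cases
    case (merge A P B E N U)
    fix C assume "C \<in> cs_parts s'"
    then consider "C \<in> P" | "C = A \<union> B" using merge by (auto simp: cs_sel)
    then show "\<exists>A1\<in>cs_parts s. \<exists>A2\<in>cs_parts s. C \<subseteq> A1 \<union> A2"
      using merge by cases (auto simp: cs_sel)
  qed (auto simp: cs_sel)
qed

text \<open>The condition is symmetric in the two pairs, so unresolved pairs between two parts are all edges
or all non-edges.\<close>

definition homogeneous :: "'a set set \<Rightarrow> 'a cs_state \<Rightarrow> bool" where
  "homogeneous Ed s \<longleftrightarrow> (\<forall>A\<in>cs_parts s. \<forall>B\<in>cs_parts s. \<forall>a\<in>A. \<forall>a'\<in>A. \<forall>b\<in>B. \<forall>b'\<in>B.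
    {a, b} \<in> cs_open s \<longrightarrow> {a', b'} \<in> cs_open s \<longrightarrow> {a, b} \<in> Ed \<longrightarrow> {a', b'} \<in> Ed)"

lemma pairs_between_parts:
  assumes P: "partition_on V P" "A \<in> P" "B \<in> P" "A0 \<in> P" "B0 \<in> P"
    and ab: "a \<in> A" "a' \<in> A" "b \<in> B" "b' \<in> B" and mem: "{a, b} \<in> pairs_between A0 B0"
  shows "{a', b'} \<in> pairs_between A0 B0"
proof -
  obtain x y where xy: "{a, b} = {x, y}" "x \<in> A0" "y \<in> B0" using mem by (auto simp: pairs_between_def)
  then consider "a = x" "b = y" | "a = y" "b = x" by (auto simp: doubleton_eq_iff)
  then show ?thesis
  proof cases
    case 1
    then have "a \<in> A0" "b \<in> B0" using xy by simp_all
    then have "A = A0" "B = B0"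
      using partition_part_unique[OF P(1,2,4) ab(1)] partition_part_unique[OF P(1,3,5) ab(3)] by simp_all
    then show ?thesis using ab by (auto simp: pairs_between_def)
  next
    case 2
    then have "a \<in> B0" "b \<in> A0" using xy by simp_all
    then have "A = B0" "B = A0"
      using partition_part_unique[OF P(1,2,5) ab(1)] partition_part_unique[OF P(1,3,4) ab(3)] by simp_all
    moreover have "{a', b'} = {b', a'}" by (rule insert_commute)
    ultimately show ?thesis using ab unfolding pairs_between_def by blast
  qed
qed

text \<open>Homogeneity is inherited backwards. A step that resolves \<open>{a, b}\<close> resolves \<open>{a', b'}\<close> in the same
way, and what it decides agrees with \<open>Ed\<close>. If neither pair is resolved, both are still unresolved
between the possibly larger parts of the next state.\<close>

lemma cs_step_homogeneous:
  assumes step: "cs_step s s'" and inv: "cs_inv V s" and hom: "homogeneous Ed s'"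
    and E: "cs_edges s' \<subseteq> Ed" and N: "cs_nonedges s' \<inter> Ed = {}"
  shows "homogeneous Ed s"
  unfolding homogeneous_def
proof (intro ballI impI)
  fix A B a a' b b'
  assume AB: "A \<in> cs_parts s" "B \<in> cs_parts s" and ab: "a \<in> A" "a' \<in> A" "b \<in> B" "b' \<in> B"
    and U: "{a, b} \<in> cs_open s" "{a', b'} \<in> cs_open s" and e: "{a, b} \<in> Ed"
  have part: "partition_on V (cs_parts s)" using inv by (auto simp: cs_inv_def cs_sel)
  have coarser: "\<forall>A\<in>cs_parts s. \<exists>A'\<in>cs_parts s'. A \<subseteq> A'"
    using cs_step_mono(1)[OF step] by (simp add: coarser_def)
  obtain A' where A': "A' \<in> cs_parts s'" "A \<subseteq> A'" using bspec[OF coarser AB(1)] by blast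
  obtain B' where B': "B' \<in> cs_parts s'" "B \<subseteq> B'" using bspec[OF coarser AB(2)] by blast
  have later: "{a', b'} \<in> Ed" if "{a, b} \<in> cs_open s'" "{a', b'} \<in> cs_open s'"
    using hom[unfolded homogeneous_def, rule_format, OF A'(1) B'(1) _ _ _ _ that e] ab A'(2) B'(2)
    by blast
  show "{a', b'} \<in> Ed"
    using step
  proof cases
    case (merge A P B E N U)
    then show ?thesis using later U by (simp add: cs_sel)
  next
    case (resolve_positive A0 P B0 E0 N0 U0)
    have A0: "A0 \<in> cs_parts s" "B0 \<in> cs_parts s" using resolve_positive by (simp_all add: cs_sel)
    have iff: "{a, b} \<in> pairs_between A0 B0 \<longleftrightarrow> {a', b'} \<in> pairs_between A0 B0"
      using pairs_between_parts[OF part AB A0 ab] pairs_between_parts[OF part AB A0 ab(2,1,4,3)] by (rule iffI)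
    show ?thesis
    proof (cases "{a, b} \<in> pairs_between A0 B0")
      case True
      then have "{a', b'} \<in> cs_edges s'" using iff U resolve_positive by (simp add: cs_sel)
      then show ?thesis using E by blast
    next
      case False
      then show ?thesis using iff U resolve_positive later by (simp add: cs_sel)
    qed
  next
    case (resolve_negative A0 P B0 E0 N0 U0)
    have A0: "A0 \<in> cs_parts s" "B0 \<in> cs_parts s" using resolve_negative by (simp_all add: cs_sel)
    have iff: "{a, b} \<in> pairs_between A0 B0 \<longleftrightarrow> {a', b'} \<in> pairs_between A0 B0"
      using pairs_between_parts[OF part AB A0 ab] pairs_between_parts[OF part AB A0 ab(2,1,4,3)] by (rule iffI)
    have "{a, b} \<notin> pairs_between A0 B0"
    proof
      assume "{a, b} \<in> pairs_between A0 B0"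
      then have "{a, b} \<in> cs_nonedges s'" using U resolve_negative by (simp add: cs_sel)
      then show False using N e by blast
    qed
    then show ?thesis using iff U resolve_negative later by (simp add: cs_sel)
  qed
qed

text \<open>The two sets are disjoint if they are completely joined, since there are no loops.\<close>

lemma no_biclique_sparse:
  assumes no: "\<not> contains_as_subgraph G (biclique t t)" and E: "edges G \<subseteq> [verts G]\<^bsup>2\<^esup>"
    and X: "X \<subseteq> verts G" "t \<le> card X" and Y: "Y \<subseteq> verts G" "t \<le> card Y"
  shows "\<exists>x\<in>X. \<exists>y\<in>Y. {x, y} \<notin> edges G"
proof (rule ccontr)
  assume "\<not> ?thesis"
  then have all: "\<And>x y. x \<in> X \<Longrightarrow> y \<in> Y \<Longrightarrow> {x, y} \<in> edges G" by blast
  have dis: "x \<noteq> y" if "x \<in> X" "y \<in> Y" for x y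
    using all[OF that] E by (auto simp: nsets_def dest!: subsetD)
  obtain X' Y' where X': "X' \<subseteq> X" "card X' = t" "finite X'" and Y': "Y' \<subseteq> Y" "card Y' = t" "finite Y'"
    using obtain_subset_with_card_n[OF X(2)] obtain_subset_with_card_n[OF Y(2)] by metis
  obtain f where f: "bij_betw f {..<t} X'"
    using X' ex_bij_betw_nat_finite[OF X'(3)] by (auto simp: atLeast0LessThan)
  obtain g where g: "bij_betw g {..<t} Y'"
    using Y' ex_bij_betw_nat_finite[OF Y'(3)] by (auto simp: atLeast0LessThan)
  have fX: "f i \<in> X" and gY: "g i \<in> Y" if "i < t" for i
    using f g that X'(1) Y'(1) by (auto simp: bij_betw_def)
  let ?h = "case_sum f g"
  have "inj_on ?h ({..<t} <+> {..<t})"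
  proof (rule inj_onI)
    fix x y assume xy: "x \<in> {..<t} <+> {..<t}" "y \<in> {..<t} <+> {..<t}" "?h x = ?h y"
    have "inj_on f {..<t}" "inj_on g {..<t}" using f g by (auto simp: bij_betw_def)
    then show "x = y" using xy dis fX gY by (cases x; cases y) (auto dest: inj_onD, (metis fX gY dis)+)
  qed
  moreover have "?h ` ({..<t} <+> {..<t}) \<subseteq> verts G" using fX gY X(1) Y(1) by auto
  moreover have "\<forall>e\<in>{{Inl i, Inr j} | i j. i < t \<and> j < t}. ?h ` e \<in> edges G"
    using all fX gY by auto
  ultimately have "contains_as_subgraph G (biclique t t)"
    unfolding contains_as_subgraph_def biclique_def fst_conv snd_conv by blast
  then show False using no by blast
qed

lemma reachable_parts_le_cs_width:
  assumes V: "finite V" and s: "s \<in> set ss" and v: "v \<in> V"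
  shows "card (reachable_parts V r s v) \<le> cs_width V r ss"
proof -
  let ?c = "\<lambda>(s, v). card (reachable_parts V r s v)"
  have "finite (?c ` (set ss \<times> V))" using V by simp
  then have "\<forall>s\<in>set ss. \<forall>v\<in>V. card (reachable_parts V r s v) \<le> Max (?c ` (set ss \<times> V))"
    using Max_ge by (metis (no_types, lifting) SigmaI case_prod_conv image_eqI)
  then have "\<forall>s\<in>set ss. \<forall>v\<in>V. card (reachable_parts V r s v) \<le> cs_width V r ss"
    unfolding cs_width_def by (rule LeastI)
  then show ?thesis using s v by blast
qed

lemma near_parts_le_cs_width:
  assumes V: "finite V" and ss: "s \<in> set ss" "cs_inv V s" and v: "v \<in> V"
  shows "card {A\<in>cs_parts s. \<exists>u\<in>A. \<exists>p. walk (cs_resolved s) v p u \<and> length p \<le> r + 1} \<le> cs_width V r ss"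
proof -
  obtain P E N U where s: "s = (P, E, N, U)" by (cases s)
  have EN: "E \<union> N \<subseteq> [V]\<^bsup>2\<^esup>" and part: "partition_on V P" using ss(2) by (auto simp: cs_inv_def s)
  have "{A\<in>cs_parts s. \<exists>u\<in>A. \<exists>p. walk (cs_resolved s) v p u \<and> length p \<le> r + 1} \<subseteq> reachable_parts V r s v"
  proof
    fix A assume "A \<in> {A\<in>cs_parts s. \<exists>u\<in>A. \<exists>p. walk (cs_resolved s) v p u \<and> length p \<le> r + 1}"
    then obtain u p where A: "A \<in> P" "u \<in> A" and p: "walk (E \<union> N) v p u" "length p \<le> r + 1"
      by (auto simp: cs_sel s)
    obtain q where q: "walk (E \<union> N) v q u" "distinct q" "set q \<subseteq> set p" "length q \<le> length p"
      using walk_shorten[OF p(1)] by blast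
    have "set q \<subseteq> V" using walk_in_vertices[OF EN q(1) v] .
    then have "is_path (V, E \<union> N) v q u" "path_length q \<le> r"
      using q p(2) by (auto simp: is_path_iff path_length_def)
    then show "A \<in> reachable_parts V r s v" using A by (auto simp: reachable_parts_def s)
  qed
  moreover have "finite (reachable_parts V r s v)"
    using finite_elements[OF V part] by (simp add: reachable_parts_def s)
  ultimately show ?thesis
    using order_trans[OF card_mono reachable_parts_le_cs_width[OF V ss(1) v]] by simp
qed

text \<open>The decisions of a construction sequence are never revised, so at all times the resolved pairs
agree with the final graph, and homogeneity propagates from the final state, where no pair is
unresolved, to all states.\<close>

lemma sparse_sequence_of_construction:
  assumes G: "finite_simple_graph G" and no: "\<not> contains_as_subgraph G (biclique t t)" and t: "t > 0"
    and cs: "construction_sequence G ss" and r: "r > 0" and width: "cs_width (verts G) r ss \<le> k"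
  shows "sparse_sequence (verts G) (edges G) (\<lambda>i. cs_parts (ss ! i)) (\<lambda>i. cs_resolved (ss ! i)) t k (length ss - 1)"
    "\<And>i. i < length ss \<Longrightarrow> cs_inv (verts G) (ss ! i)"
proof -
  define V Ed n where "V = verts G" and "Ed = edges G" and "n = length ss - 1"
  have V: "finite V" and E2: "Ed \<subseteq> [V]\<^bsup>2\<^esup>"
    using G by (auto simp: finite_simple_graph_def simple_graph_def V_def Ed_def)
  obtain P N where ss: "ss \<noteq> []" "hd ss = cs_initial V" "successively cs_step ss"
    "last ss = (P, Ed, N, {})" "card P \<le> 1"
    using cs by (auto simp: construction_sequence_def V_def Ed_def)
  have n: "length ss = Suc n" using ss(1) by (simp add: n_def)
  have s0: "ss ! 0 = cs_initial V" using ss(1,2) by (simp add: hd_conv_nth)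
  have sn: "ss ! n = (P, Ed, N, {})" using ss(1,4) by (simp add: last_conv_nth n_def)
  have step: "cs_step (ss ! i) (ss ! Suc i)" if "i < n" for i
    using ss(3) that n by (auto simp: successively_conv_nth)
  have inv: "cs_inv V (ss ! i)" if "i \<le> n" for i
    using that by (induction i) (auto simp: s0 cs_inv_initial intro: cs_step_inv[OF step])
  have mono: "coarser (cs_parts (ss ! i)) (cs_parts (ss ! j)) \<and> cs_edges (ss ! i) \<subseteq> cs_edges (ss ! j) \<and>
      cs_nonedges (ss ! i) \<subseteq> cs_nonedges (ss ! j)" if "i \<le> j" "j \<le> n" for i j
    using that
  proof (induction j rule: dec_induct)
    case base
    then show ?case by (auto simp: coarser_def)
  next
    case (step j)
    then have *: "cs_step (ss ! j) (ss ! Suc j)" using \<open>\<And>i. i < n \<Longrightarrow> _ i\<close> by simp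
    have IH: "coarser (cs_parts (ss ! i)) (cs_parts (ss ! j))" "cs_edges (ss ! i) \<subseteq> cs_edges (ss ! j)"
      "cs_nonedges (ss ! i) \<subseteq> cs_nonedges (ss ! j)" using step by auto
    have "coarser (cs_parts (ss ! i)) (cs_parts (ss ! Suc j))"
      unfolding coarser_def
    proof
      fix A assume "A \<in> cs_parts (ss ! i)"
      then obtain B where "B \<in> cs_parts (ss ! j)" "A \<subseteq> B" using IH(1) by (auto simp: coarser_def)
      moreover from this obtain C where "C \<in> cs_parts (ss ! Suc j)" "B \<subseteq> C"
        using cs_step_mono(1)[OF *] by (auto simp: coarser_def)
      ultimately show "\<exists>C\<in>cs_parts (ss ! Suc j). A \<subseteq> C" by blast
    qed
    then show ?case using IH cs_step_mono(2,3)[OF *] by blast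
  qed
  have EN: "cs_edges (ss ! i) \<subseteq> Ed" "cs_nonedges (ss ! i) \<inter> Ed = {}" if "i \<le> n" for i
  proof -
    have "cs_edges (ss ! n) = Ed" "cs_nonedges (ss ! n) = N" by (simp_all add: sn cs_sel)
    moreover have "Ed \<inter> N = {}" using inv[of n] by (simp add: sn cs_inv_def)
    ultimately show "cs_edges (ss ! i) \<subseteq> Ed" "cs_nonedges (ss ! i) \<inter> Ed = {}"
      using mono[OF that order_refl] by blast+
  qed
  have hom: "homogeneous Ed (ss ! i)" if "i \<le> n" for i
    using that
  proof (induction i rule: inc_induct)
    case base
    then show ?case by (simp add: sn homogeneous_def cs_sel)
  next
    case (step i)
    then have *: "cs_step (ss ! i) (ss ! Suc i)" "i \<le> n" "Suc i \<le> n" using \<open>\<And>i. i < n \<Longrightarrow> _ i\<close> by simp_all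
    show ?case using cs_step_homogeneous[OF *(1) inv[OF *(2)] step.IH EN[OF *(3)]] .
  qed
  have state: "sparse_state V Ed (cs_parts (ss ! i)) (cs_resolved (ss ! i)) t k" if i: "i \<le> n" for i
  proof
    obtain P E N U where s: "ss ! i = (P, E, N, U)" by (cases "ss ! i")
    have I: "partition_on V P" "E \<union> N \<union> U = [V]\<^bsup>2\<^esup>" using inv[OF i] by (auto simp: s cs_inv_def)
    show "finite V" by (rule V)
    show "Ed \<subseteq> [V]\<^bsup>2\<^esup>" by (rule E2)
    show "partition_on V (cs_parts (ss ! i))" using I(1) by (simp add: s cs_sel)
    show "t > 0" by (rule t)
    show "\<exists>x\<in>X. \<exists>y\<in>Y. {x, y} \<notin> Ed" if "X \<subseteq> V" "Y \<subseteq> V" "t \<le> card X" "t \<le> card Y" for X Y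
      using no_biclique_sparse[OF no E2[unfolded V_def Ed_def]] that by (simp add: V_def Ed_def)
    show "card {A \<in> cs_parts (ss ! i). \<exists>u\<in>A. {v, u} \<in> cs_resolved (ss ! i)} \<le> k" if v: "v \<in> V" for v
    proof -
      let ?N = "{A\<in>cs_parts (ss ! i). \<exists>u\<in>A. \<exists>p. walk (cs_resolved (ss ! i)) v p u \<and> length p \<le> r + 1}"
      have "{A \<in> cs_parts (ss ! i). \<exists>u\<in>A. {v, u} \<in> cs_resolved (ss ! i)} \<subseteq> ?N"
      proof
        fix A assume "A \<in> {A \<in> cs_parts (ss ! i). \<exists>u\<in>A. {v, u} \<in> cs_resolved (ss ! i)}"
        then obtain u where "A \<in> cs_parts (ss ! i)" "u \<in> A" "{v, u} \<in> cs_resolved (ss ! i)" by blast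
        moreover from this have "walk (cs_resolved (ss ! i)) v [v, u] u" "length [v, u] \<le> r + 1"
          using r by (auto simp: walk_Cons)
        ultimately show "A \<in> ?N" by blast
      qed
      moreover have "finite ?N" using finite_elements[OF V I(1)] by (simp add: s cs_sel)
      ultimately have "card {A \<in> cs_parts (ss ! i). \<exists>u\<in>A. {v, u} \<in> cs_resolved (ss ! i)} \<le> card ?N"
        by (rule card_mono[rotated])
      also have "\<dots> \<le> cs_width V r ss"
        using i n by (intro near_parts_le_cs_width[OF V _ inv[OF i] v]) simp
      finally show ?thesis using width by (simp add: V_def)
    qed
    show "{a', b'} \<in> Ed" if *: "A \<in> cs_parts (ss ! i)" "B \<in> cs_parts (ss ! i)" "a \<in> A" "a' \<in> A" "b \<in> B" "b' \<in> B"
      "{a, b} \<in> Ed - cs_resolved (ss ! i)" "a' \<noteq> b'" "{a', b'} \<notin> cs_resolved (ss ! i)" for A B a a' b b'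
    proof -
      have "{a, b} \<in> cs_open (ss ! i)" using *(7) E2 I(2) by (auto simp: s cs_sel)
      moreover have "a' \<in> V" "b' \<in> V" using * partition_part_subset[OF I(1)] by (auto simp: s cs_sel)
      then have "{a', b'} \<in> [V]\<^bsup>2\<^esup>" using *(8) by simp
      then have "{a', b'} \<in> E \<union> N \<union> U" unfolding I(2) .
      then have "{a', b'} \<in> cs_open (ss ! i)" using *(9) by (simp add: s cs_sel)
      ultimately show ?thesis
        using hom[OF i, unfolded homogeneous_def, rule_format, OF *(1-6)] *(7) by blast
    qed
  qed
  show "sparse_sequence (verts G) (edges G) (\<lambda>i. cs_parts (ss ! i)) (\<lambda>i. cs_resolved (ss ! i)) t k (length ss - 1)"
    unfolding V_def[symmetric] Ed_def[symmetric] n_def[symmetric]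
  proof (rule sparse_sequence.intro)
    show "\<And>i. i \<le> n \<Longrightarrow> sparse_state V Ed (cs_parts (ss ! i)) (cs_resolved (ss ! i)) t k" by (rule state)
    show "cs_resolved (ss ! i) \<subseteq> cs_resolved (ss ! j)" if "i \<le> j" "j \<le> n" for i j
      using mono[OF that] unfolding cs_resolved_def by blast
    show "coarser (cs_parts (ss ! i)) (cs_parts (ss ! j))" if "i \<le> j" "j \<le> n" for i j
      using mono[OF that] by blast
    show "\<exists>A1\<in>cs_parts (ss ! i). \<exists>A2\<in>cs_parts (ss ! i). A \<subseteq> A1 \<union> A2" if "i < n" "A \<in> cs_parts (ss ! Suc i)" for i A
      using cs_step_mono(4)[OF step[OF that(1)] that(2)] .
    show "card A \<le> 1" if "A \<in> cs_parts (ss ! 0)" for A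
      using that by (auto simp: s0 cs_initial_def cs_sel)
    show "card (cs_parts (ss ! n)) \<le> 1" using ss(5) by (simp add: sn cs_sel)
    show "Ed \<subseteq> cs_resolved (ss ! n)" by (simp add: sn cs_sel)
  qed
  show "\<And>i. i < length ss \<Longrightarrow> cs_inv (verts G) (ss ! i)" using inv n V_def by simp
qed

section \<open>Density of shallow minors and the equivalence\<close>

text \<open>Let \<open>m X\<close> be a vertex of \<open>X\<close> that settles last. Given an edge between \<open>X\<close> and \<open>Y\<close> where \<open>m X\<close>
settles no later than \<open>m Y\<close>, walk from \<open>m X\<close> inside \<open>X\<close> to the edge and then inside \<open>Y\<close> towards \<open>m
Y\<close>. The first vertex of \<open>Y\<close> on this walk that settles no earlier than \<open>m X\<close> is strongly reachable
from \<open>m X\<close>, and it determines \<open>Y\<close>. So the number of edges is at most the number of pairs of a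
branch set \<open>X\<close> and a vertex strongly reachable from \<open>m X\<close>.\<close>

lemma (in sparse_sequence) card_minor_edges:
  assumes W: "finite W" "disjoint W" and X: "\<And>X. X \<in> W \<Longrightarrow> X \<noteq> {} \<and> X \<subseteq> V"
    and walks: "\<And>X x y. X \<in> W \<Longrightarrow> x \<in> X \<Longrightarrow> y \<in> X \<Longrightarrow> \<exists>p. walk E x p y \<and> set p \<subseteq> X \<and> length p \<le> l"
    and F: "\<And>f. f \<in> F \<Longrightarrow> \<exists>X Y x y. f = {X, Y} \<and> X \<in> W \<and> Y \<in> W \<and> X \<noteq> Y \<and> x \<in> X \<and> y \<in> Y \<and> {x, y} \<in> E"
    and reach: "\<And>v. v \<in> V \<Longrightarrow> card (strong_reach (2 * l) v) \<le> b"
  shows "card F \<le> b * card W"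
proof -
  have "\<exists>m\<in>X. \<forall>x\<in>X. last_unsettled x \<le> last_unsettled m" if "X \<in> W" for X
  proof -
    have fin: "finite (last_unsettled ` X)" "last_unsettled ` X \<noteq> {}" using X[OF that] finV finite_subset by auto
    obtain m where "m \<in> X" "last_unsettled m = Max (last_unsettled ` X)" using Max_in[OF fin] by force
    then show ?thesis using Max_ge[OF fin(1)] by force
  qed
  then obtain m where m: "\<And>X. X \<in> W \<Longrightarrow> m X \<in> X" "\<And>X x. X \<in> W \<Longrightarrow> x \<in> X \<Longrightarrow> last_unsettled x \<le> last_unsettled (m X)"
    by metis
  define h where "h = (\<lambda>(X, u). {X, THE Y. Y \<in> W \<and> u \<in> Y})"
  have the: "(THE Y. Y \<in> W \<and> u \<in> Y) = Y" if "Y \<in> W" "u \<in> Y" for u Y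
    using that W(2) by (intro the_equality) (auto dest: disjointD)
  have key: "{X, Y} \<in> h ` (SIGMA X:W. strong_reach (2 * l) (m X))"
    if XY: "X \<in> W" "Y \<in> W" "x \<in> X" "y \<in> Y" "{x, y} \<in> E" "last_unsettled (m X) \<le> last_unsettled (m Y)" for X Y x y
  proof -
    obtain p where p: "walk E (m X) p x" "set p \<subseteq> X" "length p \<le> l" using walks XY m(1) by blast
    obtain q where q: "walk E y q (m Y)" "set q \<subseteq> Y" "length q \<le> l" using walks XY m(1) by blast
    have "m Y \<in> set q" using q(1) unfolding walk_def by (metis last_in_set)
    then obtain q1 u q2 where u: "q = q1 @ u # q2" "last_unsettled (m X) \<le> last_unsettled u"
      "\<forall>z\<in>set q1. \<not> last_unsettled (m X) \<le> last_unsettled z"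
      using split_list_first_prop[of q "\<lambda>z. last_unsettled (m X) \<le> last_unsettled z"] XY(6) by blast
    have pn: "p \<noteq> []" using p(1) by (auto simp: walk_def)
    have "walk E (m X) (p @ q) (m Y)" using walk_append[OF p(1) XY(5) q(1)] .
    then have w: "walk E (m X) ((p @ q1) @ [u]) u" using walk_prefix[of E "m X" "p @ q1" u q2 "m Y"] u(1) by simp
    have "u \<in> Y" using q(2) u(1) by auto
    moreover have "u \<in> strong_reach (2 * l) (m X)"
      unfolding strong_reach_def
    proof (intro CollectI conjI exI)
      show "u \<in> V" using \<open>u \<in> Y\<close> X[OF XY(2)] by blast
      show "last_unsettled (m X) \<le> last_unsettled u" by (rule u(2))
      show "p @ q1 \<noteq> []" using pn by simp
      show "walk E (m X) ((p @ q1) @ [u]) u" by (rule w)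
      show "length (p @ q1) \<le> 2 * l" using p(3) q(3) u(1) by simp
      show "set (p @ q1) \<subseteq> V" using p(2) q(2) u(1) X[OF XY(1)] X[OF XY(2)] by auto
      show "\<forall>x\<in>set (p @ q1). last_unsettled x \<le> last_unsettled (m X)"
        using p(2) m(2)[OF XY(1)] u(3) by (auto simp: not_le less_imp_le)
    qed
    ultimately show ?thesis
      using XY(1) the[OF XY(2)] by (intro image_eqI[of _ _ "(X, u)"]) (auto simp: h_def)
  qed
  have sub: "F \<subseteq> h ` (SIGMA X:W. strong_reach (2 * l) (m X))"
  proof
    fix f assume fF: "f \<in> F"
    obtain X Y x y where f: "f = {X, Y}" "X \<in> W" "Y \<in> W" "x \<in> X" "y \<in> Y" "{x, y} \<in> E"
      using F[OF fF] by blast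
    have e': "{y, x} \<in> E" "f = {Y, X}" using f(1,6) by (simp_all add: insert_commute)
    show "f \<in> h ` (SIGMA X:W. strong_reach (2 * l) (m X))"
    proof (cases "last_unsettled (m X) \<le> last_unsettled (m Y)")
      case True
      then show ?thesis unfolding f(1) by (rule key[OF f(2-6)])
    next
      case False
      then have "last_unsettled (m Y) \<le> last_unsettled (m X)" by simp
      then show ?thesis unfolding e'(2) by (rule key[OF f(3,2,5,4) e'(1)])
    qed
  qed
  have fin: "finite (strong_reach (2 * l) v)" for v using finV by (simp add: strong_reach_def)
  have "card F \<le> card (SIGMA X:W. strong_reach (2 * l) (m X))"
    by (rule surj_card_le[OF _ sub]) (use W fin in auto)
  also have "\<dots> = (\<Sum>X\<in>W. card (strong_reach (2 * l) (m X)))" using W fin by simp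
  also have "\<dots> \<le> (\<Sum>X\<in>W. b)" using reach m(1) X by (intro sum_mono) blast
  finally show ?thesis by (simp add: mult.commute)
qed

theorem corollary1p8:
  fixes C :: "'a graph set"
  assumes "\<And>G. G \<in> C \<Longrightarrow> finite_simple_graph G"
  shows "bounded_expansion C \<longleftrightarrow> bounded_merge_width C \<and> weakly_sparse C"
proof
  assume "bounded_expansion C"
  then show "bounded_merge_width C \<and> weakly_sparse C"
    using bounded_expansion_imp_bounded_merge_width[OF _ assms]
      bounded_expansion_imp_weakly_sparse[OF _ assms] by (intro conjI)
next
  assume "bounded_merge_width C \<and> weakly_sparse C"
  then have mw: "bounded_merge_width C" and ws: "weakly_sparse C" by simp_all
  show "bounded_expansion C"
    unfolding bounded_expansion_def
  proof
    fix r :: nat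
    define l where "l = 2 * r + 1"
    \<comment> \<open>Branch sets have walks with at most \<open>l\<close> vertices, strong reachability is needed for \<open>2 * l\<close>
      steps, and each step costs up to three resolved pairs.\<close>
    define \<rho> where "\<rho> = 3 * (2 * l)"
    obtain t0 where t0: "\<And>G. G \<in> C \<Longrightarrow> \<not> contains_as_subgraph G (biclique t0 t0)"
      using ws by (auto simp: weakly_sparse_def)
    have t: "t0 > 0" if "G \<in> C" for G
    proof (rule ccontr)
      assume "\<not> t0 > 0"
      then have "contains_as_subgraph G (biclique t0 t0)"
        by (auto simp: contains_as_subgraph_def biclique_def Plus_def)
      then show False using t0 that by blast
    qed
    have "(SUP G\<in>C. merge_width \<rho> G) < \<infinity>" using mw by (auto simp: bounded_merge_width_def)
    then obtain k where k: "(SUP G\<in>C. merge_width \<rho> G) = enat k" by auto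
    define b where "b = strong_bound t0 k"
    have main: "real (card (edges (contract G' \<B>))) \<le> real b * real (card (verts (contract G' \<B>)))"
      if G: "G \<in> C" and sub: "subgraph G' G" and con: "contractible r G' \<B>" for G G' \<B>
    proof -
      have fsg: "finite_simple_graph G" using assms G .
      then have V: "finite (verts G)" by (simp add: finite_simple_graph_def)
      have "merge_width \<rho> G \<le> enat k" using SUP_upper[OF G, of "merge_width \<rho>"] k by simp
      then have "merge_width \<rho> G < enat (Suc k)" by (meson enat_ord_simps(2) le_less_trans lessI)
      then obtain ss where ss: "construction_sequence G ss" "cs_width (verts G) \<rho> ss \<le> k"
        unfolding merge_width_def by (auto simp: INF_less_iff less_Suc_eq_le)
      have \<rho>: "\<rho> > 0" by (simp add: \<rho>_def l_def)
      note seq = sparse_sequence_of_construction[OF fsg t0[OF G] t[OF G] ss(1) \<rho> ss(2)]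
      interpret sparse_sequence "verts G" "edges G" "\<lambda>i. cs_parts (ss ! i)" "\<lambda>i. cs_resolved (ss ! i)" t0 k "length ss - 1"
        by (rule seq(1))
      have ne: "ss \<noteq> []" using ss(1) by (simp add: construction_sequence_def)
      have reach: "card (strong_reach (2 * l) v) \<le> b" if v: "v \<in> verts G" for v
        unfolding b_def
      proof (rule card_strong_reach[OF v])
        fix j assume "j \<le> length ss - 1"
        then have j: "j < length ss" using ne by (simp add: Suc_le_eq le_less_trans)
        show "card (near_parts (3 * (2 * l) + 1) j v) \<le> k"
          using near_parts_le_cs_width[OF V nth_mem[OF j] seq(2)[OF j] v, of \<rho>] ss(2)
          unfolding near_parts_def \<rho>_def by (rule order_trans)
      qed
      let ?W = "verts (contract G' \<B>)"
      have G': "verts G' \<subseteq> verts G" "edges G' \<subseteq> edges G" using sub by (auto simp: subgraph_def)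
      note W = contract_vertices[OF con]
      have "?W \<subseteq> Pow (verts G)" using W(2) G'(1) by blast
      then have finW: "finite ?W" using V by (simp add: finite_subset)
      have "card (edges (contract G' \<B>)) \<le> b * card ?W"
      proof (rule card_minor_edges[OF finW W(1)])
        show "X \<noteq> {} \<and> X \<subseteq> verts G" if "X \<in> ?W" for X using W(2)[OF that] G'(1) by blast
        show "\<exists>p. walk (edges G) x p y \<and> set p \<subseteq> X \<and> length p \<le> l" if "X \<in> ?W" "x \<in> X" "y \<in> X" for X x y
          using contract_vertex_walks[OF con that] walk_mono[OF _ G'(2)] unfolding l_def by blast
        show "\<exists>X Y x y. f = {X, Y} \<and> X \<in> ?W \<and> Y \<in> ?W \<and> X \<noteq> Y \<and> x \<in> X \<and> y \<in> Y \<and> {x, y} \<in> edges G"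
          if "f \<in> edges (contract G' \<B>)" for f
          using that G'(2) unfolding contract_def Let_def fst_conv snd_conv by blast
      qed (rule reach)
      then show ?thesis by (simp flip: of_nat_mult)
    qed
    then show "\<exists>k::real. \<forall>G\<in>C. \<forall>G' \<B>. subgraph G' G \<longrightarrow> contractible r G' \<B> \<longrightarrow>
          real (card (edges (contract G' \<B>))) \<le> k * real (card (verts (contract G' \<B>)))"
      by blast
  qed
qed

end
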